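(* For every integer $k \geq 3$, the following decision problem is NP-complete: given a connected split graph $G$, decide whether $\mathrm{src}(G) \leq k$.
   Context: All graphs are finite, simple, undirected and connected. A split graph is a graph whose vertex set can be partitioned into a clique and an independent set. Given a (not necessarily proper) coloring of the edges of a graph $G$, a path is rainbow if no two of its edges have the same color. An edge-colored graph $G$ is strongly rainbow-connected if between every pair of vertices there is a shortest path (in $G$) that is rainbow. The strong rainbow connection number $\mathrm{src}(G)$ is the minimum number of colors in an edge-coloring making $G$ strongly rainbow-connected. *)

theory Defs
  imports "HOL-Computational_Algebra.Polynomial"
begin

section \<open>Simple graphs and strong rainbow connection\<close>

definition simple_graph :: "'a set \<Rightarrow> 'a set set \<Rightarrow> bool" where
  "simple_graph V E \<longleftrightarrow> finite V \<and> (\<forall>e\<in>E. e \<subseteq> V \<and> card e = 2)"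

definition path_between :: "'a set \<Rightarrow> 'a set set \<Rightarrow> 'a \<Rightarrow> 'a \<Rightarrow> 'a list \<Rightarrow> bool" where
  "path_between V E u v xs \<longleftrightarrow>
     xs \<noteq> [] \<and> hd xs = u \<and> last xs = v \<and> set xs \<subseteq> V \<and> distinct xs \<and>
     successively (\<lambda>a b. {a, b} \<in> E) xs"

definition connected_graph :: "'a set \<Rightarrow> 'a set set \<Rightarrow> bool" where
  "connected_graph V E \<longleftrightarrow> V \<noteq> {} \<and> (\<forall>u\<in>V. \<forall>v\<in>V. \<exists>xs. path_between V E u v xs)"

definition split_graph :: "'a set \<Rightarrow> 'a set set \<Rightarrow> bool" where
  "split_graph V E \<longleftrightarrow>
     (\<exists>K I. K \<union> I = V \<and> K \<inter> I = {} \<and>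
        (\<forall>u\<in>K. \<forall>v\<in>K. u \<noteq> v \<longrightarrow> {u, v} \<in> E) \<and>
        (\<forall>u\<in>I. \<forall>v\<in>I. {u, v} \<notin> E))"

definition shortest_path :: "'a set \<Rightarrow> 'a set set \<Rightarrow> 'a \<Rightarrow> 'a \<Rightarrow> 'a list \<Rightarrow> bool" where
  "shortest_path V E u v xs \<longleftrightarrow>
     path_between V E u v xs \<and>
     (\<forall>ys. path_between V E u v ys \<longrightarrow> length xs \<le> length ys)"

definition path_edges :: "'a list \<Rightarrow> 'a set list" where
  "path_edges xs = map2 (\<lambda>a b. {a, b}) xs (tl xs)"

definition rainbow :: "('a set \<Rightarrow> 'c) \<Rightarrow> 'a list \<Rightarrow> bool" where
  "rainbow c xs \<longleftrightarrow> distinct (map c (path_edges xs))"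

definition strongly_rainbow_connected ::
    "'a set \<Rightarrow> 'a set set \<Rightarrow> ('a set \<Rightarrow> 'c) \<Rightarrow> bool" where
  "strongly_rainbow_connected V E c \<longleftrightarrow>
     (\<forall>u\<in>V. \<forall>v\<in>V. \<exists>xs. shortest_path V E u v xs \<and> rainbow c xs)"

definition src :: "'a set \<Rightarrow> 'a set set \<Rightarrow> nat" where
  "src V E =
     (LEAST m. \<exists>c :: 'a set \<Rightarrow> nat. card (c ` E) = m \<and> strongly_rainbow_connected V E c)"


section \<open>Deterministic multi-tape Turing machines\<close>

text \<open>
  States and tape symbols are initial segments of the natural numbers.  The start state is 0;
  symbol 0 is the blank, and symbols 1 and 2 are the input bits.  The machine halts when the
  transition function yields \<open>None\<close>.  Tapes are infinite in both directions and are
  given by their contents and the position of the head.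
\<close>

datatype dir = Lft | Stay | Rgt

record tm =
  tapes :: nat
  states :: nat
  symbols :: nat
  trans :: "nat \<Rightarrow> nat list \<Rightarrow> (nat \<times> (nat \<times> dir) list) option"

definition wf_tm :: "tm \<Rightarrow> bool" where
  "wf_tm M \<longleftrightarrow> tapes M \<ge> 1 \<and> states M \<ge> 1 \<and> symbols M \<ge> 3 \<and>
     (\<forall>q ss q' as. q < states M \<and> length ss = tapes M \<and> set ss \<subseteq> {..<symbols M} \<and>
        trans M q ss = Some (q', as) \<longrightarrow>
        q' < states M \<and> length as = tapes M \<and> fst ` set as \<subseteq> {..<symbols M})"

type_synonym tape = "(int \<Rightarrow> nat) \<times> int"
type_synonym config = "nat \<times> tape list"

fun read_tape :: "tape \<Rightarrow> nat" where
  "read_tape (t, h) = t h"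

fun move_head :: "dir \<Rightarrow> int \<Rightarrow> int" where
  "move_head Lft h = h - 1"
| "move_head Stay h = h"
| "move_head Rgt h = h + 1"

fun act :: "nat \<times> dir \<Rightarrow> tape \<Rightarrow> tape" where
  "act (s, d) (t, h) = (t(h := s), move_head d h)"

fun halted :: "tm \<Rightarrow> config \<Rightarrow> bool" where
  "halted M (q, ts) \<longleftrightarrow> trans M q (map read_tape ts) = None"

fun step :: "tm \<Rightarrow> config \<Rightarrow> config" where
  "step M (q, ts) =
     (case trans M q (map read_tape ts) of
        None \<Rightarrow> (q, ts)
      | Some (q', as) \<Rightarrow> (q', map2 act as ts))"

definition bit_symbol :: "bool \<Rightarrow> nat" where
  "bit_symbol b = (if b then 2 else 1)"

definition word_tape :: "bool list \<Rightarrow> tape" where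
  "word_tape w =
     ((\<lambda>i. if 0 \<le> i \<and> i < int (length w) then bit_symbol (w ! nat i) else 0), 0)"

text \<open>A tuple of input words is written on the first tapes, one word per tape.\<close>

definition init_config :: "tm \<Rightarrow> bool list list \<Rightarrow> config" where
  "init_config M ws = (0, map word_tape (ws @ replicate (tapes M - length ws) []))"

text \<open>The output is the word starting at the head of the first tape and ending before the
  next blank.\<close>

fun shows_word :: "tape \<Rightarrow> bool list \<Rightarrow> bool" where
  "shows_word (t, h) y \<longleftrightarrow>
     (\<forall>i<length y. t (h + int i) = bit_symbol (y ! i)) \<and> t (h + int (length y)) = 0"

definition computes_within :: "tm \<Rightarrow> bool list list \<Rightarrow> nat \<Rightarrow> bool list \<Rightarrow> bool" where
  "computes_within M ws T y \<longleftrightarrow>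
     (let c = (step M ^^ T) (init_config M ws) in halted M c \<and> shows_word (snd c ! 0) y)"


section \<open>Polynomial time, NP, and NP-completeness\<close>

text \<open>Only the values of \<open>f\<close> on tuples of \<open>a\<close> words are relevant.\<close>

definition polytime :: "nat \<Rightarrow> (bool list list \<Rightarrow> bool list) \<Rightarrow> bool" where
  "polytime a f \<longleftrightarrow>
     (\<exists>M (p :: nat poly). wf_tm M \<and> a \<le> tapes M \<and>
        (\<forall>ws. length ws = a \<longrightarrow>
           computes_within M ws (poly p (sum_list (map length ws))) (f ws)))"

definition NP :: "bool list set set" where
  "NP = {L. \<exists>V (p :: nat poly). polytime 2 V \<and>
           (\<forall>x. x \<in> L \<longleftrightarrow> (\<exists>u. length u \<le> poly p (length x) \<and> V [x, u] = [True]))}"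

definition polytime_reducible :: "bool list set \<Rightarrow> bool list set \<Rightarrow> bool" where
  "polytime_reducible A B \<longleftrightarrow>
     (\<exists>f. polytime 1 (\<lambda>ws. f (ws ! 0)) \<and> (\<forall>x. x \<in> A \<longleftrightarrow> f x \<in> B))"

definition NP_hard :: "bool list set \<Rightarrow> bool" where
  "NP_hard L \<longleftrightarrow> (\<forall>A\<in>NP. polytime_reducible A L)"

definition NP_complete :: "bool list set \<Rightarrow> bool" where
  "NP_complete L \<longleftrightarrow> L \<in> NP \<and> NP_hard L"


section \<open>The decision problem\<close>

text \<open>A graph on the vertices \<open>0, \<dots>, n - 1\<close> is encoded by \<open>n\<close> in unary, a
  delimiter, and its adjacency matrix, row by row.\<close>

definition encode_graph :: "nat \<Rightarrow> nat set set \<Rightarrow> bool list" where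
  "encode_graph n E =
     replicate n True @ [False] @
     concat (map (\<lambda>i. map (\<lambda>j. {i, j} \<in> E) [0..<n]) [0..<n])"

definition split_src_problem :: "nat \<Rightarrow> bool list set" where
  "split_src_problem k =
     {encode_graph n E | n E.
        simple_graph {..<n} E \<and> connected_graph {..<n} E \<and> split_graph {..<n} E \<and>
        src {..<n} E \<le> k}"

end

theory Submission
  imports Defs
begin

text \<open>
  Membership: a split graph is connected with \<open>src \<le> k\<close> iff some colouring with \<open>k\<close> colours gives
  every pair of vertices at distance two or three a rainbow shortest path, a first-order
  condition on the adjacency matrix.  Hardness: an accepting computation, written down relative to
  the heads, is described by clauses; satisfiability of clauses reduces to colourability with \<open>k\<close>
  colours; and a graph is turned into a split graph by making its vertices independent and joining
  all of them to one clique vertex, whose edges then carry the colouring, while non-adjacent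
  pairs get a further clique vertex as a second common neighbour.  Both the certificate check and
  the entries of the adjacency matrix produced by the reduction are given by expressions built from
  arithmetic, input symbols and bounded sums, and such expressions are evaluated once and for all
  by a Turing machine whose head positions serve as unary counters.
\<close>

section \<open>Structured programs on tapes\<close>

text \<open>The obstacle is that polynomial time has to be shown for concrete machines, for the
  verifier as well as for the reduction. Therefore every object is numbered so that one bit of an
  output is a closed formula in its position, the input length and single input symbols: vertices
  and clauses are coded in mixed radix and decoded by \<open>div\<close> and \<open>mod\<close>, and
  all quantifiers are bounded. With tapes centred at their heads, no clause mentions a head
  position, and the control state is simply the symbol on one more tape, so a single kind of clause
  describes a step. The width of the clauses is a constant depending on the machine; clauses are
  never cut down to three literals, because the colouring gadget passes a state along a clause of
  any width. No clause says that a cell carries at most one symbol: the clauses force the true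
  symbol to be marked, and the final clauses forbid all wrong ones. Three colours are needed for
  false, true and neutral.\<close>

text \<open>The loop \<open>While i s c\<close> runs as long as the symbol under head \<open>i\<close> differs from \<open>s\<close>.\<close>

datatype cmd =
    Mv nat dir
  | Wr nat nat
  | Seq cmd cmd (infixr ";;" 60)
  | While nat nat cmd
  | If nat nat cmd cmd

fun next_cmds :: "cmd \<Rightarrow> cmd list \<Rightarrow> (nat \<Rightarrow> nat) \<Rightarrow> cmd list" where
  "next_cmds (Seq a b) ks r = a # b # ks"
| "next_cmds (While i s c) ks r = (if r i = s then ks else c # While i s c # ks)"
| "next_cmds (If i s a b) ks r = (if r i = s then a # ks else b # ks)"
| "next_cmds _ ks r = ks"

text \<open>A step acts on all tapes at once, so a tape that is not addressed rewrites the symbol it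
  reads. Control commands leave every tape as it is but still take one step, which is the source of
  the \<open>+ 1\<close> in the time bounds.\<close>

fun action :: "cmd \<Rightarrow> nat \<Rightarrow> nat \<Rightarrow> nat \<times> dir" where
  "action (Mv j d) i s = (s, if i = j then d else Stay)"
| "action (Wr j a) i s = (if i = j then a else s, Stay)"
| "action _ i s = (s, Stay)"

fun cmd_step :: "cmd list \<times> (nat \<Rightarrow> tape) \<Rightarrow> cmd list \<times> (nat \<Rightarrow> tape)" where
  "cmd_step ([], \<sigma>) = ([], \<sigma>)"
| "cmd_step (c # ks, \<sigma>) =
     (next_cmds c ks (\<lambda>i. read_tape (\<sigma> i)), \<lambda>i. act (action c i (read_tape (\<sigma> i))) (\<sigma> i))"

text \<open>One \<open>t\<close> has to serve all continuations \<open>ks\<close>, so that a run of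
  \<open>c\<close> can be put in front of whatever follows; this makes the rules for
  \<open>Seq\<close> and \<open>While\<close> compositional.\<close>

definition runs :: "cmd \<Rightarrow> (nat \<Rightarrow> tape) \<Rightarrow> (nat \<Rightarrow> tape) \<Rightarrow> nat \<Rightarrow> bool" where
  "runs c \<sigma> \<sigma>' B \<longleftrightarrow> (\<exists>t\<le>B. \<forall>ks. (cmd_step ^^ t) (c # ks, \<sigma>) = (ks, \<sigma>'))"

lemma act_read_stay [simp]: "act (read_tape T, Stay) T = T"
  by (cases T) auto

lemma runs_mono: "runs c \<sigma> \<sigma>' B \<Longrightarrow> B \<le> B' \<Longrightarrow> runs c \<sigma> \<sigma>' B'"
  unfolding runs_def using le_trans by blast

lemma runs_Mv: "runs (Mv i d) \<sigma> (\<sigma>(i := act (read_tape (\<sigma> i), d) (\<sigma> i))) 1"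
  unfolding runs_def by (intro exI[of _ 1]) (auto simp: fun_eq_iff)

lemma runs_Wr: "runs (Wr i s) \<sigma> (\<sigma>(i := act (s, Stay) (\<sigma> i))) 1"
  unfolding runs_def by (intro exI[of _ 1]) (auto simp: fun_eq_iff)

lemma runs_Seq:
  assumes "runs a \<sigma> \<sigma>1 A" and "runs b \<sigma>1 \<sigma>2 B"
  shows "runs (a ;; b) \<sigma> \<sigma>2 (A + B + 1)"
proof -
  obtain s where s: "s \<le> A" "\<And>ks. (cmd_step ^^ s) (a # ks, \<sigma>) = (ks, \<sigma>1)"
    using assms(1) unfolding runs_def by blast
  obtain t where t: "t \<le> B" "\<And>ks. (cmd_step ^^ t) (b # ks, \<sigma>1) = (ks, \<sigma>2)"
    using assms(2) unfolding runs_def by blast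
  have "(cmd_step ^^ (t + (s + 1))) ((a ;; b) # ks, \<sigma>) = (ks, \<sigma>2)" for ks
    by (simp add: funpow_add s t funpow_swap1)
  then show ?thesis
    unfolding runs_def using s(1) t(1) by (intro exI[of _ "t + (s + 1)"]) auto
qed

lemma runs_If:
  assumes "read_tape (\<sigma> i) = s \<Longrightarrow> runs a \<sigma> \<sigma>' B"
    and "read_tape (\<sigma> i) \<noteq> s \<Longrightarrow> runs b \<sigma> \<sigma>' B"
  shows "runs (If i s a b) \<sigma> \<sigma>' (B + 1)"
proof -
  let ?c = "if read_tape (\<sigma> i) = s then a else b"
  have "runs ?c \<sigma> \<sigma>' B"
    using assms by auto
  then obtain t where t: "t \<le> B" "\<And>ks. (cmd_step ^^ t) (?c # ks, \<sigma>) = (ks, \<sigma>')"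
    unfolding runs_def by blast
  have "(cmd_step ^^ (t + 1)) (If i s a b # ks, \<sigma>) = (ks, \<sigma>')" for ks
    using t(2)[of ks] by (auto simp: funpow_swap1)
  then show ?thesis
    unfolding runs_def using t(1) by (intro exI[of _ "t + 1"]) auto
qed

text \<open>Instead of an invariant, \<open>S\<close> gives the exact tapes at the start of every
  round. A round costs its body and one test, and the last test ends the loop.\<close>

lemma runs_While:
  assumes "\<And>j. j < n \<Longrightarrow> read_tape (S j i) \<noteq> s"
    and "read_tape (S n i) = s"
    and "\<And>j. j < n \<Longrightarrow> runs c (S j) (S (Suc j)) B"
  shows "runs (While i s c) (S 0) (S n) (n * (B + 1) + 1)"
  using assms
proof (induction n arbitrary: S)
  case 0
  then show ?case
    unfolding runs_def by (intro exI[of _ 1]) auto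
next
  case (Suc n)
  have "runs (While i s c) (S (Suc 0)) (S (Suc n)) (n * (B + 1) + 1)"
    using Suc.IH[of "\<lambda>j. S (Suc j)"] Suc.prems by auto
  then obtain t where
    t: "t \<le> n * (B + 1) + 1" "\<And>ks. (cmd_step ^^ t) (While i s c # ks, S (Suc 0)) = (ks, S (Suc n))"
    unfolding runs_def by blast
  obtain u where u: "u \<le> B" "\<And>ks. (cmd_step ^^ u) (c # ks, S 0) = (ks, S (Suc 0))"
    using Suc.prems(3)[of 0] unfolding runs_def by auto
  have "(cmd_step ^^ (t + (u + 1))) (While i s c # ks, S 0) = (ks, S (Suc n))" for ks
    using Suc.prems(1)[of 0] by (simp add: funpow_add t u funpow_swap1)
  then show ?case
    unfolding runs_def using t(1) u(1) by (intro exI[of _ "t + (u + 1)"]) auto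
qed


section \<open>Compiling programs to Turing machines\<close>

fun cmd_ok :: "nat \<Rightarrow> cmd \<Rightarrow> bool" where
  "cmd_ok N (Mv i d) \<longleftrightarrow> i < N"
| "cmd_ok N (Wr i s) \<longleftrightarrow> i < N \<and> s < 3"
| "cmd_ok N (Seq a b) \<longleftrightarrow> cmd_ok N a \<and> cmd_ok N b"
| "cmd_ok N (While i s c) \<longleftrightarrow> i < N \<and> cmd_ok N c"
| "cmd_ok N (If i s a b) \<longleftrightarrow> i < N \<and> cmd_ok N a \<and> cmd_ok N b"

lemma cmd_ok_mono: "cmd_ok N c \<Longrightarrow> N \<le> N' \<Longrightarrow> cmd_ok N' c"
  by (induction c) auto

text \<open>The control states of the machine are the continuations that can arise during a run;
  there are finitely many of them.\<close>

fun conts :: "cmd \<Rightarrow> cmd list \<Rightarrow> cmd list set" where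
  "conts (Seq a b) ks = {(a ;; b) # ks} \<union> conts a (b # ks) \<union> conts b ks"
| "conts (While i s c) ks = {While i s c # ks} \<union> conts c (While i s c # ks)"
| "conts (If i s a b) ks = {If i s a b # ks} \<union> conts a ks \<union> conts b ks"
| "conts c ks = {c # ks}"

lemma finite_conts: "finite (conts c ks)"
  by (induction c arbitrary: ks) auto

lemma start_in_conts: "c # ks \<in> conts c ks"
  by (cases c) auto

text \<open>For \<open>ks = []\<close> this says that the finite set \<open>conts c []\<close>,
  together with the halting state \<open>[]\<close>, is closed under steps.\<close>

lemma conts_closed:
  "d # l \<in> conts c ks \<Longrightarrow> next_cmds d l r \<in> conts c ks \<union> {ks}"
  by (induction c arbitrary: ks) (fastforce simp: start_in_conts split: if_splits)+

lemma conts_ok: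
  "cmd_ok N c \<Longrightarrow> d # l \<in> conts c ks \<Longrightarrow> cmd_ok N d \<or> d # l = ks"
proof (induction c arbitrary: ks)
  case (Seq a b)
  then show ?case
    by (metis (no_types, lifting) Un_iff cmd_ok.simps(3) conts.simps(1) list.inject singletonD)
qed fastforce+

locale compilation =
  fixes c :: cmd and N :: nat
  assumes ok: "cmd_ok N c" and N: "N \<ge> 1"
begin

text \<open>The position in this list is the number of the state; \<open>[c]\<close> comes first
  because machines start in state 0.\<close>

definition pts :: "cmd list list" where
  "pts = (SOME xs. distinct xs \<and> set xs = conts c [] \<union> {[]} \<and> xs ! 0 = [c])"

lemma pts: "distinct pts" "set pts = conts c [] \<union> {[]}" "pts ! 0 = [c]"
proof -
  obtain xs where xs: "set xs = (conts c [] \<union> {[]}) - {[c]}" "distinct xs"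
    using finite_distinct_list[of "(conts c [] \<union> {[]}) - {[c]}"] by (auto simp: finite_conts)
  have "distinct ([c] # xs) \<and> set ([c] # xs) = conts c [] \<union> {[]} \<and> ([c] # xs) ! 0 = [c]"
    using xs start_in_conts[of c "[]"] by auto
  then have "distinct pts \<and> set pts = conts c [] \<union> {[]} \<and> pts ! 0 = [c]"
    unfolding pts_def by (rule someI)
  then show "distinct pts" "set pts = conts c [] \<union> {[]}" "pts ! 0 = [c]"
    by auto
qed

definition ix :: "cmd list \<Rightarrow> nat" where
  "ix ks = (THE q. q < length pts \<and> pts ! q = ks)"

lemma ix: "ks \<in> set pts \<Longrightarrow> ix ks < length pts \<and> pts ! ix ks = ks"
  unfolding ix_def
  by (rule theI') (metis in_set_conv_nth nth_eq_iff_index_eq pts(1))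

lemma ix_start: "ix [c] = 0"
proof -
  have "[c] \<in> set pts"
    using start_in_conts pts(2) by auto
  then show ?thesis
    using ix[of "[c]"] pts(1,3) nth_eq_iff_index_eq by (metis gr_zeroI less_nat_zero_code list.size(3) length_pos_if_in_set)
qed

definition machine :: tm where
  "machine = \<lparr>tapes = N, states = length pts, symbols = 3,
     trans = (\<lambda>q ss. case pts ! q of
         [] \<Rightarrow> None
       | d # ks \<Rightarrow> Some (ix (next_cmds d ks (\<lambda>i. ss ! i)),
                       map (\<lambda>i. action d i (ss ! i)) [0..<N]))\<rparr>"

lemma next_in_pts: "d # ks \<in> set pts \<Longrightarrow> next_cmds d ks r \<in> set pts"
  using conts_closed[of d ks c "[]" r] pts(2) by auto

lemma ok_pts: "d # ks \<in> set pts \<Longrightarrow> cmd_ok N d"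
  using conts_ok[OF ok, of d ks "[]"] pts(2) by auto

lemma wf_machine: "wf_tm machine"
proof -
  have "pts \<noteq> []"
    using pts(2) by auto
  then have len: "1 \<le> length pts"
    by (simp add: Suc_leI)
  show ?thesis
    unfolding wf_tm_def
  proof (intro conjI allI impI)
    fix q ss q' as
    assume a: "q < states machine \<and> length ss = tapes machine \<and> set ss \<subseteq> {..<symbols machine} \<and>
      trans machine q ss = Some (q', as)"
    obtain d ks where d: "pts ! q = d # ks"
      and q': "q' = ix (next_cmds d ks (\<lambda>i. ss ! i))" and as: "as = map (\<lambda>i. action d i (ss ! i)) [0..<N]"
      using a by (auto simp: machine_def split: list.splits)
    have mem: "d # ks \<in> set pts"
      using d a nth_mem[of q pts] by (simp add: machine_def)
    show "q' < states machine"
      using ix[OF next_in_pts[OF mem]] by (simp add: q' machine_def)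
    show "length as = tapes machine"
      by (simp add: as machine_def)
    have "fst (action d i (ss ! i)) < 3" if "i < N" for i
    proof -
      have "ss ! i < 3"
        using a that by (auto simp: machine_def subset_iff)
      then show ?thesis
        using ok_pts[OF mem] by (cases d) auto
    qed
    then show "fst ` set as \<subseteq> {..<symbols machine}"
      by (auto simp: as machine_def)
  qed (use N len in \<open>auto simp: machine_def\<close>)
qed

definition conf :: "cmd list \<times> (nat \<Rightarrow> tape) \<Rightarrow> config" where
  "conf = (\<lambda>(ks, \<sigma>). (ix ks, map \<sigma> [0..<N]))"

lemma next_cmds_cong:
  "cmd_ok N d \<Longrightarrow> (\<And>i. i < N \<Longrightarrow> r i = r' i) \<Longrightarrow> next_cmds d ks r = next_cmds d ks r'"
  by (cases d) auto

lemma step_conf: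
  assumes "ks \<in> set pts"
  shows "step machine (conf (ks, \<sigma>)) = conf (cmd_step (ks, \<sigma>)) \<and> fst (cmd_step (ks, \<sigma>)) \<in> set pts"
proof (cases ks)
  case Nil
  then show ?thesis
    using ix[OF assms] assms by (simp add: conf_def machine_def)
next
  case (Cons d l)
  let ?r = "\<lambda>i. map read_tape (map \<sigma> [0..<N]) ! i"
  have "next_cmds d l ?r = next_cmds d l (\<lambda>i. read_tape (\<sigma> i))"
    by (rule next_cmds_cong) (use ok_pts assms Cons in auto)
  then have "step machine (conf (ks, \<sigma>)) = conf (cmd_step (ks, \<sigma>))"
    using ix[OF assms] Cons
    by (auto simp: conf_def machine_def intro!: nth_equalityI)
  then show ?thesis
    using Cons next_in_pts assms by simp
qed

lemma steps_conf:
  assumes "ks \<in> set pts"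
  shows "(step machine ^^ t) (conf (ks, \<sigma>)) = conf ((cmd_step ^^ t) (ks, \<sigma>)) \<and>
    fst ((cmd_step ^^ t) (ks, \<sigma>)) \<in> set pts"
proof (induction t)
  case (Suc t)
  show ?case
    using step_conf[of "fst ((cmd_step ^^ t) (ks, \<sigma>))" "snd ((cmd_step ^^ t) (ks, \<sigma>))"] Suc
    by simp
qed (use assms in auto)

lemma computes:
  assumes "\<And>i. i < N \<Longrightarrow> \<sigma> i = word_tape (if i < length ws then ws ! i else [])" and "length ws \<le> N"
    and "runs c \<sigma> \<sigma>' B" and "shows_word (\<sigma>' 0) y"
  shows "computes_within machine ws B y"
proof -
  obtain t where t: "t \<le> B" "(cmd_step ^^ t) ([c], \<sigma>) = ([], \<sigma>')"
    using assms(3) unfolding runs_def by blast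
  \<comment> \<open>\<open>computes_within\<close> inspects the configuration after exactly
    \<open>B\<close> steps, so a run that ends earlier has to stay where it is.\<close>
  have "(cmd_step ^^ s) ([], \<sigma>') = ([], \<sigma>')" for s
    by (induction s) auto
  from this[of "B - t"] have "(cmd_step ^^ (B - t + t)) ([c], \<sigma>) = ([], \<sigma>')"
    by (simp only: funpow_add o_apply t(2))
  then have *: "(cmd_step ^^ B) ([c], \<sigma>) = ([], \<sigma>')"
    using t(1) by simp
  have "init_config machine ws = conf ([c], \<sigma>)"
    using assms(1,2) by (auto simp: init_config_def conf_def ix_start machine_def nth_append
        intro!: nth_equalityI)
  moreover have "[c] \<in> set pts"
    using start_in_conts pts(2) by auto
  ultimately have "(step machine ^^ B) (init_config machine ws) = conf ([], \<sigma>')"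
    using steps_conf[of "[c]" B \<sigma>] * by simp
  then show ?thesis
    using ix[of "[]"] pts(2) N assms(4)
    by (simp add: computes_within_def conf_def machine_def)
qed

end

text \<open>Only the tapes below \<open>N\<close> exist in the machine. The existential quantifier
  over \<sigma> leaves the contents of all others to be chosen conveniently.\<close>

lemma polytime_cmd:
  assumes "cmd_ok N c" and "N \<ge> 1" and "a \<le> N"
    and "\<And>ws. length ws = a \<Longrightarrow> \<exists>\<sigma> \<sigma>'. (\<forall>i<N. \<sigma> i = word_tape (if i < a then ws ! i else [])) \<and>
        runs c \<sigma> \<sigma>' (poly p (sum_list (map length ws))) \<and> shows_word (\<sigma>' 0) (f ws)"
  shows "polytime a f"
proof -
  interpret compilation c N
    using assms by unfold_locales
  show ?thesis
    unfolding polytime_def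
  proof (intro exI conjI allI impI)
    show "wf_tm machine"
      by (rule wf_machine)
    show "a \<le> tapes machine"
      using assms(3) by (simp add: machine_def)
    fix ws :: "bool list list"
    assume len: "length ws = a"
    then obtain \<sigma> \<sigma>' where "\<forall>i<N. \<sigma> i = word_tape (if i < a then ws ! i else [])"
      "runs c \<sigma> \<sigma>' (poly p (sum_list (map length ws)))" "shows_word (\<sigma>' 0) (f ws)"
      using assms(4) by blast
    then show "computes_within machine ws (poly p (sum_list (map length ws))) (f ws)"
      using computes[of \<sigma> ws] assms(3) len by simp
  qed
qed

section \<open>Counter programs\<close>

text \<open>A counter is the distance of a head from a mark on its tape.  Tape 0 is reserved for the
  output, tapes 1 and 2 hold the two input words, all others are counters.\<close>

definition cells :: "(bool \<Rightarrow> nat \<Rightarrow> nat) \<Rightarrow> nat \<Rightarrow> int \<Rightarrow> nat" where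
  "cells w i p =
     (if i = 1 then if p < 0 then 0 else w True (nat p)
      else if i = 2 then if p < 0 then 0 else w False (nat p)
      else if p = 0 then 1 else 0)"

definition store :: "(bool \<Rightarrow> nat \<Rightarrow> nat) \<Rightarrow> tape \<Rightarrow> (nat \<Rightarrow> nat) \<Rightarrow> nat \<Rightarrow> tape" where
  "store w T h i = (if i = 0 then T else (cells w i, int (h i)))"

lemma store_0 [simp]: "store w T h 0 = T"
  by (simp add: store_def)

lemma store_upd_0: "(store w T h)(0 := T') = store w T' h"
  by (auto simp: store_def)

lemma read_counter: "3 \<le> i \<Longrightarrow> read_tape (store w T h i) = (if h i = 0 then 1 else 0)"
  by (simp add: store_def cells_def)

lemma read_word: "read_tape (store w T h (if b then 1 else 2)) = w b (h (if b then 1 else 2))"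
  by (simp add: store_def cells_def)

lemma runs_inc:
  "0 < i \<Longrightarrow> runs (Mv i Rgt) (store w T h) (store w T (h(i := Suc (h i)))) 1"
  by (rule back_subst[of "\<lambda>s. runs _ _ s _", OF runs_Mv]) (auto simp: store_def fun_eq_iff)

lemma runs_dec:
  "0 < i \<Longrightarrow> h i = Suc n \<Longrightarrow> runs (Mv i Lft) (store w T h) (store w T (h(i := n))) 1"
  by (rule back_subst[of "\<lambda>s. runs _ _ s _", OF runs_Mv]) (auto simp: store_def fun_eq_iff)

lemma runs_stay: "runs (Mv i Stay) \<sigma> \<sigma> 1"
  by (rule back_subst[of "\<lambda>s. runs _ _ s _", OF runs_Mv]) auto

text \<open>The mark of a counter is the symbol 1, hence a loop that waits for 1 runs until the
  counter is 0. The family \<open>T\<close> admits bodies that write on the output tape.\<close>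

lemma runs_counter:
  assumes "3 \<le> i" and "\<And>j. j \<le> n \<Longrightarrow> H j i = n - j"
    and "\<And>j. j < n \<Longrightarrow> runs c (store w (T j) (H j)) (store w (T (Suc j)) (H (Suc j))) B"
    and "h = H 0" and "h' = H n"
  shows "runs (While i 1 c) (store w (T 0) h) (store w (T n) h') (n * (B + 1) + 1)"
  using assms runs_While[of n "\<lambda>j. store w (T j) (H j)" i 1 c B]
  by (auto simp: read_counter)

definition transfer :: "nat \<Rightarrow> nat \<Rightarrow> cmd" where
  "transfer a b = While a 1 (Mv a Lft ;; Mv b Rgt)"

definition transfer2 :: "nat \<Rightarrow> nat \<Rightarrow> nat \<Rightarrow> cmd" where
  "transfer2 a b d = While a 1 (Mv a Lft ;; Mv b Rgt ;; Mv d Rgt)"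

text \<open>Word tapes carry no mark at cell 0, so their heads are brought back by a distance that
  was recorded in a counter.\<close>

definition retreat :: "nat \<Rightarrow> nat \<Rightarrow> cmd" where
  "retreat a b = While a 1 (Mv a Lft ;; Mv b Lft)"

definition clear :: "nat \<Rightarrow> cmd" where
  "clear a = While a 1 (Mv a Lft)"

text \<open>The test keeps \<open>a\<close> at its mark once it is 0, which gives truncated
  subtraction.\<close>

definition subtract :: "nat \<Rightarrow> nat \<Rightarrow> cmd" where
  "subtract a b = While b 1 (Mv b Lft ;; If a 1 (Mv a Stay) (Mv a Lft))"

lemma runs_transfer:
  assumes "3 \<le> a" "0 < b" "a \<noteq> b" "h' = h(a := 0, b := h b + h a)"
  shows "runs (transfer a b) (store w T h) (store w T h') (h a * 4 + 1)"
proof -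
  let ?H = "\<lambda>j. h(a := h a - j, b := h b + j)"
  have "runs (Mv a Lft ;; Mv b Rgt) (store w T (?H j)) (store w T (?H (Suc j))) 3" if "j < h a" for j
  proof -
    have "runs (Mv a Lft) (store w T (?H j)) (store w T ((?H j)(a := h a - Suc j))) 1"
      by (rule runs_dec) (use assms that in auto)
    from runs_Seq[OF this runs_inc, of b] show ?thesis
      using assms by (simp add: fun_upd_twist numeral_eq_Suc)
  qed
  from runs_counter[of a "h a" ?H, where T = "\<lambda>_. T", OF _ _ this, of h h'] show ?thesis
    using assms unfolding transfer_def by (simp add: mult.commute fun_upd_twist)
qed

lemma runs_transfer2:
  assumes "3 \<le> a" "0 < b" "0 < d" "distinct [a, b, d]" "h' = h(a := 0, b := h b + h a, d := h d + h a)"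
  shows "runs (transfer2 a b d) (store w T h) (store w T h') (h a * 6 + 1)"
proof -
  let ?H = "\<lambda>j. h(a := h a - j, b := h b + j, d := h d + j)"
  have "runs (Mv a Lft ;; Mv b Rgt ;; Mv d Rgt) (store w T (?H j)) (store w T (?H (Suc j))) 5"
    if "j < h a" for j
  proof -
    have "runs (Mv a Lft) (store w T (?H j)) (store w T ((?H j)(a := h a - Suc j))) 1"
      by (rule runs_dec) (use assms that in auto)
    from runs_Seq[OF this runs_Seq[OF runs_inc[of b] runs_inc[of d]]] show ?thesis
      using assms by (simp add: fun_upd_twist numeral_eq_Suc)
  qed
  from runs_counter[of a "h a" ?H, where T = "\<lambda>_. T", OF _ _ this, of h h'] show ?thesis
    using assms unfolding transfer2_def by (simp add: mult.commute fun_upd_twist)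
qed

lemma runs_retreat:
  assumes "3 \<le> a" "0 < b" "a \<noteq> b" "h a \<le> h b" "h' = h(a := 0, b := h b - h a)"
  shows "runs (retreat a b) (store w T h) (store w T h') (h a * 4 + 1)"
proof -
  let ?H = "\<lambda>j. h(a := h a - j, b := h b - j)"
  have "runs (Mv a Lft ;; Mv b Lft) (store w T (?H j)) (store w T (?H (Suc j))) 3" if "j < h a" for j
  proof -
    have "runs (Mv a Lft) (store w T (?H j)) (store w T ((?H j)(a := h a - Suc j))) 1"
      by (rule runs_dec) (use assms that in auto)
    from runs_Seq[OF this runs_dec, of b "h b - Suc j"] show ?thesis
      using assms that by (simp add: fun_upd_twist Suc_diff_Suc numeral_eq_Suc)
  qed
  from runs_counter[of a "h a" ?H, where T = "\<lambda>_. T", OF _ _ this, of h h'] show ?thesis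
    using assms unfolding retreat_def by (simp add: mult.commute fun_upd_twist)
qed

lemma runs_clear:
  assumes "3 \<le> a" "h' = h(a := 0)"
  shows "runs (clear a) (store w T h) (store w T h') (h a * 2 + 1)"
proof -
  let ?H = "\<lambda>j. h(a := h a - j)"
  have "runs (Mv a Lft) (store w T (?H j)) (store w T (?H (Suc j))) 1" if "j < h a" for j
  proof -
    have "?H j a = Suc (h a - Suc j)"
      using that by simp
    from runs_dec[where h = "?H j", OF _ this] show ?thesis
      using assms by (simp only: fun_upd_upd)
  qed
  from runs_counter[of a "h a" ?H, where T = "\<lambda>_. T", OF _ _ this, of h h'] show ?thesis
    using assms unfolding clear_def by (simp add: mult.commute numeral_2_eq_2)
qed

lemma runs_subtract:
  assumes "3 \<le> a" "3 \<le> b" "a \<noteq> b" "h' = h(a := h a - h b, b := 0)"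
  shows "runs (subtract a b) (store w T h) (store w T h') (h b * 5 + 1)"
proof -
  let ?H = "\<lambda>j. h(a := h a - j, b := h b - j)"
  have "runs (Mv b Lft ;; If a 1 (Mv a Stay) (Mv a Lft)) (store w T (?H j)) (store w T (?H (Suc j))) 4"
    if "j < h b" for j
  proof -
    let ?h = "(?H j)(b := h b - Suc j)"
    have 1: "runs (Mv b Lft) (store w T (?H j)) (store w T ?h) 1"
      by (rule runs_dec) (use assms that in auto)
    have "runs (If a 1 (Mv a Stay) (Mv a Lft)) (store w T ?h) (store w T (?H (Suc j))) (1 + 1)"
    proof (rule runs_If)
      assume "read_tape (store w T ?h a) = 1"
      then have "h a \<le> j"
        using assms by (simp add: read_counter split: if_splits)
      then have "?h = ?H (Suc j)"
        by auto
      then show "runs (Mv a Stay) (store w T ?h) (store w T (?H (Suc j))) 1"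
        using runs_stay by simp
    next
      assume "read_tape (store w T ?h a) \<noteq> 1"
      then have "j < h a"
        using assms by (simp add: read_counter split: if_splits)
      then have "?h a = Suc (h a - Suc j)"
        using assms by simp
      from runs_dec[of a ?h, OF _ this] show "runs (Mv a Lft) (store w T ?h) (store w T (?H (Suc j))) 1"
        using assms by (simp add: fun_upd_twist)
    qed
    from runs_Seq[OF 1 this] show ?thesis
      by (simp add: numeral_eq_Suc)
  qed
  from runs_counter[of b "h b" ?H, where T = "\<lambda>_. T", OF _ _ this, of h h'] show ?thesis
    using assms unfolding subtract_def by (simp add: mult.commute fun_upd_twist)
qed

fun add_const :: "nat \<Rightarrow> nat \<Rightarrow> cmd" where
  "add_const a 0 = Mv a Stay"
| "add_const a (Suc n) = Mv a Rgt ;; add_const a n"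

lemma runs_add_const:
  "0 < a \<Longrightarrow> h' = h(a := h a + n) \<Longrightarrow> runs (add_const a n) (store w T h) (store w T h') (2 * n + 1)"
proof (induction n arbitrary: h)
  case 0
  then show ?case
    using runs_stay by simp
next
  case (Suc n)
  have "runs (add_const a n) (store w T (h(a := Suc (h a)))) (store w T h') (2 * n + 1)"
    using Suc.prems by (intro Suc.IH) auto
  from runs_Seq[OF runs_inc[of a] this] show ?case
    using Suc.prems by simp
qed

lemma cmd_ok_add_const [simp]: "cmd_ok N (add_const a n) \<longleftrightarrow> a < N"
  by (induction n) auto

lemma cmd_ok_counter_cmds [simp]:
  "cmd_ok N (transfer a b) \<longleftrightarrow> a < N \<and> b < N"
  "cmd_ok N (transfer2 a b d) \<longleftrightarrow> a < N \<and> b < N \<and> d < N"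
  "cmd_ok N (retreat a b) \<longleftrightarrow> a < N \<and> b < N"
  "cmd_ok N (clear a) \<longleftrightarrow> a < N"
  "cmd_ok N (subtract a b) \<longleftrightarrow> a < N \<and> b < N"
  by (auto simp: transfer_def transfer2_def retreat_def clear_def subtract_def)


section \<open>Definable functions\<close>

text \<open>The argument \<open>w\<close> gives the symbols of the two input words, \<open>\<rho>\<close> the values of the
  variables; a bounded sum binds variable 0 and shifts the others (de Bruijn indices).  All
  definable functions are polynomially bounded, so they can be evaluated in polynomial time with
  counters in unary.\<close>

inductive definable :: "((bool \<Rightarrow> nat \<Rightarrow> nat) \<Rightarrow> (nat \<Rightarrow> nat) \<Rightarrow> nat) \<Rightarrow> bool" where
  definable_const: "definable (\<lambda>w \<rho>. n)"
| definable_var: "definable (\<lambda>w \<rho>. \<rho> i)"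
| definable_add: "definable f \<Longrightarrow> definable g \<Longrightarrow> definable (\<lambda>w \<rho>. f w \<rho> + g w \<rho>)"
| definable_sub: "definable f \<Longrightarrow> definable g \<Longrightarrow> definable (\<lambda>w \<rho>. f w \<rho> - g w \<rho>)"
| definable_sym: "definable f \<Longrightarrow> definable (\<lambda>w \<rho>. w b (f w \<rho>))"
| definable_sum_case: "definable f \<Longrightarrow> definable g \<Longrightarrow> definable (\<lambda>w \<rho>. \<Sum>i<f w \<rho>. g w (case_nat i \<rho>))"

section \<open>Evaluation of definable functions with a stack of counters\<close>

lemma poly_nat_mono: "m \<le> n \<Longrightarrow> poly (p :: nat poly) m \<le> poly p n"
  by (induction p) (auto intro!: add_mono mult_mono)

text \<open>\<open>tp\<close> is a stack pointer: all counters from \<open>tp\<close> on are free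
  before the evaluation, and afterwards only \<open>tp\<close> has changed, holding the value.
  Variable \<open>i\<close> lives on tape \<open>loc i\<close>, and time is measured in a common
  bound \<open>m\<close> of the variables.\<close>

definition evaluates ::
  "cmd \<Rightarrow> ((bool \<Rightarrow> nat \<Rightarrow> nat) \<Rightarrow> (nat \<Rightarrow> nat) \<Rightarrow> nat) \<Rightarrow> (nat \<Rightarrow> nat) \<Rightarrow> nat \<Rightarrow> nat poly \<Rightarrow> bool" where
  "evaluates c f loc tp p \<longleftrightarrow>
     (\<forall>w T h m. (\<forall>b i. w b i \<le> 2) \<longrightarrow> (\<forall>i\<ge>tp. h i = 0) \<longrightarrow> h 1 = 0 \<longrightarrow> h 2 = 0 \<longrightarrow>
        (\<forall>i. h (loc i) \<le> m) \<longrightarrow>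
        runs c (store w T h) (store w T (h(tp := f w (h \<circ> loc)))) (poly p m))"

text \<open>The polynomial bounds values as well as time, since moving a unary value takes time
  proportional to it. It is fixed before \<open>loc\<close> and \<open>tp\<close>, which change with
  the nesting of sums. \<open>loc\<close> need not be injective, so infinitely many variables fit on
  finitely many tapes.\<close>

definition computable :: "((bool \<Rightarrow> nat \<Rightarrow> nat) \<Rightarrow> (nat \<Rightarrow> nat) \<Rightarrow> nat) \<Rightarrow> bool" where
  "computable f \<longleftrightarrow>
     (\<exists>p. (\<forall>w \<rho> m. (\<forall>b i. w b i \<le> 2) \<longrightarrow> (\<forall>i. \<rho> i \<le> m) \<longrightarrow> f w \<rho> \<le> poly p m) \<and>
        (\<forall>loc tp. (\<forall>i. 3 \<le> loc i \<and> loc i < tp) \<longrightarrow>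
           (\<exists>c N. cmd_ok N c \<and> evaluates c f loc tp p)))"

lemma evaluatesD:
  "evaluates c f loc tp p \<Longrightarrow> (\<And>b i. w b i \<le> 2) \<Longrightarrow> (\<And>i. i \<ge> tp \<Longrightarrow> h i = 0) \<Longrightarrow> h 1 = 0 \<Longrightarrow> h 2 = 0 \<Longrightarrow>
    (\<And>i. h (loc i) \<le> m) \<Longrightarrow> v = f w (\<lambda>i. h (loc i)) \<Longrightarrow> h' = h(tp := v) \<Longrightarrow>
    runs c (store w T h) (store w T h') (poly p m)"
  unfolding evaluates_def by (simp add: o_def del: split_paired_All)

lemma computable_const: "computable (\<lambda>w \<rho>. n)"
  unfolding computable_def
proof (intro exI[of _ "[:2 * n + 1:]"] conjI allI impI)
  fix loc :: "nat \<Rightarrow> nat" and tp :: nat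
  assume "\<forall>i::nat. 3 \<le> loc i \<and> loc i < tp"
  then have "0 < tp"
    by (metis gr_implies_not0 neq0_conv)
  then have "evaluates (add_const tp n) (\<lambda>w \<rho>. n) loc tp [:2 * n + 1:]"
    unfolding evaluates_def
  proof (intro allI impI)
    fix w :: "bool \<Rightarrow> nat \<Rightarrow> nat" and T and h :: "nat \<Rightarrow> nat" and m :: nat
    assume "0 < tp" "\<forall>i\<ge>tp. h i = 0"
    then show "runs (add_const tp n) (store w T h) (store w T (h(tp := n))) (poly [:2 * n + 1:] m)"
      using runs_add_const[of tp "h(tp := n)" h n w T] by simp
  qed
  then show "\<exists>c N. cmd_ok N c \<and> evaluates c (\<lambda>w \<rho>. n) loc tp [:2 * n + 1:]"
    by (meson cmd_ok_add_const lessI)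
qed auto

text \<open>Reading a counter empties it; the value is therefore moved to two counters, and one of
  the copies is moved back.\<close>

lemma computable_var: "computable (\<lambda>w \<rho>. \<rho> i)"
  unfolding computable_def
proof (intro exI[of _ "[:3, 10:]"] conjI allI impI)
  fix w :: "bool \<Rightarrow> nat \<Rightarrow> nat" and \<rho> :: "nat \<Rightarrow> nat" and m
  assume "\<forall>i. \<rho> i \<le> m"
  from this[rule_format, of i] show "\<rho> i \<le> poly [:3, 10:] m"
    by simp
next
  fix loc :: "nat \<Rightarrow> nat" and tp :: nat
  assume loc: "\<forall>i::nat. 3 \<le> loc i \<and> loc i < tp"
  let ?c = "transfer2 (loc i) tp (Suc tp) ;; transfer (Suc tp) (loc i)"
  have "evaluates ?c (\<lambda>w \<rho>. \<rho> i) loc tp [:3, 10:]"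
    unfolding evaluates_def
  proof (intro allI impI)
    fix w :: "bool \<Rightarrow> nat \<Rightarrow> nat" and T and h :: "nat \<Rightarrow> nat" and m
    assume z: "\<forall>i\<ge>tp. h i = 0" and m: "\<forall>i. h (loc i) \<le> m"
    have l: "3 \<le> loc i" "loc i < tp"
      using loc by auto
    let ?h = "h(loc i := 0, tp := h (loc i), Suc tp := h (loc i))"
    have "runs (transfer2 (loc i) tp (Suc tp)) (store w T h) (store w T ?h) (h (loc i) * 6 + 1)"
      by (rule runs_transfer2) (use l z in auto)
    moreover have "runs (transfer (Suc tp) (loc i)) (store w T ?h)
        (store w T (h(tp := (h \<circ> loc) i))) (?h (Suc tp) * 4 + 1)"
      by (rule runs_transfer) (use l z in \<open>auto simp: fun_eq_iff\<close>)
    ultimately show "runs ?c (store w T h) (store w T (h(tp := (h \<circ> loc) i))) (poly [:3, 10:] m)"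
      by (rule runs_mono[OF runs_Seq]) (use m[rule_format, of i] in simp)
  qed
  then show "\<exists>c N. cmd_ok N c \<and> evaluates c (\<lambda>w \<rho>. \<rho> i) loc tp [:3, 10:]"
    using loc by (intro exI[of _ ?c] exI[of _ "Suc (Suc tp)"]) (auto simp: less_SucI)
qed

lemma computable_add:
  assumes "computable f" "computable g"
  shows "computable (\<lambda>w \<rho>. f w \<rho> + g w \<rho>)"
proof -
  obtain p where p: "\<And>w \<rho> m. (\<And>b i. w b i \<le> 2) \<Longrightarrow> (\<And>i. \<rho> i \<le> m) \<Longrightarrow> f w \<rho> \<le> poly p m"
    "\<And>loc tp. (\<And>i. 3 \<le> loc i \<and> loc i < tp) \<Longrightarrow> \<exists>c N. cmd_ok N c \<and> evaluates c f loc tp p"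
    using assms(1) unfolding computable_def by metis
  obtain q where q: "\<And>w \<rho> m. (\<And>b i. w b i \<le> 2) \<Longrightarrow> (\<And>i. \<rho> i \<le> m) \<Longrightarrow> g w \<rho> \<le> poly q m"
    "\<And>loc tp. (\<And>i. 3 \<le> loc i \<and> loc i < tp) \<Longrightarrow> \<exists>c N. cmd_ok N c \<and> evaluates c g loc tp q"
    using assms(2) unfolding computable_def by metis
  \<comment> \<open>\<open>q\<close> enters once as the time for \<open>g\<close> and four times as
    a bound on its value, which \<open>transfer\<close> moves at four steps per unit.\<close>
  let ?r = "p + 5 * q + [:3:]"
  show ?thesis
    unfolding computable_def
  proof (intro exI[of _ ?r] conjI allI impI)
    fix w :: "bool \<Rightarrow> nat \<Rightarrow> nat" and \<rho> :: "nat \<Rightarrow> nat" and m :: nat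
    assume "\<forall>b i. w b i \<le> (2::nat)" "\<forall>i. \<rho> i \<le> (m::nat)"
    then show "f w \<rho> + g w \<rho> \<le> poly ?r m"
      using p(1)[of w \<rho> m] q(1)[of w \<rho> m] by simp
  next
    fix loc :: "nat \<Rightarrow> nat" and tp :: nat
    assume loc: "\<forall>i::nat. 3 \<le> loc i \<and> loc i < tp"
    obtain c N where c: "cmd_ok N c" "evaluates c f loc tp p"
      using p(2)[of loc tp] loc by auto
    obtain d M where d: "cmd_ok M d" "evaluates d g loc (Suc tp) q"
      using q(2)[of loc "Suc tp"] loc less_SucI by metis
    let ?c = "c ;; d ;; transfer (Suc tp) tp"
    have "evaluates ?c (\<lambda>w \<rho>. f w \<rho> + g w \<rho>) loc tp ?r"
      unfolding evaluates_def
    proof (intro allI impI)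
      fix w :: "bool \<Rightarrow> nat \<Rightarrow> nat" and T and h :: "nat \<Rightarrow> nat" and m
      assume w: "\<forall>b i. w b i \<le> 2" and z: "\<forall>i\<ge>tp. h i = 0" "h 1 = 0" "h 2 = 0"
        and m: "\<forall>i. h (loc i) \<le> m"
      have l: "loc i \<noteq> tp" "3 < tp" for i
        using loc by (metis less_irrefl, metis le_less_trans)
      let ?h1 = "h(tp := f w (\<lambda>i. h (loc i)))"
      let ?h2 = "?h1(Suc tp := g w (\<lambda>i. h (loc i)))"
      have "runs c (store w T h) (store w T ?h1) (poly p m)"
        by (rule evaluatesD[OF c(2)]) (use w z m in auto)
      moreover have "runs d (store w T ?h1) (store w T ?h2) (poly q m)"
        by (rule evaluatesD[OF d(2)]) (use w z m l in auto)
      moreover have "runs (transfer (Suc tp) tp) (store w T ?h2)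
          (store w T (h(tp := f w (h \<circ> loc) + g w (h \<circ> loc)))) (?h2 (Suc tp) * 4 + 1)"
        by (rule runs_transfer) (use z l(2) in \<open>auto simp: fun_eq_iff o_def\<close>)
      ultimately show "runs ?c (store w T h)
          (store w T (h(tp := f w (h \<circ> loc) + g w (h \<circ> loc)))) (poly ?r m)"
        by (intro runs_mono[OF runs_Seq[OF _ runs_Seq]]) (use q(1)[of w "\<lambda>i. h (loc i)" m] w m in auto)
    qed
    then show "\<exists>c N. cmd_ok N c \<and> evaluates c (\<lambda>w \<rho>. f w \<rho> + g w \<rho>) loc tp ?r"
      using c(1) d(1) by (intro exI[of _ ?c] exI[of _ "N + M + Suc (Suc tp)"])
        (auto intro: cmd_ok_mono)
  qed
qed

lemma computable_sub:
  assumes "computable f" "computable g"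
  shows "computable (\<lambda>w \<rho>. f w \<rho> - g w \<rho>)"
proof -
  obtain p where p: "\<And>w \<rho> m. (\<And>b i. w b i \<le> 2) \<Longrightarrow> (\<And>i. \<rho> i \<le> m) \<Longrightarrow> f w \<rho> \<le> poly p m"
    "\<And>loc tp. (\<And>i. 3 \<le> loc i \<and> loc i < tp) \<Longrightarrow> \<exists>c N. cmd_ok N c \<and> evaluates c f loc tp p"
    using assms(1) unfolding computable_def by metis
  obtain q where q: "\<And>w \<rho> m. (\<And>b i. w b i \<le> 2) \<Longrightarrow> (\<And>i. \<rho> i \<le> m) \<Longrightarrow> g w \<rho> \<le> poly q m"
    "\<And>loc tp. (\<And>i. 3 \<le> loc i \<and> loc i < tp) \<Longrightarrow> \<exists>c N. cmd_ok N c \<and> evaluates c g loc tp q"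
    using assms(2) unfolding computable_def by metis
  let ?r = "p + 6 * q + [:3:]"
  show ?thesis
    unfolding computable_def
  proof (intro exI[of _ ?r] conjI allI impI)
    fix w :: "bool \<Rightarrow> nat \<Rightarrow> nat" and \<rho> :: "nat \<Rightarrow> nat" and m :: nat
    assume "\<forall>b i. w b i \<le> (2::nat)" "\<forall>i. \<rho> i \<le> (m::nat)"
    then show "f w \<rho> - g w \<rho> \<le> poly ?r m"
      using p(1)[of w \<rho> m] by simp
  next
    fix loc :: "nat \<Rightarrow> nat" and tp :: nat
    assume loc: "\<forall>i::nat. 3 \<le> loc i \<and> loc i < tp"
    obtain c N where c: "cmd_ok N c" "evaluates c f loc tp p"
      using p(2)[of loc tp] loc by auto
    obtain d M where d: "cmd_ok M d" "evaluates d g loc (Suc tp) q"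
      using q(2)[of loc "Suc tp"] loc less_SucI by metis
    let ?c = "c ;; d ;; subtract tp (Suc tp)"
    have "evaluates ?c (\<lambda>w \<rho>. f w \<rho> - g w \<rho>) loc tp ?r"
      unfolding evaluates_def
    proof (intro allI impI)
      fix w :: "bool \<Rightarrow> nat \<Rightarrow> nat" and T and h :: "nat \<Rightarrow> nat" and m
      assume w: "\<forall>b i. w b i \<le> 2" and z: "\<forall>i\<ge>tp. h i = 0" "h 1 = 0" "h 2 = 0"
        and m: "\<forall>i. h (loc i) \<le> m"
      have l: "loc i \<noteq> tp" "3 < tp" for i
        using loc by (metis less_irrefl, metis le_less_trans)
      let ?h1 = "h(tp := f w (\<lambda>i. h (loc i)))"
      let ?h2 = "?h1(Suc tp := g w (\<lambda>i. h (loc i)))"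
      have "runs c (store w T h) (store w T ?h1) (poly p m)"
        by (rule evaluatesD[OF c(2)]) (use w z m in auto)
      moreover have "runs d (store w T ?h1) (store w T ?h2) (poly q m)"
        by (rule evaluatesD[OF d(2)]) (use w z m l in auto)
      moreover have "runs (subtract tp (Suc tp)) (store w T ?h2)
          (store w T (h(tp := f w (h \<circ> loc) - g w (h \<circ> loc)))) (?h2 (Suc tp) * 5 + 1)"
        by (rule runs_subtract) (use z l(2) in \<open>auto simp: fun_eq_iff o_def\<close>)
      ultimately show "runs ?c (store w T h)
          (store w T (h(tp := f w (h \<circ> loc) - g w (h \<circ> loc)))) (poly ?r m)"
        by (intro runs_mono[OF runs_Seq[OF _ runs_Seq]]) (use q(1)[of w "\<lambda>i. h (loc i)" m] w m in auto)
    qed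
    then show "\<exists>c N. cmd_ok N c \<and> evaluates c (\<lambda>w \<rho>. f w \<rho> - g w \<rho>) loc tp ?r"
      using c(1) d(1) by (intro exI[of _ ?c] exI[of _ "N + M + Suc (Suc tp)"])
        (auto intro: cmd_ok_mono)
  qed
qed

text \<open>The head of the word tape walks to the position, while \<open>Suc tp\<close> remembers
  the distance for the way back. There are only three possible symbols, so two tests identify the
  one read.\<close>

lemma computable_sym:
  assumes "computable f"
  shows "computable (\<lambda>w \<rho>. w b (f w \<rho>))"
proof -
  obtain p where p: "\<And>w \<rho> m. (\<And>b i. w b i \<le> 2) \<Longrightarrow> (\<And>i. \<rho> i \<le> m) \<Longrightarrow> f w \<rho> \<le> poly p m"
    "\<And>loc tp. (\<And>i. 3 \<le> loc i \<and> loc i < tp) \<Longrightarrow> \<exists>c N. cmd_ok N c \<and> evaluates c f loc tp p"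
    using assms(1) unfolding computable_def by metis
  let ?r = "11 * p + [:12:]"
  show ?thesis
    unfolding computable_def
  proof (intro exI[of _ ?r] conjI allI impI)
    fix w :: "bool \<Rightarrow> nat \<Rightarrow> nat" and \<rho> :: "nat \<Rightarrow> nat" and m :: nat
    assume "\<forall>b i. w b i \<le> (2::nat)" "\<forall>i. \<rho> i \<le> (m::nat)"
    then show "w b (f w \<rho>) \<le> poly ?r m"
      by (simp add: trans_le_add2 order.trans[of _ 2])
  next
    fix loc :: "nat \<Rightarrow> nat" and tp :: nat
    assume loc: "\<forall>i::nat. 3 \<le> loc i \<and> loc i < tp"
    obtain c N where c: "cmd_ok N c" "evaluates c f loc tp p"
      using p(2)[of loc tp] loc by auto
    define j :: nat where "j = (if b then 1 else 2)"
    let ?If = "If j 0 (add_const tp 0) (If j 1 (add_const tp 1) (add_const tp 2))"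
    let ?c = "c ;; transfer2 tp j (Suc tp) ;; ?If ;; retreat (Suc tp) j"
    have "evaluates ?c (\<lambda>w \<rho>. w b (f w \<rho>)) loc tp ?r"
      unfolding evaluates_def
    proof (intro allI impI)
      fix w :: "bool \<Rightarrow> nat \<Rightarrow> nat" and T and h :: "nat \<Rightarrow> nat" and m
      assume w: "\<forall>b i. w b i \<le> 2" and z: "\<forall>i\<ge>tp. h i = 0" "h 1 = 0" "h 2 = 0"
        and m: "\<forall>i. h (loc i) \<le> m"
      have l: "3 < tp"
        using loc by (metis le_less_trans)
      have j: "0 < j" "j < 3" "h j = 0"
        using z by (auto simp: j_def)
      define v where "v = f w (\<lambda>i. h (loc i))"
      let ?h1 = "h(tp := v)"
      let ?h2 = "h(j := v, Suc tp := v)"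
      let ?h3 = "h(j := v, Suc tp := v, tp := w b v)"
      have "runs c (store w T h) (store w T ?h1) (poly p m)"
        by (rule evaluatesD[OF c(2)]) (use w z m in \<open>auto simp: v_def\<close>)
      moreover have "runs (transfer2 tp j (Suc tp)) (store w T ?h1) (store w T ?h2) (?h1 tp * 6 + 1)"
        by (rule runs_transfer2) (use z l j in \<open>auto simp: fun_eq_iff\<close>)
      moreover have "runs ?If (store w T ?h2) (store w T ?h3) 7"
      proof -
        have rd: "read_tape (store w T ?h2 j) = w b v"
          using read_word[of w T ?h2 b] l by (auto simp: j_def)
        have *: "runs (add_const tp i) (store w T ?h2) (store w T ?h3) 5" if "w b v = i" for i
        proof (rule runs_mono[OF runs_add_const])
          show "2 * i + 1 \<le> 5"
            using that w[rule_format, of b v] by simp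
        qed (use that z l j in \<open>auto simp: fun_eq_iff\<close>)
        have "w b v = 0 \<or> w b v = 1 \<or> w b v = 2"
          using w[rule_format, of b v] by linarith
        then have "runs (If j 1 (add_const tp 1) (add_const tp 2)) (store w T ?h2) (store w T ?h3) (5 + 1)"
          if "w b v \<noteq> 0"
          by (intro runs_If *) (use rd that in auto)
        then have "runs ?If (store w T ?h2) (store w T ?h3) (6 + 1)"
          by (intro runs_If runs_mono[OF *]) (use rd in auto)
        then show ?thesis
          by simp
      qed
      moreover have "runs (retreat (Suc tp) j) (store w T ?h3)
          (store w T (h(tp := w b (f w (h \<circ> loc))))) (?h3 (Suc tp) * 4 + 1)"
        by (rule runs_retreat) (use z l j in \<open>auto simp: fun_eq_iff o_def v_def\<close>)
      ultimately show "runs ?c (store w T h) (store w T (h(tp := w b (f w (h \<circ> loc))))) (poly ?r m)"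
        by (intro runs_mono[OF runs_Seq[OF _ runs_Seq[OF _ runs_Seq]]])
          (use p(1)[of w "\<lambda>i. h (loc i)" m] w m in \<open>auto simp: v_def\<close>)
    qed
    then show "\<exists>c N. cmd_ok N c \<and> evaluates c (\<lambda>w \<rho>. w b (f w \<rho>)) loc tp ?r"
      using c(1) by (intro exI[of _ ?c] exI[of _ "N + Suc (Suc (Suc tp))"])
        (auto intro: cmd_ok_mono simp: j_def)
  qed
qed

lemma computable_sum:
  assumes "computable f" "computable g"
  shows "computable (\<lambda>w \<rho>. \<Sum>i<f w \<rho>. g w (case_nat i \<rho>))"
proof -
  obtain p where p: "\<And>w \<rho> m. (\<And>b i. w b i \<le> 2) \<Longrightarrow> (\<And>i. \<rho> i \<le> m) \<Longrightarrow> f w \<rho> \<le> poly p m"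
    "\<And>loc tp. (\<And>i. 3 \<le> loc i \<and> loc i < tp) \<Longrightarrow> \<exists>c N. cmd_ok N c \<and> evaluates c f loc tp p"
    using assms(1) unfolding computable_def by metis
  obtain q where q: "\<And>w \<rho> m. (\<And>b i. w b i \<le> 2) \<Longrightarrow> (\<And>i. \<rho> i \<le> m) \<Longrightarrow> g w \<rho> \<le> poly q m"
    "\<And>loc tp. (\<And>i. 3 \<le> loc i \<and> loc i < tp) \<Longrightarrow> \<exists>c N. cmd_ok N c \<and> evaluates c g loc tp q"
    using assms(2) unfolding computable_def by metis
  \<comment> \<open>Inside the sum the bound variable may reach the value of \<open>f\<close>, so
    all variables of \<open>g\<close> are bounded by \<open>m + poly p m\<close>.\<close>
  let ?q = "pcompose q ([:0, 1:] + p)"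
  let ?r = "p + p * (5 * ?q + [:10:]) + 2 * p + [:10:]"
  have bound: "(\<Sum>i<f w \<rho>. g w (case_nat i \<rho>)) \<le> poly ?r m"
    and bound_g: "i \<le> f w \<rho> \<Longrightarrow> g w (case_nat i \<rho>) \<le> poly ?q m"
    if "\<forall>b i. w b i \<le> 2" "\<forall>i. \<rho> i \<le> m" for w \<rho> m i
  proof -
    have f: "f w \<rho> \<le> poly p m"
      using that p(1) by auto
    have g: "g w (case_nat i \<rho>) \<le> poly ?q m" if "i \<le> f w \<rho>" for i
      using q(1)[of w "case_nat i \<rho>" "m + poly p m"] that f \<open>\<forall>b i. w b i \<le> 2\<close> \<open>\<forall>i. \<rho> i \<le> m\<close>
      by (auto simp: poly_pcompose trans_le_add1 trans_le_add2 split: nat.splits)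
    then show "i \<le> f w \<rho> \<Longrightarrow> g w (case_nat i \<rho>) \<le> poly ?q m" .
    have "(\<Sum>i<f w \<rho>. g w (case_nat i \<rho>)) \<le> (\<Sum>i<f w \<rho>. poly ?q m)"
      by (intro sum_mono g) simp
    also have "\<dots> \<le> poly p m * poly ?q m"
      using f by simp
    also have "\<dots> \<le> poly ?r m"
      by (simp add: algebra_simps)
    finally show "(\<Sum>i<f w \<rho>. g w (case_nat i \<rho>)) \<le> poly ?r m" .
  qed
  show ?thesis
    unfolding computable_def
  proof (intro exI[of _ ?r] conjI allI impI)
    show "(\<Sum>i<f w \<rho>. g w (case_nat i \<rho>)) \<le> poly ?r m"
      if "\<forall>b i. w b i \<le> 2" "\<forall>i. \<rho> i \<le> m" for w \<rho> m
      using bound that by simp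
  next
    fix loc :: "nat \<Rightarrow> nat" and tp :: nat
    assume loc: "\<forall>i::nat. 3 \<le> loc i \<and> loc i < tp"
    have loc': "3 \<le> loc i \<and> loc i < tp \<and> loc i < Suc tp \<and> loc i < Suc (Suc tp)
        \<and> loc i \<noteq> tp \<and> loc i \<noteq> Suc tp \<and> loc i \<noteq> Suc (Suc tp)" for i
      using loc less_SucI by (metis less_irrefl_nat)
    obtain c N where c: "cmd_ok N c" "evaluates c f loc (Suc tp) p"
      using p(2)[of loc "Suc tp"] loc' by auto
    let ?loc = "case_nat (Suc (Suc tp)) loc"
    obtain d M where d: "cmd_ok M d" "evaluates d g ?loc (Suc (Suc (Suc tp))) q"
    proof -
      have "3 \<le> ?loc i \<and> ?loc i < Suc (Suc (Suc tp))" for i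
        using loc' le_less_trans[of 3 "loc 0" tp] by (auto split: nat.splits intro: less_SucI)
      from q(2)[of ?loc, OF this] show ?thesis
        using that by auto
    qed
    \<comment> \<open>\<open>tp\<close> accumulates the sum, \<open>Suc tp\<close> counts the
      remaining rounds, the next counter is the bound variable, and the one after it receives the
      value of the summand.\<close>
    let ?b = "Mv (Suc tp) Lft ;; d ;; transfer (Suc (Suc (Suc tp))) tp ;; Mv (Suc (Suc tp)) Rgt"
    let ?c = "c ;; While (Suc tp) 1 ?b ;; clear (Suc (Suc tp))"
    have "evaluates ?c (\<lambda>w \<rho>. \<Sum>i<f w \<rho>. g w (case_nat i \<rho>)) loc tp ?r"
      unfolding evaluates_def
    proof (intro allI impI)
      fix w :: "bool \<Rightarrow> nat \<Rightarrow> nat" and T and h :: "nat \<Rightarrow> nat" and m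
      assume w: "\<forall>b i. w b i \<le> 2" and z: "\<forall>i\<ge>tp. h i = 0" "h 1 = 0" "h 2 = 0"
        and m: "\<forall>i. h (loc i) \<le> m"
      have l: "3 < tp"
        using loc by (metis le_less_trans)
      define \<rho> where "\<rho> = (\<lambda>i. h (loc i))"
      define n where "n = f w \<rho>"
      have n: "n \<le> poly p m"
        using p(1)[of w \<rho> m] w m by (simp add: n_def \<rho>_def)
      let ?S = "\<lambda>j. \<Sum>i<j. g w (case_nat i \<rho>)"
      let ?H = "\<lambda>j. h(tp := ?S j, Suc tp := n - j, Suc (Suc tp) := j)"
      let ?B = "5 * poly ?q m + 6"
      have body: "runs ?b (store w T (?H j)) (store w T (?H (Suc j))) ?B" if "j < n" for j
      proof -
        let ?v = "g w (case_nat j \<rho>)"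
        let ?h1 = "h(tp := ?S j, Suc tp := n - Suc j, Suc (Suc tp) := j)"
        let ?h2 = "?h1(Suc (Suc (Suc tp)) := ?v)"
        let ?h3 = "h(tp := ?S (Suc j), Suc tp := n - Suc j, Suc (Suc tp) := j)"
        have "runs (Mv (Suc tp) Lft) (store w T (?H j)) (store w T ((?H j)(Suc tp := n - Suc j))) 1"
          by (rule runs_dec) (use that in auto)
        then have "runs (Mv (Suc tp) Lft) (store w T (?H j)) (store w T ?h1) 1"
          by (simp add: fun_upd_twist)
        moreover have "runs d (store w T ?h1) (store w T ?h2) (poly q (m + poly p m))"
        proof (rule evaluatesD[OF d(2)])
          show "?h1 (?loc i) \<le> m + poly p m" for i
            using m[rule_format, of "i - 1"] n that loc'[of "i - 1"] by (auto split: nat.splits)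
          have "case_nat j \<rho> = (\<lambda>i. ?h1 (?loc i))"
            using loc' by (auto simp: fun_eq_iff \<rho>_def split: nat.splits)
          then show "?v = g w (\<lambda>i. ?h1 (?loc i))"
            by simp
        qed (use w z l in auto)
        moreover have "runs (transfer (Suc (Suc (Suc tp))) tp) (store w T ?h2) (store w T ?h3)
            (?h2 (Suc (Suc (Suc tp))) * 4 + 1)"
          by (rule runs_transfer) (use z l in \<open>auto simp: fun_eq_iff\<close>)
        moreover have "runs (Mv (Suc (Suc tp)) Rgt) (store w T ?h3)
            (store w T (?h3(Suc (Suc tp) := Suc (?h3 (Suc (Suc tp)))))) 1"
          by (rule runs_inc) simp
        then have "runs (Mv (Suc (Suc tp)) Rgt) (store w T ?h3) (store w T (?H (Suc j))) 1"
          by (simp only: fun_upd_same fun_upd_upd)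
        ultimately show ?thesis
          by (rule runs_mono[OF runs_Seq[OF _ runs_Seq[OF _ runs_Seq]]])
            (use bound_g[of w \<rho> m j] w m that in \<open>auto simp: poly_pcompose \<rho>_def n_def\<close>)
      qed
      have "runs c (store w T h) (store w T (h(Suc tp := n))) (poly p m)"
        by (rule evaluatesD[OF c(2)]) (use w z m in \<open>auto simp: n_def \<rho>_def\<close>)
      moreover have "runs (While (Suc tp) 1 ?b) (store w T (h(Suc tp := n))) (store w T (?H n)) (n * (?B + 1) + 1)"
        by (rule runs_counter[where T = "\<lambda>_. T" and H = ?H, OF _ _ body]) (use z l in \<open>auto simp: fun_eq_iff\<close>)
      moreover have "runs (clear (Suc (Suc tp))) (store w T (?H n))
          (store w T (h(tp := \<Sum>i<f w (h \<circ> loc). g w (case_nat i (h \<circ> loc))))) (?H n (Suc (Suc tp)) * 2 + 1)"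
        by (rule runs_clear) (use z l in \<open>auto simp: fun_eq_iff n_def \<rho>_def o_def\<close>)
      ultimately show "runs ?c (store w T h)
          (store w T (h(tp := \<Sum>i<f w (h \<circ> loc). g w (case_nat i (h \<circ> loc))))) (poly ?r m)"
      proof (rule runs_mono[OF runs_Seq[OF _ runs_Seq]])
        have "n * (?B + 1) \<le> poly p m * (?B + 1)"
          using n by (rule mult_le_mono1)
        then show "poly p m + (n * (?B + 1) + 1 + (?H n (Suc (Suc tp)) * 2 + 1) + 1) + 1 \<le> poly ?r m"
          using n by (simp add: algebra_simps)
      qed
    qed
    then show "\<exists>c N. cmd_ok N c \<and> evaluates c (\<lambda>w \<rho>. \<Sum>i<f w \<rho>. g w (case_nat i \<rho>)) loc tp ?r"
      using c(1) d(1) by (intro exI[of _ ?c] exI[of _ "N + M + Suc (Suc (Suc (Suc tp)))"])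
        (auto intro: cmd_ok_mono)
  qed
qed

lemma definable_computable: "definable f \<Longrightarrow> computable f"
  by (induction rule: definable.induct)
    (intro computable_const computable_var computable_add computable_sub computable_sym computable_sum;
      assumption)+

section \<open>Preparing the input, writing the output, and polynomial time of definable
  functions\<close>

definition second_word :: "bool list list \<Rightarrow> bool list" where
  "second_word ws = (if 1 < length ws then ws ! 1 else [])"

definition symbol_at :: "bool list \<Rightarrow> nat \<Rightarrow> nat" where
  "symbol_at xs p = (if p < length xs then bit_symbol (xs ! p) else 0)"

definition word_symbols :: "bool list list \<Rightarrow> bool \<Rightarrow> nat \<Rightarrow> nat" where
  "word_symbols ws b = symbol_at (if b then second_word ws else ws ! 0)"

text \<open>\<open>i\<close> stands for the position of the output bit to be computed. Environments
  are total, so the last length fills all remaining variables.\<close>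

definition input_env :: "bool list list \<Rightarrow> nat \<Rightarrow> nat \<Rightarrow> nat" where
  "input_env ws i = case_nat i (case_nat (length (ws ! 0)) (\<lambda>_. length (second_word ws)))"

lemma symbol_at_le: "symbol_at xs p \<le> 2"
  by (auto simp: symbol_at_def bit_symbol_def)

lemma symbol_at_eq_0: "symbol_at xs p = 0 \<longleftrightarrow> length xs \<le> p"
  by (auto simp: symbol_at_def bit_symbol_def)

lemma word_tape_symbols: "word_tape xs = (\<lambda>p. if p < 0 then 0 else symbol_at xs (nat p), 0)"
  by (auto simp: word_tape_def symbol_at_def fun_eq_iff)

text \<open>Work tapes start out blank, whereas counters need their mark at cell 0.\<close>

definition write_marks :: "nat \<Rightarrow> cmd" where
  "write_marks N = foldr (\<lambda>i c. Wr i 1 ;; c) [3..<N] (Mv 0 Stay)"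

lemma cmd_ok_write_marks: "0 < N \<Longrightarrow> cmd_ok N (write_marks N)"
proof -
  assume "0 < N"
  then have "(\<forall>i\<in>set is. i < N) \<Longrightarrow> cmd_ok N (foldr (\<lambda>i c. Wr i 1 ;; c) is (Mv 0 Stay))" for "is"
    by (induction "is") auto
  then show ?thesis
    by (simp add: write_marks_def)
qed

lemma runs_write_marks:
  "runs (write_marks N) \<sigma> (\<lambda>i. if 3 \<le> i \<and> i < N then act (1, Stay) (\<sigma> i) else \<sigma> i) (2 * N + 1)"
proof -
  have "runs (foldr (\<lambda>i c. Wr i 1 ;; c) is (Mv 0 Stay)) \<sigma>
      (\<lambda>i. if i \<in> set is then act (1, Stay) (\<sigma> i) else \<sigma> i) (2 * length is + 1)" for "is" \<sigma>
  proof (induction "is" arbitrary: \<sigma>)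
    case Nil
    then show ?case
      using runs_stay by simp
  next
    case (Cons j "is")
    have "act (1, Stay) (act (1, Stay) T) = act (1, Stay) T" for T
      by (cases T) auto
    then have "(\<lambda>i. if i \<in> set is then act (1, Stay) ((\<sigma>(j := act (1, Stay) (\<sigma> j))) i)
          else (\<sigma>(j := act (1, Stay) (\<sigma> j))) i) =
        (\<lambda>i. if i \<in> set (j # is) then act (1, Stay) (\<sigma> i) else \<sigma> i)"
      by (auto simp: fun_eq_iff)
    with runs_Seq[OF runs_Wr Cons.IH, of j 1 \<sigma>] show ?case
      by simp
  qed
  from this[of "[3..<N]" \<sigma>] show ?thesis
    unfolding write_marks_def by (auto elim: runs_mono)
qed

text \<open>The first word arrives on tape 0, which is needed for the output, and so moves to tape
  2; the second word stays on tape 1. Tape 4 keeps the length, tape 6 the way back. The head of tape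
  0 is left on the blank behind the word, where the output is going to end.\<close>

definition copy_first :: cmd where
  "copy_first =
     While 0 0 (If 0 1 (Wr 2 1) (Wr 2 2) ;; Mv 0 Rgt ;; Mv 2 Rgt ;; Mv 4 Rgt ;; Mv 6 Rgt) ;; retreat 6 2"

definition measure_second :: cmd where
  "measure_second = While 1 0 (Mv 1 Rgt ;; Mv 5 Rgt ;; Mv 6 Rgt) ;; retreat 6 1"

lemma runs_Wr_word:
  "runs (Wr 2 s) (store w T h) (store (w(False := (w False)(h 2 := s))) T h) 1"
  by (rule back_subst[of "\<lambda>s. runs _ _ s _", OF runs_Wr]) (auto simp: store_def cells_def fun_eq_iff)

lemma runs_Mv_output: "runs (Mv 0 d) (store w (t, p) h) (store w (t, move_head d p) h) 1"
  by (rule back_subst[of "\<lambda>s. runs _ _ s _", OF runs_Mv]) (auto simp: store_def fun_eq_iff)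

lemma runs_measure_second:
  assumes "\<And>p. w True p = symbol_at u p" and "h 1 = 0" "h 5 = 0" "h 6 = 0"
  shows "runs measure_second (store w T h) (store w T (h(5 := length u))) (10 * length u + 3)"
proof -
  let ?H = "\<lambda>j. h(1 := j, 5 := j, 6 := j)"
  let ?n = "length u"
  have rd: "read_tape (store w T (?H j) 1) = symbol_at u j" for j
    using read_word[of w T "?H j" True] assms(1) by simp
  have h0: "h = ?H 0"
    using assms by auto
  have "runs (While 1 0 (Mv 1 Rgt ;; Mv 5 Rgt ;; Mv 6 Rgt)) (store w T (?H 0)) (store w T (?H ?n)) (?n * (5 + 1) + 1)"
  proof (rule runs_While)
    fix j
    have "runs (Mv 1 Rgt ;; Mv 5 Rgt ;; Mv 6 Rgt) (store w T (?H j))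
      (store w T ((?H j)(1 := Suc j, 5 := Suc j, 6 := Suc j))) (1 + (1 + 1 + 1) + 1)"
      using runs_Seq[OF runs_inc[of 1 w T "?H j"] runs_Seq[OF runs_inc[of 5] runs_inc[of 6]]] by simp
    then show "runs (Mv 1 Rgt ;; Mv 5 Rgt ;; Mv 6 Rgt) (store w T (?H j)) (store w T (?H (Suc j))) 5"
      by (simp add: fun_upd_twist numeral_eq_Suc)
  qed (use rd in \<open>simp_all add: symbol_at_eq_0 del: One_nat_def fun_upd_apply\<close>)
  moreover have "runs (retreat 6 1) (store w T (?H ?n)) (store w T (h(5 := ?n))) (?H ?n 6 * 4 + 1)"
    by (rule runs_retreat) (use assms in auto)
  ultimately show ?thesis
    unfolding measure_second_def h0[symmetric]
    by (rule runs_mono[OF runs_Seq]) simp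
qed

lemma runs_copy_first:
  assumes "w False = (\<lambda>p. 0)" and "h 2 = 0" "h 4 = 0" "h 6 = 0"
  shows "runs copy_first (store w (word_tape x) h)
    (store (w(False := symbol_at x)) (fst (word_tape x), int (length x)) (h(4 := length x)))
    (16 * length x + 3)"
proof -
  let ?t = "fst (word_tape x)"
  let ?w = "\<lambda>j. w(False := \<lambda>p. if p < j then symbol_at x p else 0)"
  let ?H = "\<lambda>j. h(2 := j, 4 := j, 6 := j)"
  let ?n = "length x"
  let ?b = "If 0 1 (Wr 2 1) (Wr 2 2) ;; Mv 0 Rgt ;; Mv 2 Rgt ;; Mv 4 Rgt ;; Mv 6 Rgt"
  have t: "?t (int j) = symbol_at x j" for j
    by (simp add: word_tape_symbols)
  have start: "store w (word_tape x) h = store (?w 0) (?t, int 0) (?H 0)"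
    using assms by (auto simp: fun_upd_idem word_tape_def)
  have stop: "?w ?n = w(False := symbol_at x)"
    using symbol_at_eq_0[of x] by (auto simp: fun_eq_iff)
  have "runs (While 0 0 ?b) (store (?w 0) (?t, int 0) (?H 0)) (store (?w ?n) (?t, int ?n) (?H ?n)) (?n * (11 + 1) + 1)"
  proof (rule runs_While[where S = "\<lambda>j. store (?w j) (?t, int j) (?H j)"])
    fix j
    assume j: "j < length x"
    have w: "(?w j)(False := (?w j False)(?H j 2 := symbol_at x j)) = ?w (Suc j)"
      by (auto simp: fun_eq_iff less_Suc_eq)
    have *: "runs (Wr 2 s) (store (?w j) (?t, int j) (?H j)) (store (?w (Suc j)) (?t, int j) (?H j)) 1"
      if "s = symbol_at x j" for s
      using runs_Wr_word[of s "?w j" "(?t, int j)" "?H j"] w that by simp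
    have "symbol_at x j = 1 \<or> symbol_at x j = 2"
      using j by (simp add: symbol_at_def bit_symbol_def)
    then have 1: "runs (If 0 1 (Wr 2 1) (Wr 2 2)) (store (?w j) (?t, int j) (?H j))
        (store (?w (Suc j)) (?t, int j) (?H j)) (1 + 1)"
      by (intro runs_If *) (use t in auto)
    have 2: "runs (Mv 0 Rgt) (store (?w (Suc j)) (?t, int j) (?H j)) (store (?w (Suc j)) (?t, int (Suc j)) (?H j)) 1"
      using runs_Mv_output[of Rgt "?w (Suc j)" ?t "int j" "?H j"] by (simp add: add.commute)
    have "runs (Mv 2 Rgt ;; Mv 4 Rgt ;; Mv 6 Rgt) (store (?w (Suc j)) (?t, int (Suc j)) (?H j))
      (store (?w (Suc j)) (?t, int (Suc j)) ((?H j)(2 := Suc j, 4 := Suc j, 6 := Suc j))) (1 + (1 + 1 + 1) + 1)"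
      using runs_Seq[OF runs_inc[of 2 _ _ "?H j"] runs_Seq[OF runs_inc[of 4] runs_inc[of 6]]] by simp
    then have 3: "runs (Mv 2 Rgt ;; Mv 4 Rgt ;; Mv 6 Rgt) (store (?w (Suc j)) (?t, int (Suc j)) (?H j))
      (store (?w (Suc j)) (?t, int (Suc j)) (?H (Suc j))) (1 + (1 + 1 + 1) + 1)"
      by (simp add: fun_upd_twist)
    show "runs ?b (store (?w j) (?t, int j) (?H j)) (store (?w (Suc j)) (?t, int (Suc j)) (?H (Suc j))) 11"
      by (rule runs_mono[OF runs_Seq[OF 1 runs_Seq[OF 2 3]]]) simp
  qed (use t in \<open>auto simp: symbol_at_eq_0\<close>)
  moreover have "runs (retreat 6 2) (store (?w ?n) (?t, int ?n) (?H ?n))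
      (store (?w ?n) (?t, int ?n) (h(4 := ?n))) (?H ?n 6 * 4 + 1)"
    by (rule runs_retreat) (use assms in auto)
  ultimately show ?thesis
    unfolding copy_first_def start stop by (intro runs_mono[OF runs_Seq]) auto
qed

text \<open>The output is written from right to left, starting left of a blank cell
  \<open>n\<close>: this blank terminates the word, and at the end the head stands on its first bit.
  Counter 3 is both the loop counter and variable 0, so after its decrement it is the position of
  the bit. A zero in counter 6 reads as the mark 1, hence the test on 1 writes the bit symbol of
  \<open>False\<close>.\<close>

lemma runs_write_bits:
  assumes c: "evaluates c f loc 6 q" "loc 0 = 3" "\<And>i. 3 \<le> loc i \<and> loc i < 6"
    and w: "\<And>b i. w b i \<le> 2" and m: "\<And>i. h (loc i) \<le> m" "L \<le> m" and h: "\<And>i. i \<ge> 6 \<Longrightarrow> h i = 0" "h 1 = 0" "h 2 = 0"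
    and e: "\<And>i. f w (\<lambda>j. (h(3 := i)) (loc j)) = v i" "\<And>i. i < L \<Longrightarrow> v i \<le> V"
    and t: "t n = 0"
  shows "\<exists>T. runs (While 3 1 (Mv 3 Lft ;; c ;; Mv 0 Lft ;; If 6 1 (Wr 0 1) (Wr 0 2) ;; clear 6))
      (store w (t, n) (h(3 := L))) (store w T (h(3 := 0))) (L * (poly q m + 2 * V + 9 + 1) + 1) \<and>
    shows_word T (map (\<lambda>i. 0 < v i) [0..<L])"
proof -
  \<comment> \<open>After \<open>j\<close> rounds the last \<open>j\<close> bits stand immediately
    to the left of \<open>n\<close>.\<close>
  define tt where "tt = (\<lambda>j p. if n - int j \<le> p \<and> p < n then bit_symbol (0 < v (nat (p - (n - int L)))) else t p)"
  let ?T = "\<lambda>j. (tt j, n - int j)"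
  let ?H = "\<lambda>j. h(3 := L - j)"
  let ?b = "Mv 3 Lft ;; c ;; Mv 0 Lft ;; If 6 1 (Wr 0 1) (Wr 0 2) ;; clear 6"
  have body: "runs ?b (store w (?T j) (?H j)) (store w (?T (Suc j)) (?H (Suc j))) (poly q m + 2 * V + 9)"
    if j: "j < L" for j
  proof -
    let ?i = "L - Suc j"
    have "(?H j) 3 = Suc ?i"
      using j by simp
    from runs_dec[where h = "?H j", OF _ this]
    have 1: "runs (Mv 3 Lft) (store w (?T j) (?H j)) (store w (?T j) (?H (Suc j))) 1"
      by simp
    have 2: "runs c (store w (?T j) (?H (Suc j))) (store w (?T j) ((?H (Suc j))(6 := v ?i))) (poly q m)"
      by (rule evaluatesD[OF c(1)]) (use w m h e j order.trans[OF _ m(2)] in auto)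
    have 3: "runs (Mv 0 Lft) (store w (?T j) ((?H (Suc j))(6 := v ?i)))
        (store w (tt j, n - int (Suc j)) ((?H (Suc j))(6 := v ?i))) 1"
      using runs_Mv_output[of Lft w "tt j" "n - int j" "(?H (Suc j))(6 := v ?i)"]
      by (simp add: algebra_simps)
    have tt: "(tt j)(n - int (Suc j) := bit_symbol (0 < v ?i)) = tt (Suc j)"
      using j by (auto simp: tt_def fun_eq_iff of_nat_diff nat_diff_distrib')
    have *: "runs (Wr 0 s) (store w (tt j, n - int (Suc j)) g) (store w (?T (Suc j)) g) 1"
      if "s = bit_symbol (0 < v ?i)" for s g
      using runs_Wr[of 0 s "store w (tt j, n - int (Suc j)) g"] tt that by (simp add: store_upd_0)
    have 4: "runs (If 6 1 (Wr 0 1) (Wr 0 2)) (store w (tt j, n - int (Suc j)) ((?H (Suc j))(6 := v ?i)))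
        (store w (?T (Suc j)) ((?H (Suc j))(6 := v ?i))) (1 + 1)"
      by (intro runs_If *) (auto simp: read_counter bit_symbol_def split: if_splits)
    have 5: "runs (clear 6) (store w (?T (Suc j)) ((?H (Suc j))(6 := v ?i)))
        (store w (?T (Suc j)) (?H (Suc j))) (((?H (Suc j))(6 := v ?i)) 6 * 2 + 1)"
      by (rule runs_clear) (use h in auto)
    show ?thesis
      by (rule runs_mono[OF runs_Seq[OF 1 runs_Seq[OF 2 runs_Seq[OF 3 runs_Seq[OF 4 5]]]]])
        (use e(2)[of ?i] j in simp)
  qed
  have "runs (While 3 1 ?b) (store w (?T 0) (h(3 := L))) (store w (?T L) (h(3 := 0)))
      (L * (poly q m + 2 * V + 9 + 1) + 1)"
    by (rule runs_counter[where T = ?T and H = ?H, OF _ _ body]) auto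
  moreover have "?T 0 = (t, n)"
    by (auto simp: tt_def)
  moreover have "shows_word (?T L) (map (\<lambda>i. 0 < v i) [0..<L])"
    using t by (auto simp: tt_def)
  ultimately show ?thesis
    by (intro exI[of _ "?T L"]) auto
qed

text \<open>Every output bit is evaluated afresh from its position, so one expression for the bits
  and one for their number describe a whole function.\<close>

theorem polytime_definable:
  assumes f: "definable f" and g: "definable g" and a: "a = 1 \<or> a = 2"
    and out: "\<And>ws. length ws = a \<Longrightarrow>
      out ws = map (\<lambda>i. 0 < f (word_symbols ws) (input_env ws i)) [0..<g (word_symbols ws) (input_env ws 0)]"
  shows "polytime a out"
proof -
  let ?loc = "case_nat 3 (case_nat 4 (\<lambda>_. 5 :: nat))"
  have loc: "3 \<le> ?loc i \<and> ?loc i < 6" for i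
    by (auto split: nat.splits)
  obtain p where p: "\<And>w \<rho> m. (\<And>b i. w b i \<le> 2) \<Longrightarrow> (\<And>i. \<rho> i \<le> m) \<Longrightarrow> f w \<rho> \<le> poly p m"
    "\<And>loc tp. (\<And>i. 3 \<le> loc i \<and> loc i < tp) \<Longrightarrow> \<exists>c N. cmd_ok N c \<and> evaluates c f loc tp p"
    using definable_computable[OF f] unfolding computable_def by metis
  obtain q where q: "\<And>w \<rho> m. (\<And>b i. w b i \<le> 2) \<Longrightarrow> (\<And>i. \<rho> i \<le> m) \<Longrightarrow> g w \<rho> \<le> poly q m"
    "\<And>loc tp. (\<And>i. 3 \<le> loc i \<and> loc i < tp) \<Longrightarrow> \<exists>c N. cmd_ok N c \<and> evaluates c g loc tp q"
    using definable_computable[OF g] unfolding computable_def by metis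
  obtain c N where c: "cmd_ok N c" "evaluates c f ?loc 6 p"
    using p(2)[of ?loc 6] loc by auto
  obtain d M where d: "cmd_ok M d" "evaluates d g ?loc 6 q"
    using q(2)[of ?loc 6] loc by auto
  define K where "K = N + M + 7"
  let ?loop = "While 3 1 (Mv 3 Lft ;; c ;; Mv 0 Lft ;; If 6 1 (Wr 0 1) (Wr 0 2) ;; clear 6)"
  let ?c = "write_marks K ;; measure_second ;; copy_first ;; d ;; transfer 6 3 ;; ?loop"
  \<comment> \<open>Positions of output bits are below the output length, which \<open>q\<close>
    bounds.\<close>
  let ?p = "pcompose p ([:0, 1:] + q)"
  let ?r = "[:2 * K + 20:] + [:0, 26:] + 5 * q + q * (3 * ?p + [:10:])"
  show ?thesis
  proof (rule polytime_cmd)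
    show "cmd_ok K ?c"
      using c(1) d(1) cmd_ok_write_marks[of K]
      by (auto intro: cmd_ok_mono simp: K_def measure_second_def copy_first_def)
    show "K \<ge> 1" "a \<le> K"
      using a by (auto simp: K_def)
    fix ws :: "bool list list"
    assume len: "length ws = a"
    let ?s = "sum_list (map length ws)"
    let ?x = "ws ! 0" and ?u = "second_word ws"
    have ws: "ws = [?x] \<and> a = 1 \<or> ws = [?x, ?u] \<and> a = 2"
      using a len by (auto simp: second_word_def length_Suc_conv numeral_2_eq_2)
    have s: "?s = length ?x + length ?u"
      using ws by (smt (verit) One_nat_def add_0_right length_Cons list.map(1) list.simps(9) list.size(3) second_word_def sum_list.Cons sum_list.Nil less_irrefl)
    define w where "w = word_symbols ws"
    have w: "w b i \<le> 2" for b i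
      by (auto simp: w_def word_symbols_def symbol_at_le)
    let ?w0 = "w(False := \<lambda>p. 0)"
    define L where "L = g w (input_env ws 0)"
    define v where "v = (\<lambda>i. f w (input_env ws i))"
    let ?h0 = "\<lambda>_ :: nat. 0 :: nat"
    let ?h1 = "?h0(5 := length ?u)"
    let ?h2 = "?h1(4 := length ?x)"
    let ?h3 = "?h2(6 := L)"
    let ?h4 = "?h2(3 := L)"
    let ?t = "fst (word_tape ?x)"
    have env: "(?h2(3 := i)) (?loc j) = input_env ws i j" for i j
      by (auto simp: input_env_def split: nat.splits)
    have env0: "?h2 (?loc j) = input_env ws 0 j" for j
      by (auto simp: input_env_def split: nat.splits)
    have bnd: "input_env ws i j \<le> ?s + i" for i j
      unfolding s by (auto simp: input_env_def split: nat.splits)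
    have L: "L \<le> poly q ?s"
      unfolding L_def using q(1)[of w "input_env ws 0" ?s] w bnd[of 0] by simp
    have v: "v i \<le> poly ?p ?s" if "i < L" for i
    proof -
      have "input_env ws i j \<le> ?s + poly q ?s" for j
        using bnd[of i j] L that by linarith
      from p(1)[OF w this] show ?thesis
        by (simp add: v_def poly_pcompose)
    qed
    \<comment> \<open>Beyond the \<open>K\<close> tapes of the machine, \<sigma> is chosen to agree
      with the store that the marks produce.\<close>
    let ?\<sigma> = "\<lambda>i. if i < K then word_tape (if i < a then ws ! i else []) else store ?w0 (word_tape ?x) ?h0 i"
    have start: "(\<lambda>i. if 3 \<le> i \<and> i < K then act (1, Stay) (?\<sigma> i) else ?\<sigma> i) = store ?w0 (word_tape ?x) ?h0"
    proof
      fix i :: nat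
      consider "i = 0" | "i = 1" | "i = 2" | "3 \<le> i"
        by linarith
      then show "(if 3 \<le> i \<and> i < K then act (1, Stay) (?\<sigma> i) else ?\<sigma> i) = store ?w0 (word_tape ?x) ?h0 i"
        using a len by cases
          (auto simp: store_def cells_def K_def w_def word_symbols_def word_tape_symbols symbol_at_def
            second_word_def fun_eq_iff)
    qed
    have "?w0(False := symbol_at ?x) = w"
      by (auto simp: fun_eq_iff w_def word_symbols_def)
    then have 3: "runs copy_first (store ?w0 (word_tape ?x) ?h1)
        (store w (?t, int (length ?x)) ?h2) (16 * length ?x + 3)"
      using runs_copy_first[of ?w0 ?h1 ?x] by simp
    have 1: "runs (write_marks K) ?\<sigma> (store ?w0 (word_tape ?x) ?h0) (2 * K + 1)"
      using runs_write_marks[of K ?\<sigma>] unfolding start .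
    have 2: "runs measure_second (store ?w0 (word_tape ?x) ?h0) (store ?w0 (word_tape ?x) ?h1) (10 * length ?u + 3)"
      by (rule runs_measure_second) (auto simp: w_def word_symbols_def)
    have 4: "runs d (store w (?t, int (length ?x)) ?h2) (store w (?t, int (length ?x)) ?h3) (poly q ?s)"
      by (rule evaluatesD[OF d(2)]) (use w env0 bnd[of 0] in \<open>auto simp: L_def\<close>)
    have 5: "runs (transfer 6 3) (store w (?t, int (length ?x)) ?h3) (store w (?t, int (length ?x)) ?h4)
        (?h3 6 * 4 + 1)"
      by (rule runs_transfer) auto
    have "\<exists>T. runs ?loop (store w (?t, int (length ?x)) (?h2(3 := L))) (store w T (?h2(3 := 0)))
        (L * (poly p (?s + poly q ?s) + 2 * poly ?p ?s + 9 + 1) + 1) \<and> shows_word T (map (\<lambda>i. 0 < v i) [0..<L])"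
    proof (rule runs_write_bits[OF c(2)])
      show "?h2 (?loc i) \<le> ?s + poly q ?s" for i
        using env0[of i] bnd[of 0 i] by linarith
      show "f w (\<lambda>j. (?h2(3 := i)) (?loc j)) = v i" for i
        unfolding env v_def ..
    qed (use loc w v L in \<open>auto simp: word_tape_def\<close>)
    then obtain T where 6: "runs ?loop (store w (?t, int (length ?x)) ?h4) (store w T (?h2(3 := 0)))
        (L * (poly p (?s + poly q ?s) + 2 * poly ?p ?s + 9 + 1) + 1)"
      and T: "shows_word T (map (\<lambda>i. 0 < v i) [0..<L])"
      by blast
    have "L * (poly p (?s + poly q ?s) + 2 * poly ?p ?s + 9 + 1) \<le> poly q ?s * (3 * poly ?p ?s + 10)"
      using L by (intro mult_le_mono) (auto simp: poly_pcompose)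
    then have "runs ?c ?\<sigma> (store w T (?h2(3 := 0))) (poly ?r ?s)"
      by (intro runs_mono[OF runs_Seq[OF 1 runs_Seq[OF 2 runs_Seq[OF 3 runs_Seq[OF 4 runs_Seq[OF 5 6]]]]]])
        (use L s in \<open>auto simp: algebra_simps\<close>)
    moreover have "out ws = map (\<lambda>i. 0 < v i) [0..<L]"
      using out[OF len] by (simp add: v_def L_def w_def)
    ultimately show "\<exists>\<sigma> \<sigma>'. (\<forall>i<K. \<sigma> i = word_tape (if i < a then ws ! i else [])) \<and>
        runs ?c \<sigma> \<sigma>' (poly ?r ?s) \<and> shows_word (\<sigma>' 0) (out ws)"
      using T by (intro exI[of _ ?\<sigma>] exI[of _ "store w T (?h2(3 := 0))"]) auto
  qed
qed

section \<open>Closure properties of definable functions\<close>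

text \<open>Substitution under a bounded sum has to shift the substituted expressions; this special
  case provides the shift.\<close>

lemma definable_rename: "definable f \<Longrightarrow> definable (\<lambda>w \<rho>. f w (\<lambda>i. \<rho> (s i)))"
proof (induction arbitrary: s rule: definable.induct)
  case (definable_sum_case f g)
  have "(\<lambda>w \<rho>. \<Sum>i<f w (\<lambda>i. \<rho> (s i)). g w (case_nat i (\<lambda>i. \<rho> (s i)))) =
      (\<lambda>w \<rho>. \<Sum>i<f w (\<lambda>i. \<rho> (s i)). g w (\<lambda>j. (case_nat i \<rho>) (case_nat 0 (\<lambda>i. Suc (s i)) j)))"
    by (intro ext sum.cong arg_cong2[where f = g] refl) (auto split: nat.split)
  then show ?case
    using definable.definable_sum_case[OF definable_sum_case.IH] by simp
qed (auto intro: definable.intros)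

lemma definable_subst:
  "definable f \<Longrightarrow> (\<And>i. definable (e i)) \<Longrightarrow> definable (\<lambda>w \<rho>. f w (\<lambda>i. e i w \<rho>))"
proof (induction arbitrary: e rule: definable.induct)
  case (definable_sum_case f g)
  \<comment> \<open>Under the binder, variable 0 stays fixed and the expressions for the others skip
    it.\<close>
  let ?e = "case_nat (\<lambda>w \<rho>. \<rho> 0) (\<lambda>i w \<rho>. e i w (\<lambda>j. \<rho> (Suc j)))"
  have "definable (?e i)" for i
  proof (cases i)
    case 0
    then show ?thesis
      by (simp add: definable_var)
  next
    case (Suc j)
    then show ?thesis
      using definable_rename[OF definable_sum_case.prems, of j Suc] by simp
  qed
  from definable.definable_sum_case[OF definable_sum_case.IH(1)[OF definable_sum_case.prems]
      definable_sum_case.IH(2)[of ?e, OF this]]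
  have "definable (\<lambda>w \<rho>. \<Sum>i<f w (\<lambda>i. e i w \<rho>). g w (\<lambda>j. ?e j w (case_nat i \<rho>)))" .
  moreover have "(\<lambda>w \<rho>. \<Sum>i<f w (\<lambda>i. e i w \<rho>). g w (case_nat i (\<lambda>i. e i w \<rho>))) =
      (\<lambda>w \<rho>. \<Sum>i<f w (\<lambda>i. e i w \<rho>). g w (\<lambda>j. ?e j w (case_nat i \<rho>)))"
    by (intro ext sum.cong arg_cong2[where f = g] refl) (auto split: nat.split)
  ultimately show ?case
    by (simp only:)
qed (simp_all add: definable_const definable_add definable_sub definable_sym)

text \<open>A function that is definable in its own variables can be used like a function symbol.
  This keeps nested constructions folded when the definability of the reduction is shown.\<close>

lemma definable_app1:
  assumes "definable (\<lambda>w \<rho>. F w (\<rho> 0))" "definable a"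
  shows "definable (\<lambda>w \<rho>. F w (a w \<rho>))"
  using definable_subst[OF assms(1), of "\<lambda>_. a"] assms(2) by simp

lemma definable_app2:
  assumes "definable (\<lambda>w \<rho>. F w (\<rho> 0) (\<rho> 1))" "definable a" "definable b"
  shows "definable (\<lambda>w \<rho>. F w (a w \<rho>) (b w \<rho>))"
  using definable_subst[OF assms(1), of "\<lambda>i. if i = 0 then a else b"] assms(2,3) by simp

lemma definable_app3:
  assumes "definable (\<lambda>w \<rho>. F w (\<rho> 0) (\<rho> 1) (\<rho> 2))" "definable a" "definable b" "definable c"
  shows "definable (\<lambda>w \<rho>. F w (a w \<rho>) (b w \<rho>) (c w \<rho>))"
  using definable_subst[OF assms(1), of "\<lambda>i. if i = 0 then a else if i = 1 then b else c"] assms(2-)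
  by simp

lemma definable_Suc: "definable f \<Longrightarrow> definable (\<lambda>w \<rho>. Suc (f w \<rho>))"
  using definable_add[OF _ definable_const[of 1], of f] by simp

text \<open>The summand is given as a function of the bound variable and the outer environment, so
  that \<open>G\<close> is found by higher-order unification with an ordinary sum.\<close>

lemma definable_sum:
  assumes "definable F" "definable (\<lambda>w \<rho>. G w (\<rho> 0) (\<lambda>i. \<rho> (Suc i)))"
  shows "definable (\<lambda>w \<rho>. \<Sum>i<F w \<rho>. G w i \<rho>)"
  using definable_sum_case[OF assms] by simp

lemma definable_mult: "definable f \<Longrightarrow> definable g \<Longrightarrow> definable (\<lambda>w \<rho>. f w \<rho> * g w \<rho>)"
  using definable_sum[of f "\<lambda>w i \<rho>. g w \<rho>"] definable_rename[of g Suc] by simp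

lemma definable_not:
  assumes "definable (\<lambda>w \<rho>. of_bool (P w \<rho>))"
  shows "definable (\<lambda>w \<rho>. of_bool (\<not> P w \<rho>))"
proof -
  have "(\<lambda>w \<rho>. of_bool (\<not> P w \<rho>)) = (\<lambda>w \<rho>. 1 - of_bool (P w \<rho>) :: nat)"
    by (intro ext) auto
  then show ?thesis
    using definable_sub[OF definable_const[of 1] assms] by simp
qed

lemma definable_conj:
  assumes "definable (\<lambda>w \<rho>. of_bool (P w \<rho>))" "definable (\<lambda>w \<rho>. of_bool (Q w \<rho>))"
  shows "definable (\<lambda>w \<rho>. of_bool (P w \<rho> \<and> Q w \<rho>))"
  using definable_mult[OF assms] by (simp add: of_bool_conj)

lemma definable_disj:
  assumes "definable (\<lambda>w \<rho>. of_bool (P w \<rho>))" "definable (\<lambda>w \<rho>. of_bool (Q w \<rho>))"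
  shows "definable (\<lambda>w \<rho>. of_bool (P w \<rho> \<or> Q w \<rho>))"
  using definable_not[OF definable_conj[OF assms[THEN definable_not]]] by simp

lemma definable_imp:
  assumes "definable (\<lambda>w \<rho>. of_bool (P w \<rho>))" "definable (\<lambda>w \<rho>. of_bool (Q w \<rho>))"
  shows "definable (\<lambda>w \<rho>. of_bool (P w \<rho> \<longrightarrow> Q w \<rho>))"
  using definable_disj[OF definable_not[OF assms(1)] assms(2)] by (simp only: imp_conv_disj)

lemma definable_le:
  assumes "definable f" "definable g"
  shows "definable (\<lambda>w \<rho>. of_bool (f w \<rho> \<le> g w \<rho>))"
proof -
  have "(\<lambda>w \<rho>. of_bool (f w \<rho> \<le> g w \<rho>)) = (\<lambda>w \<rho>. 1 - (f w \<rho> - g w \<rho>))"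
    by (intro ext) auto
  then show ?thesis
    using definable_sub[OF definable_const[of 1] definable_sub[OF assms]] by simp
qed

lemma definable_less:
  assumes "definable f" "definable g"
  shows "definable (\<lambda>w \<rho>. of_bool (f w \<rho> < g w \<rho>))"
  using definable_not[OF definable_le[OF assms(2,1)]] by (simp add: not_le)

lemma definable_eq:
  assumes "definable f" "definable g"
  shows "definable (\<lambda>w \<rho>. of_bool (f w \<rho> = g w \<rho>))"
  using definable_conj[OF definable_le[OF assms] definable_le[OF assms(2,1)]] by (simp add: eq_iff)

lemma definable_ex:
  assumes "definable F" "definable (\<lambda>w \<rho>. of_bool (P w (\<rho> 0) (\<lambda>i. \<rho> (Suc i))))"
  shows "definable (\<lambda>w \<rho>. of_bool (\<exists>i<F w \<rho>. P w i \<rho>))"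
proof -
  have "(\<lambda>w \<rho>. of_bool (\<exists>i<F w \<rho>. P w i \<rho>)) = (\<lambda>w \<rho>. of_bool (0 < (\<Sum>i<F w \<rho>. of_bool (P w i \<rho>) :: nat)) :: nat)"
    by (intro ext) (auto simp: sum_eq_0_iff)
  then show ?thesis
    using definable_less[OF definable_const[of 0] definable_sum[OF assms]] by simp
qed

lemma definable_all:
  assumes "definable F" "definable (\<lambda>w \<rho>. of_bool (P w (\<rho> 0) (\<lambda>i. \<rho> (Suc i))))"
  shows "definable (\<lambda>w \<rho>. of_bool (\<forall>i<F w \<rho>. P w i \<rho>))"
  using definable_not[OF definable_ex[OF assms(1) definable_not[OF assms(2)]]] by simp

lemma definable_if:
  assumes "definable (\<lambda>w \<rho>. of_bool (P w \<rho>))" "definable f" "definable g"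
  shows "definable (\<lambda>w \<rho>. if P w \<rho> then f w \<rho> else g w \<rho>)"
proof -
  have "(\<lambda>w \<rho>. if P w \<rho> then f w \<rho> else g w \<rho>) =
      (\<lambda>w \<rho>. of_bool (P w \<rho>) * f w \<rho> + of_bool (\<not> P w \<rho>) * g w \<rho>)"
    by (intro ext) auto
  then show ?thesis
    using assms by (auto intro!: definable_add definable_mult definable_not)
qed

lemma definable_div:
  assumes "definable f" "definable g"
  shows "definable (\<lambda>w \<rho>. f w \<rho> div g w \<rho>)"
proof (rule definable_app2[OF _ assms])
  \<comment> \<open>A quotient is the number of positive multiples of \<open>n\<close> up to
    \<open>m\<close>; the condition \<open>0 < n\<close> reproduces division by zero.\<close>
  have "m div n = (\<Sum>i<m. of_bool (0 < n \<and> Suc i * n \<le> m))" for m n :: nat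
  proof (cases "n = 0")
    case False
    have "(\<Sum>i<m. of_bool (0 < n \<and> Suc i * n \<le> m)) = card {i\<in>{..<m}. Suc i * n \<le> m}"
      using False by (simp add: Int_def)
    also have "{i\<in>{..<m}. Suc i * n \<le> m} = {..<m div n}"
    proof -
      have "Suc i * n \<le> m \<longleftrightarrow> i < m div n" for i
        using False by (metis Suc_le_eq less_eq_div_iff_mult_less_eq neq0_conv)
      moreover have "i < m" if "i < m div n" for i
        using that div_le_dividend[of m n] by linarith
      ultimately show ?thesis
        by blast
    qed
    finally show ?thesis
      by simp
  qed simp
  then show "definable (\<lambda>w \<rho>. \<rho> 0 div \<rho> 1)"
    by (simp only:) (intro definable_sum definable_conj definable_less definable_le definable_mult
      definable_Suc definable_var definable_const)
qed

lemma definable_mod: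
  assumes "definable f" "definable g"
  shows "definable (\<lambda>w \<rho>. f w \<rho> mod g w \<rho>)"
  unfolding modulo_nat_def using assms by (intro definable_sub definable_mult definable_div)

lemma definable_min: "definable f \<Longrightarrow> definable g \<Longrightarrow> definable (\<lambda>w \<rho>. min (f w \<rho>) (g w \<rho>))"
  unfolding min_def by (intro definable_if definable_le)

lemma definable_max: "definable f \<Longrightarrow> definable g \<Longrightarrow> definable (\<lambda>w \<rho>. max (f w \<rho>) (g w \<rho>))"
  unfolding max_def by (intro definable_if definable_le)

lemma definable_poly: "definable f \<Longrightarrow> definable (\<lambda>w \<rho>. poly p (f w \<rho>))"
  by (induction p) (auto intro!: definable_const definable_add definable_mult)

text \<open>Arbitrary finite functions, such as the transitions of a given machine, enter
  expressions in this form; the default 0 makes them total.\<close>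

definition table :: "nat \<Rightarrow> (nat \<Rightarrow> nat) \<Rightarrow> nat \<Rightarrow> nat" where
  "table R t x = (if x < R then t x else 0)"

lemma definable_table: "definable f \<Longrightarrow> definable (\<lambda>w \<rho>. table R t (f w \<rho>))"
proof (induction R)
  case 0
  then show ?case
    by (simp add: table_def definable_const)
next
  case (Suc R)
  have "(\<lambda>w \<rho>. table (Suc R) t (f w \<rho>)) = (\<lambda>w \<rho>. if f w \<rho> = R then t R else table R t (f w \<rho>))"
    by (intro ext) (auto simp: table_def less_Suc_eq)
  moreover have "definable (\<lambda>w \<rho>. table R t (f w \<rho>))"
    using Suc by simp
  ultimately show ?case
    using Suc.prems by (simp only:) (intro definable_if definable_eq definable_const)
qed

lemmas definable_intros =
  definable_const definable_var definable_add definable_sub definable_sym definable_Suc definable_sum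
  definable_mult definable_not definable_conj definable_disj definable_imp definable_le
  definable_less definable_eq definable_ex definable_all definable_if definable_div definable_mod
  definable_min definable_max definable_poly definable_table

lemma NP_definable:
  assumes "definable f"
    and "\<And>x. x \<in> L \<longleftrightarrow> (\<exists>u. length u \<le> poly p (length x) \<and> 0 < f (word_symbols [x, u]) (input_env [x, u] 0))"
  shows "L \<in> NP"
proof -
  let ?V = "\<lambda>ws. [0 < f (word_symbols ws) (input_env ws 0)]"
  have "polytime 2 ?V"
    by (rule polytime_definable[OF assms(1) definable_const[of 1]]) auto
  then show ?thesis
    unfolding NP_def using assms(2) by (auto intro!: exI[of _ ?V])
qed

section \<open>Strong rainbow connection in split graphs\<close>

text \<open>Shortest paths are spelled out without any quantifier over lists. The ban on common
  neighbours in the last case makes a walk with three edges a shortest path. Distinctness of the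
  vertices is not demanded, as it follows from the absence of loops and from the failure of the
  earlier cases.\<close>

definition rainbow_links :: "'a set \<Rightarrow> 'a set set \<Rightarrow> ('a set \<Rightarrow> 'c) \<Rightarrow> bool" where
  "rainbow_links V E c \<longleftrightarrow> (\<forall>u\<in>V. \<forall>v\<in>V. u = v \<or> {u, v} \<in> E \<or>
     (\<exists>a\<in>V. {u, a} \<in> E \<and> {a, v} \<in> E \<and> c {u, a} \<noteq> c {a, v}) \<or>
     ((\<forall>a\<in>V. \<not> ({u, a} \<in> E \<and> {a, v} \<in> E)) \<and>
      (\<exists>a\<in>V. \<exists>b\<in>V. {u, a} \<in> E \<and> {a, b} \<in> E \<and> {b, v} \<in> E \<and>
         c {u, a} \<noteq> c {a, b} \<and> c {u, a} \<noteq> c {b, v} \<and> c {a, b} \<noteq> c {b, v})))"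

lemma no_loop: "simple_graph V E \<Longrightarrow> {u, u} \<notin> E"
  by (auto simp: simple_graph_def)

lemma path_between_short:
  assumes "path_between V E u v xs"
  shows "(length xs = 1 \<longrightarrow> xs = [u] \<and> u = v) \<and>
    (length xs = 2 \<longrightarrow> xs = [u, v] \<and> {u, v} \<in> E) \<and>
    (length xs = 3 \<longrightarrow> (\<exists>a\<in>V. xs = [u, a, v] \<and> {u, a} \<in> E \<and> {a, v} \<in> E)) \<and>
    (length xs = 4 \<longrightarrow> (\<exists>a\<in>V. \<exists>b\<in>V. xs = [u, a, b, v] \<and> {u, a} \<in> E \<and> {a, b} \<in> E \<and> {b, v} \<in> E)) \<and>
    length xs \<noteq> 0"
  using assms by (auto simp: path_between_def numeral_eq_Suc length_Suc_conv)

lemma path_edges_simps [simp]: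
  "path_edges [] = []" "path_edges [a] = []" "path_edges (a # b # xs) = {a, b} # path_edges (b # xs)"
  by (auto simp: path_edges_def)

lemma path_edges_subset: "e \<in> set (path_edges xs) \<Longrightarrow> e \<subseteq> set xs"
  by (induction xs rule: induct_list012) auto

lemma distinct_path_edges: "distinct xs \<Longrightarrow> distinct (path_edges xs)"
  by (induction xs rule: induct_list012) (auto dest: path_edges_subset)

lemma path_edges_in: "successively (\<lambda>a b. {a, b} \<in> E) xs \<Longrightarrow> set (path_edges xs) \<subseteq> E"
  by (induction xs rule: induct_list012) auto

lemma rainbow_inj:
  assumes "inj_on c E" "path_between V E u v xs"
  shows "rainbow c xs"
  unfolding rainbow_def distinct_map
  using assms distinct_path_edges[of xs] path_edges_in[of E xs]
  by (auto simp: path_between_def intro: inj_on_subset)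

lemma rainbow_comp:
  assumes "inj_on f (c ` E)" "path_between V E u v xs" "rainbow c xs"
  shows "rainbow (f \<circ> c) xs"
proof -
  have "set (map c (path_edges xs)) \<subseteq> c ` E"
    using path_edges_in[of E xs] assms(2) by (auto simp: path_between_def)
  with assms(1) have "inj_on f (set (map c (path_edges xs)))"
    by (rule inj_on_subset)
  then have "distinct (map f (map c (path_edges xs)))"
    using assms(3) by (subst distinct_map) (simp add: rainbow_def)
  then show ?thesis
    by (simp add: rainbow_def)
qed

lemma ex_shortest_path:
  assumes "connected_graph V E" "u \<in> V" "v \<in> V"
  shows "\<exists>xs. shortest_path V E u v xs"
proof -
  obtain xs where "path_between V E u v xs"
    using assms by (auto simp: connected_graph_def)
  from ex_has_least_nat[of "path_between V E u v", OF this, of length] show ?thesis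
    by (auto simp: shortest_path_def)
qed

lemma finite_edges: "simple_graph V E \<Longrightarrow> finite E"
  unfolding simple_graph_def using finite_subset[of E "Pow V"] by auto

text \<open>\<open>src\<close> counts the colours occurring on edges. An injective renaming of the
  colours preserves rainbow paths, so at most \<open>k\<close> colours can be taken to be the
  numbers below \<open>k\<close>.\<close>

lemma src_le_iff:
  assumes G: "simple_graph V E" and conn: "connected_graph V E" and "0 < k"
  shows "src V E \<le> k \<longleftrightarrow> (\<exists>c :: 'a set \<Rightarrow> nat. (\<forall>e. c e < k) \<and> strongly_rainbow_connected V E c)"
proof
  let ?P = "\<lambda>m. \<exists>c :: 'a set \<Rightarrow> nat. card (c ` E) = m \<and> strongly_rainbow_connected V E c"
  have fin: "finite E"
    using finite_edges[OF G] .
  \<comment> \<open>Giving all edges different colours shows that the set under \<open>LEAST\<close>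
    is not empty, so the minimum is attained.\<close>
  then obtain f :: "'a set \<Rightarrow> nat" where f: "inj_on f E"
    using finite_imp_inj_to_nat_seg by blast
  then have "strongly_rainbow_connected V E f"
    unfolding strongly_rainbow_connected_def
    using ex_shortest_path[OF conn] rainbow_inj[OF f] by (metis shortest_path_def)
  then have "?P (card (f ` E))"
    by blast
  then have "?P (src V E)"
    unfolding src_def by (rule LeastI)
  then obtain c :: "'a set \<Rightarrow> nat" where c: "card (c ` E) = src V E" "strongly_rainbow_connected V E c"
    by blast
  assume "src V E \<le> k"
  then obtain g where g: "inj_on g (c ` E)" "g ` c ` E \<subseteq> {..<k}"
    using c(1) fin card_le_inj[of "c ` E" "{..<k}"] by auto
  \<comment> \<open>The default 0 outside \<open>E\<close> extends the bound \<open>k\<close> to all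
    arguments.\<close>
  define d where "d = (\<lambda>e. if e \<in> E then g (c e) else 0)"
  have "rainbow d xs = rainbow (g \<circ> c) xs" if "path_between V E u v xs" for u v xs
  proof -
    have "map d (path_edges xs) = map (g \<circ> c) (path_edges xs)"
      using that path_edges_in[of E xs] by (auto simp: path_between_def d_def)
    then show ?thesis
      unfolding rainbow_def by (simp only:)
  qed
  then have "strongly_rainbow_connected V E d"
    using c(2) rainbow_comp[OF g(1)] unfolding strongly_rainbow_connected_def
    by (metis shortest_path_def)
  moreover have "d e < k" for e
    using g(2) \<open>0 < k\<close> by (auto simp: d_def)
  ultimately show "\<exists>c :: 'a set \<Rightarrow> nat. (\<forall>e. c e < k) \<and> strongly_rainbow_connected V E c"
    by blast
next
  assume "\<exists>c :: 'a set \<Rightarrow> nat. (\<forall>e. c e < k) \<and> strongly_rainbow_connected V E c"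
  then obtain c :: "'a set \<Rightarrow> nat" where c: "\<And>e. c e < k" "strongly_rainbow_connected V E c"
    by blast
  have "src V E \<le> card (c ` E)"
    unfolding src_def by (rule Least_le) (use c(2) in blast)
  also have "\<dots> \<le> card {..<k}"
    by (rule card_mono) (use c(1) in auto)
  finally show "src V E \<le> k"
    by simp
qed

lemma path_between_neighbour:
  assumes "path_between V E u v xs" "u \<noteq> v"
  shows "\<exists>a\<in>V. {u, a} \<in> E"
  using assms by (cases xs; cases "tl xs") (auto simp: path_between_def)

text \<open>If \<open>u\<close> were in the clique, then \<open>v\<close> would be independent, and
  a neighbour of \<open>v\<close>, which lies in the clique, would be a common neighbour; the same
  holds for \<open>v\<close>. So both are independent, and a neighbour of \<open>u\<close> and one
  of \<open>v\<close> are joined inside the clique.\<close>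

lemma split_graph_far:
  assumes "split_graph V E" "connected_graph V E" and uv: "u \<in> V" "v \<in> V" "u \<noteq> v" "{u, v} \<notin> E"
    and none: "\<And>a. a \<in> V \<Longrightarrow> {u, a} \<in> E \<Longrightarrow> {a, v} \<notin> E"
  shows "\<exists>a\<in>V. \<exists>b\<in>V. {u, a} \<in> E \<and> {a, b} \<in> E \<and> {b, v} \<in> E \<and> distinct [u, a, b, v]"
proof -
  obtain K I where "K \<union> I = V \<and> K \<inter> I = {} \<and>
      (\<forall>u\<in>K. \<forall>v\<in>K. u \<noteq> v \<longrightarrow> {u, v} \<in> E) \<and> (\<forall>u\<in>I. \<forall>v\<in>I. {u, v} \<notin> E)"
    using assms(1) unfolding split_graph_def by (elim exE)
  then have V: "\<And>u. u \<in> V \<Longrightarrow> u \<in> K \<or> u \<in> I" and disj: "\<And>u. u \<in> K \<Longrightarrow> u \<notin> I"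
    and K: "\<And>u v. u \<in> K \<Longrightarrow> v \<in> K \<Longrightarrow> u \<noteq> v \<Longrightarrow> {u, v} \<in> E"
    and I: "\<And>u v. u \<in> I \<Longrightarrow> v \<in> I \<Longrightarrow> {u, v} \<notin> E"
    by blast+
  obtain xs ys where "path_between V E u v xs" "path_between V E v u ys"
    using assms(2) uv(1,2) unfolding connected_graph_def by blast
  then obtain a b where ab: "a \<in> V" "{u, a} \<in> E" "b \<in> V" "{v, b} \<in> E"
    using path_between_neighbour uv(3) by metis
  then have bv: "{b, v} \<in> E"
    by (simp add: insert_commute)
  have "u \<in> I"
  proof (rule ccontr)
    assume "u \<notin> I"
    then have "u \<in> K" "v \<in> I"
      using V K uv by blast+
    then have "b \<in> K" "b \<noteq> u"
      using V I ab(3) bv uv(4) by blast+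
    then show False
      using K[OF \<open>u \<in> K\<close>, of b] none[OF ab(3)] bv by simp
  qed
  moreover have "v \<in> I"
  proof (rule ccontr)
    assume "v \<notin> I"
    then have "v \<in> K"
      using V uv by blast
    moreover have "a \<in> K" "a \<noteq> v"
      using V I \<open>u \<in> I\<close> ab(1,2) uv(4) by blast+
    ultimately show False
      using K[of a v] none[OF ab(1,2)] by simp
  qed
  ultimately have "a \<in> K" "b \<in> K" "a \<noteq> u" "a \<noteq> v" "b \<noteq> u" "b \<noteq> v"
    using V I ab bv disj by blast+
  moreover have "a \<noteq> b"
    using none[OF ab(1,2)] bv by blast
  ultimately show ?thesis
    using K[of a b] ab bv uv(3) by auto
qed

text \<open>Distances are at most three by \<open>split_graph_far\<close>, so a shortest path has at
  most four vertices and its colours can be compared one by one.\<close>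

lemma strongly_rainbow_connected_iff_links:
  assumes G: "simple_graph V E" and split: "split_graph V E" and conn: "connected_graph V E"
  shows "strongly_rainbow_connected V E c \<longleftrightarrow> rainbow_links V E c"
proof
  assume c: "strongly_rainbow_connected V E c"
  show "rainbow_links V E c"
    unfolding rainbow_links_def
  proof (intro ballI)
    fix u v
    assume uv: "u \<in> V" "v \<in> V"
    obtain xs where "shortest_path V E u v xs" and rb: "rainbow c xs"
      using c uv unfolding strongly_rainbow_connected_def by blast
    then have xs: "path_between V E u v xs"
      and least: "\<And>ys. path_between V E u v ys \<Longrightarrow> length xs \<le> length ys"
      by (auto simp: shortest_path_def)
    note short = path_between_short[OF xs]
    consider "u = v \<or> {u, v} \<in> E"
      | a where "u \<noteq> v" "{u, v} \<notin> E" "a \<in> V" "{u, a} \<in> E" "{a, v} \<in> E"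
      | "u \<noteq> v" "{u, v} \<notin> E" "\<And>a. a \<in> V \<Longrightarrow> {u, a} \<in> E \<Longrightarrow> {a, v} \<notin> E"
      by blast
    then show "u = v \<or> {u, v} \<in> E \<or>
     (\<exists>a\<in>V. {u, a} \<in> E \<and> {a, v} \<in> E \<and> c {u, a} \<noteq> c {a, v}) \<or>
     ((\<forall>a\<in>V. \<not> ({u, a} \<in> E \<and> {a, v} \<in> E)) \<and>
      (\<exists>a\<in>V. \<exists>b\<in>V. {u, a} \<in> E \<and> {a, b} \<in> E \<and> {b, v} \<in> E \<and>
         c {u, a} \<noteq> c {a, b} \<and> c {u, a} \<noteq> c {b, v} \<and> c {a, b} \<noteq> c {b, v}))"
    proof cases
      case 1
      then show ?thesis
        by blast
    next
      case (2 a)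
      have "a \<noteq> u" "a \<noteq> v"
        using 2(4,5) no_loop[OF G] by metis+
      then have "path_between V E u v [u, a, v]"
        using uv 2 by (simp add: path_between_def)
      from least[OF this] have "length xs \<le> 3"
        by simp
      moreover have "length xs \<noteq> 0" "length xs \<noteq> 1" "length xs \<noteq> 2"
        using short 2(1,2) by blast+
      ultimately have "length xs = 3"
        by linarith
      then obtain d where "d \<in> V" "xs = [u, d, v]" "{u, d} \<in> E" "{d, v} \<in> E"
        using short by blast
      moreover have "c {u, d} \<noteq> c {d, v}"
        using rb calculation(2) by (simp add: rainbow_def)
      ultimately show ?thesis
        by blast
    next
      case 3
      obtain a b where "a \<in> V" "b \<in> V" "{u, a} \<in> E" "{a, b} \<in> E" "{b, v} \<in> E" "distinct [u, a, b, v]"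
        using split_graph_far[OF split conn uv 3] by blast
      then have "path_between V E u v [u, a, b, v]"
        using uv by (simp add: path_between_def)
      from least[OF this] have "length xs \<le> 4"
        by simp
      moreover have "length xs \<noteq> 0" "length xs \<noteq> 1" "length xs \<noteq> 2" "length xs \<noteq> 3"
        using short 3 by blast+
      ultimately have "length xs = 4"
        by linarith
      then obtain d e where "d \<in> V" "e \<in> V" "xs = [u, d, e, v]" "{u, d} \<in> E" "{d, e} \<in> E" "{e, v} \<in> E"
        using short by blast
      moreover have "c {u, d} \<noteq> c {d, e}" "c {u, d} \<noteq> c {e, v}" "c {d, e} \<noteq> c {e, v}"
        using rb calculation(3) by (simp_all add: rainbow_def)
      ultimately show ?thesis
        using 3(3) by blast
    qed
  qed
next
  assume c: "rainbow_links V E c"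
  show "strongly_rainbow_connected V E c"
    unfolding strongly_rainbow_connected_def
  proof (intro ballI)
    fix u v
    assume uv: "u \<in> V" "v \<in> V"
    have len: "(u \<noteq> v \<longrightarrow> 2 \<le> length ys) \<and> (u \<noteq> v \<and> {u, v} \<notin> E \<longrightarrow> 3 \<le> length ys) \<and>
        (u \<noteq> v \<and> {u, v} \<notin> E \<and> (\<forall>a\<in>V. \<not> ({u, a} \<in> E \<and> {a, v} \<in> E)) \<longrightarrow> 4 \<le> length ys) \<and> 1 \<le> length ys"
      if "path_between V E u v ys" for ys
    proof -
      have "length ys = 0 \<or> length ys = 1 \<or> length ys = 2 \<or> length ys = 3 \<or> 4 \<le> length ys"
        by linarith
      then show ?thesis
        using path_between_short[OF that] by (elim disjE) auto
    qed
    consider "u = v" | "u \<noteq> v" "{u, v} \<in> E"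
      | a where "u \<noteq> v" "{u, v} \<notin> E" "a \<in> V" "{u, a} \<in> E" "{a, v} \<in> E" "c {u, a} \<noteq> c {a, v}"
      | a b where "u \<noteq> v" "{u, v} \<notin> E" "\<forall>a\<in>V. \<not> ({u, a} \<in> E \<and> {a, v} \<in> E)" "a \<in> V" "b \<in> V"
        "{u, a} \<in> E" "{a, b} \<in> E" "{b, v} \<in> E"
        "c {u, a} \<noteq> c {a, b}" "c {u, a} \<noteq> c {b, v}" "c {a, b} \<noteq> c {b, v}"
      using c uv unfolding rainbow_links_def by blast
    then show "\<exists>xs. shortest_path V E u v xs \<and> rainbow c xs"
    proof cases
      case 1
      then have "path_between V E u v [u]"
        using uv by (auto simp: path_between_def)
      then show ?thesis
        using len by (intro exI[of _ "[u]"]) (auto simp: shortest_path_def rainbow_def)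
    next
      case 2
      then have "path_between V E u v [u, v]"
        using uv by (auto simp: path_between_def)
      then show ?thesis
        using 2 len by (intro exI[of _ "[u, v]"]) (simp add: shortest_path_def rainbow_def numeral_eq_Suc)
    next
      case (3 a)
      then have "a \<noteq> u" "a \<noteq> v"
        using no_loop[OF G] by auto
      then have "path_between V E u v [u, a, v]"
        using uv 3 by (auto simp: path_between_def)
      then show ?thesis
        using 3 len by (intro exI[of _ "[u, a, v]"]) (simp add: shortest_path_def rainbow_def numeral_eq_Suc)
    next
      case (4 a b)
      have eq: "{b, v} = {v, b}" for b
        by auto
      have "a \<noteq> u" "a \<noteq> v" "b \<noteq> u" "b \<noteq> v" "a \<noteq> b"
        using 4 no_loop[OF G] eq by metis+
      then have "path_between V E u v [u, a, b, v]"
        using uv 4 by (auto simp: path_between_def)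
      then show ?thesis
        using 4 len by (intro exI[of _ "[u, a, b, v]"]) (simp add: shortest_path_def rainbow_def numeral_eq_Suc)
    qed
  qed
qed

text \<open>Connectedness is a consequence of the colour condition, so a verifier does not have to
  test it separately.\<close>

lemma connected_if_links:
  assumes "simple_graph V E" "V \<noteq> {}" "rainbow_links V E c"
  shows "connected_graph V E"
  unfolding connected_graph_def
proof (intro conjI ballI assms(2))
  fix u v
  assume uv: "u \<in> V" "v \<in> V"
  define S where "S = {(u, v). u \<in> V \<and> v \<in> V \<and> {u, v} \<in> E}"
  have "\<exists>xs. path_between V E u t xs" if "(u, t) \<in> S\<^sup>*" "u \<in> V" for t
    using that
  proof (induction rule: rtrancl_induct)
    case base
    then show ?case
      by (intro exI[of _ "[u]"]) (auto simp: path_between_def)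
  next
    case (step s t)
    then obtain xs where xs: "path_between V E u s xs"
      by blast
    show ?case
    \<comment> \<open>Paths have distinct vertices; if \<open>t\<close> was visited before, the path
      is cut off there.\<close>
    proof (cases "t \<in> set xs")
      case True
      then obtain ys zs where "xs = ys @ t # zs"
        by (auto simp: in_set_conv_decomp)
      then have "path_between V E u t (ys @ [t])"
        using xs by (auto simp: path_between_def successively_append_iff hd_append)
      then show ?thesis
        by blast
    next
      case False
      then have "path_between V E u t (xs @ [t])"
        using xs step by (auto simp: path_between_def successively_append_iff S_def)
      then show ?thesis
        by blast
    qed
  qed
  moreover have "(u, v) \<in> S\<^sup>*"
  proof -
    have "u = v \<or> {u, v} \<in> E \<or> (\<exists>a\<in>V. {u, a} \<in> E \<and> {a, v} \<in> E) \<or>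
        (\<exists>a\<in>V. \<exists>b\<in>V. {u, a} \<in> E \<and> {a, b} \<in> E \<and> {b, v} \<in> E)"
      using assms(3) uv unfolding rainbow_links_def by blast
    then have "u = v \<or> (u, v) \<in> S \<or> (\<exists>a. (u, a) \<in> S \<and> (a, v) \<in> S) \<or> (\<exists>a b. (u, a) \<in> S \<and> (a, b) \<in> S \<and> (b, v) \<in> S)"
      using uv unfolding S_def by blast
    then show ?thesis
      by (metis converse_rtrancl_into_rtrancl r_into_rtrancl rtrancl.rtrancl_refl)
  qed
  ultimately show "\<exists>xs. path_between V E u v xs"
    using uv by blast
qed

lemma split_src_iff:
  fixes V :: "'a set"
  assumes "simple_graph V E" "split_graph V E" "V \<noteq> {}" "0 < k"
  shows "connected_graph V E \<and> src V E \<le> k \<longleftrightarrow>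
    (\<exists>c :: 'a set \<Rightarrow> nat. (\<forall>e. c e < k) \<and> rainbow_links V E c)"
  using assms connected_if_links src_le_iff strongly_rainbow_connected_iff_links by metis

section \<open>Membership in NP\<close>

lemma concat_rows:
  "concat (map (\<lambda>i. map (f i) [0..<n]) [0..<m]) = map (\<lambda>p. f (p div n) (p mod n)) [0..<m * n]"
proof (induction m)
  case (Suc m)
  have "[0..<Suc m * n] = [0..<m * n] @ map (\<lambda>j. j + m * n) [0..<n]"
    using upt_add_eq_append[of 0 "m * n" n] map_add_upt[of "m * n" n] by (simp add: add.commute)
  moreover have "map (\<lambda>p. f (p div n) (p mod n)) (map (\<lambda>j. j + m * n) [0..<n]) = map (f m) [0..<n]"
    by (cases "n = 0") auto
  ultimately show ?case
    using Suc by simp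
qed simp

text \<open>This is the form needed for definability: a single bit as a function of its position,
  with the delimiter at \<open>n\<close>.\<close>

lemma encode_graph_map:
  "encode_graph n E =
     map (\<lambda>p. p < n \<or> (p \<noteq> n \<and> {(p - Suc n) div n, (p - Suc n) mod n} \<in> E)) [0..<Suc (n + n * n)]"
  unfolding encode_graph_def concat_rows
  by (rule nth_equalityI) (auto simp: nth_append nth_Cons' simp del: upt_Suc)

lemma length_encode_graph: "length (encode_graph n E) = Suc (n + n * n)"
  by (simp add: encode_graph_map)

lemma matrix_index:
  assumes "i < n" "j < n"
  shows "i * n + j < n * n" "(i * n + j) div n = i" "(i * n + j) mod n = (j :: nat)"
proof -
  have "i * n + j < Suc i * n"
    using assms by simp
  also have "\<dots> \<le> n * n"
    using assms by (intro mult_le_mono1) simp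
  finally show "i * n + j < n * n" .
qed (use assms in auto)

lemma symbol_at_eq_iff:
  "symbol_at x p = 2 \<longleftrightarrow> p < length x \<and> x ! p" "symbol_at x p = Suc 0 \<longleftrightarrow> p < length x \<and> \<not> x ! p"
  by (auto simp: symbol_at_def bit_symbol_def)

lemma symbol_at_map: "p < L \<Longrightarrow> symbol_at (map f [0..<L]) p = bit_symbol (f p)"
  by (simp add: symbol_at_def)

lemma encode_graph_edge:
  assumes "i < n" "j < n"
  shows "symbol_at (encode_graph n E) (Suc n + i * n + j) = 2 \<longleftrightarrow> {i, j} \<in> E"
proof -
  have "Suc n + i * n + j - Suc n = i * n + j"
    by simp
  then show ?thesis
    using matrix_index[OF assms] unfolding encode_graph_map
    by (subst symbol_at_map) (auto simp: bit_symbol_def)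
qed

definition edge_symbol :: "(bool \<Rightarrow> nat \<Rightarrow> nat) \<Rightarrow> nat \<Rightarrow> nat \<Rightarrow> nat \<Rightarrow> bool" where
  "edge_symbol w n i j \<longleftrightarrow> w False (Suc n + i * n + j) = 2"

text \<open>The certificate lists the vertices of the clique, followed by \<open>k - 1\<close> matrices; the
  colour of an edge is the number of these matrices that contain it, and hence less than \<open>k\<close>.\<close>

definition certified_colour :: "nat \<Rightarrow> (bool \<Rightarrow> nat \<Rightarrow> nat) \<Rightarrow> nat \<Rightarrow> nat \<Rightarrow> nat \<Rightarrow> nat" where
  "certified_colour k w n i j =
     (\<Sum>t<k - 1. of_bool (w True (n + t * (n * n) + (min i j * n + max i j)) = 2))"

text \<open>All that must be checked about a matrix \<open>e\<close>, a clique \<open>K\<close> and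
  colours \<open>d\<close>, with every quantifier bounded by \<open>n\<close>: a simple graph, a
  split partition, and \<open>rainbow_links\<close>.\<close>

definition split_links :: "nat \<Rightarrow> (nat \<Rightarrow> nat \<Rightarrow> bool) \<Rightarrow> (nat \<Rightarrow> bool) \<Rightarrow> (nat \<Rightarrow> nat \<Rightarrow> nat) \<Rightarrow> bool" where
  "split_links n e K d \<longleftrightarrow> (\<forall>i<n. \<not> e i i \<and> (\<forall>j<n.
     (e i j \<longrightarrow> e j i) \<and> (K i \<and> K j \<and> \<not> i = j \<longrightarrow> e i j) \<and> (\<not> K i \<and> \<not> K j \<longrightarrow> \<not> e i j) \<and>
     (i = j \<or> e i j \<or> (\<exists>a<n. e i a \<and> e a j \<and> \<not> d i a = d a j) \<or>
       ((\<forall>a<n. \<not> (e i a \<and> e a j)) \<and>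
        (\<exists>a<n. \<exists>b<n. e i a \<and> e a b \<and> e b j \<and> \<not> d i a = d a b \<and> \<not> d i a = d b j \<and> \<not> d a b = d b j)))))"

lemma split_links_cong:
  assumes "\<And>i j. i < n \<Longrightarrow> j < n \<Longrightarrow> e i j = e' i j" "\<And>i. i < n \<Longrightarrow> K i = K' i"
    "\<And>i j. i < n \<Longrightarrow> j < n \<Longrightarrow> d i j = d' i j"
  shows "split_links n e K d = split_links n e' K' d'"
  unfolding split_links_def using assms by (simp cong: conj_cong)

lemma split_links_iff:
  assumes "simple_graph {..<n} E" "0 < n" "0 < k"
  shows "connected_graph {..<n} E \<and> split_graph {..<n} E \<and> src {..<n} E \<le> k \<longleftrightarrow>
    (\<exists>K c. (\<forall>e. c e < k) \<and> split_links n (\<lambda>i j. {i, j} \<in> E) K (\<lambda>i j. c {i, j}))"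
proof -
  have links: "split_links n (\<lambda>i j. {i, j} \<in> E) K (\<lambda>i j. c {i, j}) \<longleftrightarrow>
      (\<forall>i<n. \<forall>j<n. (K i \<and> K j \<and> i \<noteq> j \<longrightarrow> {i, j} \<in> E) \<and> (\<not> K i \<and> \<not> K j \<longrightarrow> {i, j} \<notin> E)) \<and>
      rainbow_links {..<n} E c" (is "?L = ?R") for K and c :: "nat set \<Rightarrow> nat"
  proof
    show "?L \<Longrightarrow> ?R"
      unfolding split_links_def rainbow_links_def Ball_def Bex_def lessThan_iff by blast
    show "?R \<Longrightarrow> ?L"
      using no_loop[OF assms(1)]
      unfolding split_links_def rainbow_links_def Ball_def Bex_def lessThan_iff
      by (simp add: insert_commute)
  qed
  have split: "split_graph {..<n} E \<longleftrightarrow>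
      (\<exists>K. \<forall>i<n. \<forall>j<n. (K i \<and> K j \<and> i \<noteq> j \<longrightarrow> {i, j} \<in> E) \<and> (\<not> K i \<and> \<not> K j \<longrightarrow> {i, j} \<notin> E))"
  proof
    assume "split_graph {..<n} E"
    then obtain K I where "K \<union> I = {..<n} \<and> K \<inter> I = {} \<and>
      (\<forall>u\<in>K. \<forall>v\<in>K. u \<noteq> v \<longrightarrow> {u, v} \<in> E) \<and> (\<forall>u\<in>I. \<forall>v\<in>I. {u, v} \<notin> E)"
      unfolding split_graph_def by (elim exE)
    then show "\<exists>K. \<forall>i<n. \<forall>j<n. (K i \<and> K j \<and> i \<noteq> j \<longrightarrow> {i, j} \<in> E) \<and> (\<not> K i \<and> \<not> K j \<longrightarrow> {i, j} \<notin> E)"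
      by (intro exI[of _ "\<lambda>i. i \<in> K"]) blast
  next
    assume "\<exists>K. \<forall>i<n. \<forall>j<n. (K i \<and> K j \<and> i \<noteq> j \<longrightarrow> {i, j} \<in> E) \<and> (\<not> K i \<and> \<not> K j \<longrightarrow> {i, j} \<notin> E)"
    then obtain K where "\<forall>i<n. \<forall>j<n. (K i \<and> K j \<and> i \<noteq> j \<longrightarrow> {i, j} \<in> E) \<and> (\<not> K i \<and> \<not> K j \<longrightarrow> {i, j} \<notin> E)"
      by blast
    then show "split_graph {..<n} E"
      unfolding split_graph_def
      by (intro exI[of _ "{i. i < n \<and> K i}"] exI[of _ "{i. i < n \<and> \<not> K i}"]) auto
  qed
  show ?thesis
    unfolding links using split split_src_iff[OF assms(1) _ _ assms(3)] assms(2) by blast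
qed

text \<open>The number of vertices is not part of the input to the check; a bounded search recovers
  it from the length of the code. Together with the unary prefix and the delimiter this ensures that
  the word encodes a graph.\<close>

definition verify :: "nat \<Rightarrow> (bool \<Rightarrow> nat \<Rightarrow> nat) \<Rightarrow> nat \<Rightarrow> bool" where
  "verify k w l \<longleftrightarrow> (\<exists>n<l. l = Suc (n + n * n) \<and> 0 < n \<and> (\<forall>p<n. w False p = 2) \<and> w False n = 1 \<and>
     split_links n (edge_symbol w n) (\<lambda>i. w True i = 2) (certified_colour k w n))"

lemma definable_verify: "definable (\<lambda>w \<rho>. of_bool (verify k w (\<rho> 1)))"
  unfolding verify_def split_links_def edge_symbol_def certified_colour_def
  by (intro definable_intros)

lemma verify_sound:
  assumes "verify k (word_symbols [x, u]) (length x)" and "0 < k"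
  shows "x \<in> split_src_problem k"
proof -
  let ?w = "word_symbols [x, u]"
  obtain n where len: "length x = Suc (n + n * n)" and n: "0 < n" and p: "\<And>p. p < n \<Longrightarrow> symbol_at x p = 2"
    "symbol_at x n = 1" and l: "split_links n (edge_symbol ?w n) (\<lambda>i. ?w True i = 2) (certified_colour k ?w n)"
    using assms(1) unfolding verify_def by (auto simp: word_symbols_def)
  have irr: "\<not> edge_symbol ?w n i i" if "i < n" for i
    using l that unfolding split_links_def by blast
  have sym: "edge_symbol ?w n j i" if "i < n" "j < n" "edge_symbol ?w n i j" for i j
    using l that unfolding split_links_def by blast
  define E where "E = {{i, j} |i j. i < n \<and> j < n \<and> edge_symbol ?w n i j}"
  have E: "{i, j} \<in> E \<longleftrightarrow> edge_symbol ?w n i j" if "i < n" "j < n" for i j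
  proof
    assume "{i, j} \<in> E"
    then show "edge_symbol ?w n i j"
      using sym that unfolding E_def by (auto simp: doubleton_eq_iff)
  qed (use that in \<open>auto simp: E_def\<close>)
  have simple: "simple_graph {..<n} E"
  proof -
    have "card {i, j} = 2" if "i < n" "edge_symbol ?w n i j" for i j
      using irr that by (cases "i = j") auto
    then show ?thesis
      unfolding simple_graph_def E_def by auto
  qed
  \<comment> \<open>\<open>Min\<close> and \<open>Max\<close> turn an edge back into a pair;
    \<open>certified_colour\<close> sorts its arguments in the same way.\<close>
  define c where "c = (\<lambda>e. certified_colour k ?w n (Min e) (Max e))"
  have "certified_colour k ?w n i j < k" for i j
  proof -
    have "certified_colour k ?w n i j \<le> (\<Sum>t<k - 1. 1)"
      unfolding certified_colour_def by (intro sum_mono) simp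
    then show ?thesis
      using assms(2) by simp
  qed
  then have "\<forall>e. c e < k"
    by (simp add: c_def)
  moreover have "split_links n (\<lambda>i j. {i, j} \<in> E) (\<lambda>i. ?w True i = 2) (\<lambda>i j. c {i, j})"
  proof -
    have "c {i, j} = certified_colour k ?w n i j" for i j
      by (auto simp: c_def certified_colour_def min_def max_def)
    then show ?thesis
      using l E split_links_cong[of n "\<lambda>i j. {i, j} \<in> E" "edge_symbol ?w n"] by simp
  qed
  ultimately have "connected_graph {..<n} E \<and> split_graph {..<n} E \<and> src {..<n} E \<le> k"
    using split_links_iff[OF simple n assms(2)] by blast
  moreover have "x = encode_graph n E"
  proof (rule nth_equalityI)
    fix q
    assume q: "q < length x"
    consider "q < n" | "q = n" | i j where "i < n" "j < n" "q = Suc n + (i * n + j)"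
    proof -
      have "\<exists>i j. i < n \<and> j < n \<and> q = Suc n + (i * n + j)" if "n < q"
      proof -
        have "q = Suc n + ((q - Suc n) div n * n + (q - Suc n) mod n)"
          using that by simp
        moreover have "(q - Suc n) div n < n"
          using q len that n by (simp add: less_mult_imp_div_less less_diff_conv2)
        ultimately show ?thesis
          using n mod_less_divisor by blast
      qed
      then show ?thesis
        using that by (cases rule: linorder_cases[of q n]) blast+
    qed
    then show "x ! q = encode_graph n E ! q"
    proof cases
      case 3
      then have "symbol_at (encode_graph n E) q = 2 \<longleftrightarrow> symbol_at x q = 2"
        using encode_graph_edge[of i n j E] E[of i j] by (simp add: edge_symbol_def word_symbols_def add.assoc)
      then show ?thesis
        using q len by (simp add: symbol_at_eq_iff length_encode_graph)
    qed (use p q len in \<open>auto simp: symbol_at_eq_iff encode_graph_map simp del: upt_Suc\<close>)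
  qed (simp add: len length_encode_graph)
  ultimately show ?thesis
    using simple unfolding split_src_problem_def by blast
qed

lemma verify_complete:
  assumes "x \<in> split_src_problem k" and "0 < k"
  shows "\<exists>u. length u \<le> poly [:0, 1, k:] (length x) \<and> verify k (word_symbols [x, u]) (length x)"
proof -
  obtain n E where x: "x = encode_graph n E" and simple: "simple_graph {..<n} E"
    and G: "split_graph {..<n} E" "src {..<n} E \<le> k" "connected_graph {..<n} E"
    using assms(1) unfolding split_src_problem_def by blast
  have n: "0 < n"
    using G(3) unfolding connected_graph_def by auto
  obtain K c where c: "\<forall>e. c e < k" and l: "split_links n (\<lambda>i j. {i, j} \<in> E) K (\<lambda>i j. c {i, j})"
    using split_links_iff[OF simple n assms(2)] G by blast
  \<comment> \<open>Matrix \<open>t\<close> contains the edges whose colour exceeds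
    \<open>t\<close>. Since colours are below \<open>k\<close>, an edge lies in exactly as many of
    the \<open>k - 1\<close> matrices as its colour says.\<close>
  define u where "u = map (\<lambda>p. if p < n then K p
    else (p - n) div (n * n) < c {((p - n) mod (n * n)) div n, ((p - n) mod (n * n)) mod n}) [0..<n + (k - 1) * (n * n)]"
  let ?w = "word_symbols [x, u]"
  have "length u \<le> n + k * (n * n)"
    by (simp add: u_def)
  also have "\<dots> \<le> length x + length x * (length x * k)"
  proof -
    have "n \<le> length x"
      by (simp add: x length_encode_graph)
    moreover from this have "k * (n * n) \<le> k * (length x * length x)"
      by (intro mult_le_mono) auto
    ultimately have "n + k * (n * n) \<le> length x + k * (length x * length x)"
      by (rule add_mono)
    then show ?thesis
      by (simp only: ac_simps)
  qed
  finally have "length u \<le> poly [:0, 1, k:] (length x)"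
    by (simp add: algebra_simps)
  moreover have "verify k ?w (length x)"
    unfolding verify_def
  proof (intro exI conjI allI impI)
    show "n < length x" "length x = Suc (n + n * n)"
      by (simp_all add: x length_encode_graph)
    show "?w False p = 2" if "p < n" for p
      using that by (simp add: word_symbols_def x symbol_at_eq_iff encode_graph_map del: upt_Suc)
    show "?w False n = 1"
      by (simp add: word_symbols_def x symbol_at_eq_iff encode_graph_map del: upt_Suc)
    have "edge_symbol ?w n i j \<longleftrightarrow> {i, j} \<in> E" if "i < n" "j < n" for i j
      using encode_graph_edge[OF that] by (simp add: edge_symbol_def word_symbols_def x)
    moreover have "?w True i = 2 \<longleftrightarrow> K i" if "i < n" for i
      using that by (simp add: word_symbols_def second_word_def symbol_at_eq_iff u_def)
    moreover have "certified_colour k ?w n i j = c {i, j}" if ij: "i < n" "j < n" for i j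
    proof -
      let ?m = "min i j" and ?M = "max i j"
      have mM: "?m < n" "?M < n" "{?m, ?M} = {i, j}"
        using ij by (auto simp: min_def max_def)
      have "?w True (n + t * (n * n) + (?m * n + ?M)) = 2 \<longleftrightarrow> t < c {i, j}" if "t < k - 1" for t
      proof -
        have "t * (n * n) + (?m * n + ?M) < Suc t * (n * n)"
          using matrix_index(1)[OF mM(1,2)] by simp
        also have "\<dots> \<le> (k - 1) * (n * n)"
          using that by (intro mult_le_mono1) simp
        finally have "n + t * (n * n) + (?m * n + ?M) < n + (k - 1) * (n * n)"
          by simp
        moreover have "(n + t * (n * n) + (?m * n + ?M) - n) div (n * n) = t"
          "(n + t * (n * n) + (?m * n + ?M) - n) mod (n * n) = ?m * n + ?M"
          using matrix_index(1)[OF mM(1,2)] n by (simp_all add: add.assoc)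
        ultimately show ?thesis
          using matrix_index(2,3)[OF mM(1,2)] mM(3)
          by (simp add: word_symbols_def second_word_def symbol_at_eq_iff u_def del: mult_Suc)
      qed
      then have "certified_colour k ?w n i j = (\<Sum>t<k - 1. of_bool (t < c {i, j}))"
        unfolding certified_colour_def by (intro sum.cong) auto
      also have "\<dots> = card {t\<in>{..<k - 1}. t < c {i, j}}"
        by (simp add: Int_def)
      also have "{t\<in>{..<k - 1}. t < c {i, j}} = {..<c {i, j}}"
        using c[rule_format, of "{i, j}"] by auto
      finally show ?thesis
        by simp
    qed
    ultimately show "split_links n (edge_symbol ?w n) (\<lambda>i. ?w True i = 2) (certified_colour k ?w n)"
      using l split_links_cong[of n "edge_symbol ?w n" "\<lambda>i j. {i, j} \<in> E"] by simp
  qed (rule n)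
  ultimately show ?thesis
    by blast
qed

lemma split_src_problem_NP:
  assumes "0 < k"
  shows "split_src_problem k \<in> NP"
proof (rule NP_definable[OF definable_verify[of k]])
  show "x \<in> split_src_problem k \<longleftrightarrow> (\<exists>u. length u \<le> poly [:0, 1, k:] (length x) \<and>
      0 < (of_bool (verify k (word_symbols [x, u]) (input_env [x, u] 0 1)) :: nat))" for x
    using verify_sound verify_complete assms by (auto simp: input_env_def)
qed

section \<open>From clauses to colourings\<close>

definition literal_true :: "(nat \<Rightarrow> bool) \<Rightarrow> nat \<Rightarrow> bool" where
  "literal_true \<alpha> l \<longleftrightarrow> (if even l then \<alpha> (l div 2) else \<not> \<alpha> (l div 2))"

definition satisfiable :: "nat \<Rightarrow> nat \<Rightarrow> (nat \<Rightarrow> nat \<Rightarrow> nat) \<Rightarrow> bool" where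
  "satisfiable W m lit \<longleftrightarrow> (\<exists>\<alpha>. \<forall>c<m. \<exists>j<W. literal_true \<alpha> (lit c j))"

text \<open>The vertex \<open>4 * p + r\<close> is, for \<open>r = 0\<close>, the \<open>p\<close>-th vertex of a palette (0 is false, 1 is
  true, 2 is neutral); for \<open>r = 1\<close>, the literal \<open>p\<close>; for \<open>p = c * (W + 1) + j\<close> and \<open>r = 2\<close>, the
  state of clause \<open>c\<close> before its literal \<open>j\<close> is read: neutral at first, true in the end; for
  \<open>r = 3\<close>, a vertex adjacent to the states before and after literal \<open>j\<close> and to the literal.  Since
  it needs a colour of its own, the state cannot change from neutral to true at a false literal.\<close>

definition arc :: "nat \<Rightarrow> nat \<Rightarrow> nat \<Rightarrow> (nat \<Rightarrow> nat \<Rightarrow> nat) \<Rightarrow> nat \<Rightarrow> nat \<Rightarrow> bool" where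
  "arc k W m lit i j \<longleftrightarrow>
     (i mod 4 = 0 \<and> i div 4 < k \<and>
       ((j mod 4 = 0 \<and> j div 4 < k \<and> \<not> i div 4 = j div 4) \<or>
        (j mod 4 = 1 \<and> 2 \<le> i div 4) \<or>
        (j mod 4 = 2 \<and> \<not> (i div 4 = 2 \<and> \<not> (j div 4) mod Suc W = W) \<and> \<not> (i div 4 = 1 \<and> \<not> (j div 4) mod Suc W = 0)) \<or>
        (j mod 4 = 3 \<and> 3 \<le> i div 4))) \<or>
     (i mod 4 = 1 \<and> j mod 4 = 1 \<and> i div 4 div 2 = j div 4 div 2 \<and> \<not> i div 4 = j div 4) \<or>
     (i mod 4 = 3 \<and> (i div 4) mod Suc W < W \<and> (i div 4) div Suc W < m \<and>
       ((j mod 4 = 2 \<and> (j div 4 = i div 4 \<or> j div 4 = Suc (i div 4))) \<or>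
        (j mod 4 = 1 \<and> j div 4 = lit ((i div 4) div Suc W) ((i div 4) mod Suc W))))"

definition conflict :: "nat \<Rightarrow> nat \<Rightarrow> nat \<Rightarrow> (nat \<Rightarrow> nat \<Rightarrow> nat) \<Rightarrow> nat \<Rightarrow> nat \<Rightarrow> bool" where
  "conflict k W m lit i j \<longleftrightarrow> arc k W m lit i j \<or> arc k W m lit j i"

definition colourable :: "nat \<Rightarrow> nat \<Rightarrow> (nat \<Rightarrow> nat \<Rightarrow> bool) \<Rightarrow> bool" where
  "colourable k N r \<longleftrightarrow> (\<exists>col. (\<forall>i<N. col i < k) \<and> (\<forall>i<N. \<forall>j<N. r i j \<longrightarrow> col i \<noteq> col j))"

lemma conflict_sym: "conflict k W m lit i j \<Longrightarrow> conflict k W m lit j i"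
  by (auto simp: conflict_def)

lemma conflict_irrefl: "\<not> conflict k W m lit i i"
  by (auto simp: conflict_def arc_def)

definition vertex :: "nat \<Rightarrow> nat \<Rightarrow> nat" where
  "vertex r p = 4 * p + r"

lemma vertex_simps [simp]: "r < 4 \<Longrightarrow> vertex r p mod 4 = r" "r < 4 \<Longrightarrow> vertex r p div 4 = p"
  by (simp_all add: vertex_def)

lemma vertex_less: "r < 4 \<Longrightarrow> p < q \<Longrightarrow> 4 * q \<le> N \<Longrightarrow> vertex r p < N"
  by (simp add: vertex_def)

lemma satisfiable_colourable:
  assumes "satisfiable W m lit" and k: "3 \<le> k" and "0 < W"
  shows "colourable k N (conflict k W m lit)"
proof -
  obtain \<alpha> where \<alpha>: "\<And>c. c < m \<Longrightarrow> \<exists>j<W. literal_true \<alpha> (lit c j)"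
    using assms(1) unfolding satisfiable_def by blast
  \<comment> \<open>State vertices are tied to the palette for every clause number, also beyond
    \<open>m\<close>. Declaring all literals of such clauses true lets their states end with colour
    1 as well.\<close>
  define t where "t = (\<lambda>c j. m \<le> c \<or> literal_true \<alpha> (lit c j))"
  define y where "y = (\<lambda>c j. if \<exists>i<j. t c i then 1 else 2 :: nat)"
  \<comment> \<open>The colour left over by the three neighbours: 2 once the state is true, 0 if it
    turns true at this literal, 1 if it remains neutral.\<close>
  define h where "h = (\<lambda>c j. if y c j = 1 then 2 else if t c j then 0 else 1 :: nat)"
  define col where "col = (\<lambda>v.
     if v mod 4 = 0 then if v div 4 < k then v div 4 else 0
     else if v mod 4 = 1 then if literal_true \<alpha> (v div 4) then 1 else 0
     else if v mod 4 = 2 then y ((v div 4) div Suc W) ((v div 4) mod Suc W)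
     else h ((v div 4) div Suc W) ((v div 4) mod Suc W))"
  have y0: "y c 0 = 2" and yW: "y c W = 1" for c
    using \<alpha>[of c] \<open>0 < W\<close> by (auto simp: y_def t_def not_le)
  have y12: "y c j = 1 \<or> y c j = 2" for c j
    by (auto simp: y_def)
  have h012: "h c j < 3" for c j
    by (auto simp: h_def)
  have hy: "h c j \<noteq> y c j" for c j
    by (auto simp: h_def y_def)
  have hyS: "h c j \<noteq> y c (Suc j)" for c j
    by (auto simp: h_def y_def less_Suc_eq)
  have ht: "h c j \<noteq> (if literal_true \<alpha> (lit c j) then 1 else 0)" if "c < m" for c j
    using that by (auto simp: h_def t_def)
  have Suc_idx: "Suc p div Suc W = p div Suc W \<and> Suc p mod Suc W = Suc (p mod Suc W)" if "p mod Suc W < W" for p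
    using that by (simp add: div_Suc mod_Suc)
  have "col i \<noteq> col j" if "arc k W m lit i j" for i j
  proof -
    have pal: "col i = i div 4" if "i mod 4 = 0" "i div 4 < k" for i
      using that by (simp add: col_def)
    have li: "col i = (if literal_true \<alpha> (i div 4) then 1 else 0)" if "i mod 4 = 1" for i
      using that by (simp add: col_def)
    have st: "col i = y ((i div 4) div Suc W) ((i div 4) mod Suc W)" if "i mod 4 = 2" for i
      using that by (simp add: col_def)
    have he: "col i = h ((i div 4) div Suc W) ((i div 4) mod Suc W)" if "i mod 4 = 3" for i
      using that by (simp add: col_def)
    from \<open>arc k W m lit i j\<close> show ?thesis
      unfolding arc_def
    proof (elim disjE conjE, goal_cases)
      case 1
      have "col i = i div 4" "col j = j div 4"
        by (rule pal[OF 1(1,2)], rule pal[OF 1(3,4)])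
      with 1(5) show ?case
        by metis
    next
      case 2
      show ?case
        unfolding pal[OF 2(1,2)] li[OF 2(3)] using 2(4) by (cases "literal_true \<alpha> (j div 4)") simp_all
    next
      case 3
      let ?c = "(j div 4) div Suc W" and ?j = "(j div 4) mod Suc W"
      have "i div 4 = 1 \<Longrightarrow> y ?c ?j = 2" "i div 4 = 2 \<Longrightarrow> y ?c ?j = 1"
        using 3(4,5) y0[of ?c] yW[of ?c] by simp_all
      then have "i div 4 \<noteq> y ?c ?j"
        using y12[of ?c ?j] by linarith
      then show ?case
        unfolding pal[OF 3(1,2)] st[OF 3(3)] .
    next
      case 4
      show ?case
        unfolding pal[OF 4(1,2)] he[OF 4(3)]
        using h012[of "(j div 4) div Suc W" "(j div 4) mod Suc W"] 4(4) by linarith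
    next
      case 5
      have parity: "p div 2 = q div 2 \<Longrightarrow> p \<noteq> q \<Longrightarrow> even p \<longleftrightarrow> odd q" for p q :: nat
        by presburger
      show ?case
        unfolding li[OF 5(1)] li[OF 5(2)] literal_true_def using parity[OF 5(3,4)] 5(3)
        by (cases "even (i div 4)") simp_all
    next
      case 6
      show ?case
        unfolding st[OF 6(4)] he[OF 6(1)] 6(5) by (rule hy)
    next
      case 7
      have *: "Suc (i div 4) div Suc W = i div 4 div Suc W" "Suc (i div 4) mod Suc W = Suc (i div 4 mod Suc W)"
        using Suc_idx[OF 7(2)] by blast+
      show ?case
        unfolding st[OF 7(4)] he[OF 7(1)] 7(5) * by (rule hyS)
    next
      case 8
      show ?case
        unfolding li[OF 8(4)] he[OF 8(1)] 8(5) by (rule ht[OF 8(3)])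
    qed
  qed
  moreover have "col i < k" for i
    using k y12[of "(i div 4) div Suc W" "(i div 4) mod Suc W"] h012[of "(i div 4) div Suc W" "(i div 4) mod Suc W"]
    by (auto simp: col_def)
  ultimately show ?thesis
    unfolding colourable_def conflict_def by metis
qed

text \<open>The palette uses every colour once, so each colour can be named by a palette vertex. If
  all literals of a clause had the colour of false, its state could never leave neutral, although
  the last state must differ from neutral.\<close>

lemma colourable_satisfiable:
  assumes "colourable k N (conflict k W m lit)" and k: "3 \<le> k"
    and N: "4 * k \<le> N" "4 * (m * Suc W) \<le> N" "4 * L \<le> N"
    and lit: "\<And>c j. c < m \<Longrightarrow> j < W \<Longrightarrow> lit c j < L"
  shows "satisfiable W m lit"
proof -
  obtain col where colk: "\<And>i. i < N \<Longrightarrow> col i < k"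
    and "\<And>i j. i < N \<Longrightarrow> j < N \<Longrightarrow> conflict k W m lit i j \<Longrightarrow> col i \<noteq> col j"
    using assms(1) unfolding colourable_def by blast
  then have col: "col i \<noteq> col j" if "i < N" "j < N" "arc k W m lit i j" for i j
    using that by (auto simp: conflict_def)
  define P where "P = (\<lambda>p. col (vertex 0 p))"
  have "inj_on P {..<k}"
  proof (rule inj_onI, rule ccontr)
    fix p q
    assume "p \<in> {..<k}" "q \<in> {..<k}" "P p = P q" "p \<noteq> q"
    then show False
      using col[of "vertex 0 p" "vertex 0 q"] vertex_less[OF _ _ N(1), of 0] by (simp add: P_def arc_def)
  qed
  then have "P ` {..<k} = {..<k}"
    by (intro endo_inj_surj) (use colk vertex_less[OF _ _ N(1), of 0] in \<open>auto simp: P_def\<close>)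
  then have palette: "\<exists>p<k. x = P p" if "x < k" for x
    using that by (metis imageE lessThan_iff)
  have P: "P p \<noteq> P q" if "p < k" "q < k" "p \<noteq> q" for p q
    using \<open>inj_on P {..<k}\<close> that by (auto dest: inj_onD)
  have avoid: "P p \<noteq> col j" if "p < k" "j < N" "arc k W m lit (vertex 0 p) j" for p j
    using col[of "vertex 0 p" j] that vertex_less[OF _ _ N(1), of 0] by (simp add: P_def)
  have litN: "vertex 1 l < N" if "l < L" for l
    using that by (intro vertex_less[OF _ _ N(3)]) auto
  have literal: "col (vertex 1 l) = P 0 \<or> col (vertex 1 l) = P 1" if "l < L" for l
  proof -
    obtain p where p: "p < k" "col (vertex 1 l) = P p"
      using palette[OF colk[OF litN[OF \<open>l < L\<close>]]] by auto
    have "\<not> 2 \<le> p"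
      using avoid[OF p(1) litN[OF \<open>l < L\<close>]] p by (auto simp: arc_def)
    then have "p = 0 \<or> p = 1"
      by linarith
    then show ?thesis
      using p by auto
  qed
  \<comment> \<open>The assignment is read off the positive literals; a negative literal with the
    colour of true has a partner with another colour.\<close>
  define \<alpha> where "\<alpha> = (\<lambda>v. col (vertex 1 (2 * v)) = P 1)"
  have true: "literal_true \<alpha> l" if "l < L" "col (vertex 1 l) \<noteq> P 0" for l
  proof -
    have 1: "col (vertex 1 l) = P 1"
      using literal that by blast
    show ?thesis
    proof (cases "even l")
      case True
      then have "2 * (l div 2) = l"
        by simp
      with True 1 show ?thesis
        unfolding literal_true_def \<alpha>_def by (simp only: if_True)
    next
      case False
      then have l: "l = Suc (2 * (l div 2))"
        by simp
      have "col (vertex 1 (2 * (l div 2))) \<noteq> col (vertex 1 l)"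
      proof (rule col)
        show "arc k W m lit (vertex 1 (2 * (l div 2))) (vertex 1 l)"
          using l by (auto simp: arc_def)
      qed (rule litN, use \<open>l < L\<close> l in linarith)+
      then show ?thesis
        unfolding literal_true_def \<alpha>_def using 1 False by (simp only: if_False not_False_eq_True)
    qed
  qed
  have "\<exists>j<W. literal_true \<alpha> (lit c j)" if "c < m" for c
  proof (rule ccontr)
    assume none: "\<not> ?thesis"
    have idx: "c * Suc W + j < m * Suc W \<and> (c * Suc W + j) div Suc W = c \<and> (c * Suc W + j) mod Suc W = j"
      if "j \<le> W" for j
    proof -
      have "c * Suc W + j < Suc c * Suc W"
        using that by simp
      also have "\<dots> \<le> m * Suc W"
        using \<open>c < m\<close> by (intro mult_le_mono1) simp
      moreover have "(c * Suc W + j) div Suc W = c + j div Suc W"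
        by (rule div_mult_self3) simp
      moreover have "(c * Suc W + j) mod Suc W = j mod Suc W"
        by (rule mod_mult_self3)
      ultimately show ?thesis
        using that by simp
    qed
    define Y where "Y = (\<lambda>j. vertex 2 (c * Suc W + j))"
    define H where "H = (\<lambda>j. vertex 3 (c * Suc W + j))"
    have YN: "Y j < N" and HN: "H j < N" if "j \<le> W" for j
      unfolding Y_def H_def using idx[OF that] by (intro vertex_less[OF _ _ N(2)]; simp)+
    have state: "col (Y j) = P 1 \<or> col (Y j) = P 2" if j: "j \<le> W" for j
    proof -
      obtain p where p: "p < k" "col (Y j) = P p"
        using palette[OF colk[OF YN[OF j]]] by auto
      have "\<not> (p \<noteq> 1 \<and> p \<noteq> 2)"
        using avoid[OF p(1) YN[OF j]] p by (auto simp: arc_def Y_def simp del: mult_Suc mult_Suc_right)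
      then show ?thesis
        using p by auto
    qed
    \<comment> \<open>At a false literal and a neutral state the vertex \<open>H j\<close> must take
      the colour of true, which is thereby denied to the next state.\<close>
    have "col (Y j) = P 2" if "j \<le> W" for j
      using that
    proof (induction j)
      case 0
      have "P 1 \<noteq> col (Y 0)"
        by (rule avoid) (use k YN[of 0] idx[of 0] in \<open>auto simp: arc_def Y_def simp del: mult_Suc mult_Suc_right\<close>)
      then show ?case
        using state[of 0] by auto
    next
      case (Suc j)
      then have j: "j < W" "j \<le> W"
        by auto
      have lj: "lit c j < L" "col (vertex 1 (lit c j)) = P 0"
        using lit[OF \<open>c < m\<close> j(1)] true none j(1) by blast+
      obtain p where p: "p < k" "col (H j) = P p"
        using palette[OF colk[OF HN[OF j(2)]]] by auto
      have "\<not> 3 \<le> p"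
        using avoid[OF p(1) HN[OF j(2)]] p by (auto simp: arc_def H_def simp del: mult_Suc mult_Suc_right)
      moreover have "col (H j) \<noteq> col (vertex 1 (lit c j))"
        by (rule col) (use HN[OF j(2)] litN[OF lj(1)] idx[OF j(2)] j \<open>c < m\<close> in
          \<open>auto simp: arc_def H_def simp del: mult_Suc mult_Suc_right\<close>)
      then have "p \<noteq> 0"
        using p lj by metis
      moreover have "col (H j) \<noteq> col (Y j)"
        by (rule col) (use HN[OF j(2)] YN[OF j(2)] idx[OF j(2)] j \<open>c < m\<close> in
          \<open>auto simp: arc_def H_def Y_def simp del: mult_Suc mult_Suc_right\<close>)
      then have "p \<noteq> 2"
        using p Suc.IH j by metis
      ultimately have "p = 1"
        by linarith
      have "col (H j) \<noteq> col (Y (Suc j))"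
        by (rule col) (use HN[OF j(2)] YN[OF Suc.prems] idx[OF j(2)] j \<open>c < m\<close> in
          \<open>auto simp: arc_def H_def Y_def simp del: mult_Suc mult_Suc_right\<close>)
      then show ?case
        using state[OF Suc.prems] p \<open>p = 1\<close> by auto
    qed
    from this[of W] have "col (Y W) = P 2"
      by simp
    moreover have "P 2 \<noteq> col (Y W)"
      by (rule avoid) (use k YN[of W] idx[of W] in \<open>auto simp: arc_def Y_def simp del: mult_Suc mult_Suc_right\<close>)
    ultimately show False
      by simp
  qed
  then show ?thesis
    unfolding satisfiable_def by blast
qed


section \<open>From colourings to strong rainbow connection\<close>

text \<open>The vertices below \<open>N\<close> are independent.  The vertex \<open>N + N * N\<close> of the clique is adjacent to
  all of them, so its edges carry the colouring; \<open>N + p * N + q\<close> offers a second path between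
  \<open>p\<close> and \<open>q\<close> if these two need not have different colours.\<close>

definition cross_edge :: "nat \<Rightarrow> (nat \<Rightarrow> nat \<Rightarrow> bool) \<Rightarrow> nat \<Rightarrow> nat \<Rightarrow> bool" where
  "cross_edge N r i j \<longleftrightarrow> i < N \<and> N \<le> j \<and> (j = N + N * N \<or>
     (i = (j - N) div N \<or> i = (j - N) mod N) \<and> \<not> r ((j - N) div N) ((j - N) mod N))"

definition split_edge :: "nat \<Rightarrow> (nat \<Rightarrow> nat \<Rightarrow> bool) \<Rightarrow> nat \<Rightarrow> nat \<Rightarrow> bool" where
  "split_edge N r i j \<longleftrightarrow> (N \<le> i \<and> N \<le> j \<and> \<not> i = j) \<or> cross_edge N r i j \<or> cross_edge N r j i"

definition split_of :: "nat \<Rightarrow> (nat \<Rightarrow> nat \<Rightarrow> bool) \<Rightarrow> nat set set" where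
  "split_of N r = {{i, j} |i j. i < Suc (N + N * N) \<and> j < Suc (N + N * N) \<and> split_edge N r i j}"

lemma split_edge_sym: "split_edge N r i j \<Longrightarrow> split_edge N r j i"
  by (auto simp: split_edge_def)

lemma split_edge_irrefl: "\<not> split_edge N r i i"
  by (auto simp: split_edge_def cross_edge_def)

lemma split_of_iff:
  "i < Suc (N + N * N) \<Longrightarrow> j < Suc (N + N * N) \<Longrightarrow> {i, j} \<in> split_of N r \<longleftrightarrow> split_edge N r i j"
  unfolding split_of_def by (auto simp: doubleton_eq_iff dest: split_edge_sym)

lemma simple_split_of: "simple_graph {..<Suc (N + N * N)} (split_of N r)"
proof -
  have "card {i, j} = 2" if "split_edge N r i j" for i j
    using that split_edge_irrefl by (cases "i = j") auto
  then show ?thesis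
    unfolding simple_graph_def split_of_def by auto
qed

lemma split_split_of: "split_graph {..<Suc (N + N * N)} (split_of N r)"
  unfolding split_graph_def
proof (intro exI conjI ballI impI)
  show "{N..<Suc (N + N * N)} \<union> {..<N} = {..<Suc (N + N * N)}"
    by auto
qed (auto simp: split_of_iff split_edge_def cross_edge_def)

text \<open>A clique vertex adjacent to both \<open>i\<close> and \<open>j\<close> is the one
  adjacent to all, or belongs to one of the two ordered pairs; the latter have no such edges if
  \<open>r i j\<close>. Hence conflicting vertices have a single shortest path between them, and its
  two edges need different colours. Conversely, all other pairs can be served by fixed
  colours.\<close>

lemma split_of_src:
  assumes sym: "\<And>i j. r i j \<Longrightarrow> r j i" and irrefl: "\<And>i. \<not> r i i" and k: "3 \<le> k"
  shows "connected_graph {..<Suc (N + N * N)} (split_of N r) \<and> src {..<Suc (N + N * N)} (split_of N r) \<le> k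
    \<longleftrightarrow> colourable k N r"
proof -
  let ?n = "Suc (N + N * N)"
  let ?E = "split_of N r"
  let ?a = "N + N * N"
  have "connected_graph {..<?n} ?E \<and> src {..<?n} ?E \<le> k \<longleftrightarrow>
      (\<exists>c :: nat set \<Rightarrow> nat. (\<forall>e. c e < k) \<and> rainbow_links {..<?n} ?E c)"
    using k by (intro split_src_iff simple_split_of split_split_of) auto
  also have "\<dots> \<longleftrightarrow> colourable k N r"
  proof
    assume "\<exists>c :: nat set \<Rightarrow> nat. (\<forall>e. c e < k) \<and> rainbow_links {..<?n} ?E c"
    then obtain c :: "nat set \<Rightarrow> nat" where c: "\<And>e. c e < k" "rainbow_links {..<?n} ?E c"
      by blast
    have "c {i, ?a} \<noteq> c {j, ?a}" if ij: "i < N" "j < N" "r i j" for i j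
    proof -
      have "i \<noteq> j"
        using ij irrefl by auto
      have "\<not> split_edge N r i j"
        using ij by (auto simp: split_edge_def cross_edge_def)
      have common: "w = ?a" if "split_edge N r i w" "split_edge N r w j" "w < ?n" for w
      proof (rule ccontr)
        assume "w \<noteq> ?a"
        then have "i = (w - N) div N \<or> i = (w - N) mod N" "j = (w - N) div N \<or> j = (w - N) mod N"
          "\<not> r ((w - N) div N) ((w - N) mod N)"
          using that ij by (auto simp: split_edge_def cross_edge_def)
        then show False
          using \<open>i \<noteq> j\<close> ij(3) sym by metis
      qed
      have "split_edge N r i ?a \<and> split_edge N r ?a j"
        using ij by (auto simp: split_edge_def cross_edge_def)
      then have "{i, ?a} \<in> ?E \<and> {?a, j} \<in> ?E"
        using ij by (simp add: split_of_iff)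
      moreover have "i \<in> {..<?n}" "j \<in> {..<?n}" "?a \<in> {..<?n}"
        using ij by auto
      ultimately obtain w where "w < ?n" "{i, w} \<in> ?E" "{w, j} \<in> ?E" "c {i, w} \<noteq> c {w, j}"
        using c(2)[unfolded rainbow_links_def, rule_format, of i j] \<open>i \<noteq> j\<close> \<open>\<not> split_edge N r i j\<close>
        by (auto simp: split_of_iff)
      moreover from this have "w = ?a"
        using ij by (intro common) (simp_all add: split_of_iff)
      ultimately show ?thesis
        by (simp add: insert_commute)
    qed
    then show "colourable k N r"
      unfolding colourable_def using c(1) by (intro exI[of _ "\<lambda>i. c {i, ?a}"]) auto
  next
    assume "colourable k N r"
    then obtain col where col: "\<And>i. i < N \<Longrightarrow> col i < k" "\<And>i j. i < N \<Longrightarrow> j < N \<Longrightarrow> r i j \<Longrightarrow> col i \<noteq> col j"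
      unfolding colourable_def by blast
    \<comment> \<open>Arguments are ordered, and independent vertices have the smaller numbers, so
      \<open>i\<close> is the independent end of a cross edge. Clique edges get 2, and the two edges
      at a pair vertex get 0 and 1.\<close>
    define d where "d = (\<lambda>i j. if N \<le> i then 2 else if j = ?a then col i
      else if i = (j - N) div N then 0 else 1 :: nat)"
    define c where "c = (\<lambda>e :: nat set. d (Min e) (Max e))"
    have c_less: "c {i, j} = d i j" "c {j, i} = d i j" if "i < j" for i j
      using that by (auto simp: c_def min_def max_def)
    have "\<forall>e. c e < k"
      using col(1) k by (auto simp: c_def d_def)
    have pair: "N + (i * N + j) < ?n" "N + (i * N + j) \<noteq> ?a" "(N + (i * N + j) - N) div N = i"
      "(N + (i * N + j) - N) mod N = j" "i < N + (i * N + j)" "j < N + (i * N + j)" if "i < N" "j < N" for i j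
      using matrix_index[OF that] that by auto
    have pair_edge: "split_edge N r i (N + (i * N + j))" "split_edge N r j (N + (i * N + j))"
      if "i < N" "j < N" "\<not> r i j" for i j
      using pair[OF that(1,2)] that by (auto simp: split_edge_def cross_edge_def)
    have "rainbow_links {..<?n} ?E c"
      unfolding rainbow_links_def
    proof (intro ballI)
      fix u v
      assume "u \<in> {..<?n}" "v \<in> {..<?n}"
      then have uv: "u < ?n" "v < ?n"
        by auto
      have "u = v \<or> split_edge N r u v \<or>
          (\<exists>w<?n. split_edge N r u w \<and> split_edge N r w v \<and> c {u, w} \<noteq> c {w, v})"
      proof -
        consider "u = v" | "N \<le> u" "N \<le> v" "u \<noteq> v" | "u < N" "v < N" "r u v" | "u < N" "v < N" "\<not> r u v" "u \<noteq> v"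
          | "u < N" "N \<le> v" "\<not> split_edge N r u v" | "N \<le> u" "v < N" "\<not> split_edge N r u v" | "split_edge N r u v"
          by linarith
        then show ?thesis
        proof cases
          case 2
          then show ?thesis
            by (auto simp: split_edge_def)
        next
          case 3
          then have "c {u, ?a} = col u" "c {?a, v} = col v"
            using c_less[of u ?a] c_less[of v ?a] by (auto simp: d_def)
          moreover have "split_edge N r u ?a" "split_edge N r ?a v"
            using 3 by (auto simp: split_edge_def cross_edge_def)
          ultimately show ?thesis
            using col(2)[OF 3] by (metis lessI)
        next
          case 4
          let ?w = "N + (u * N + v)"
          have "c {u, ?w} = 0" "c {?w, v} = 1"
            using pair[OF 4(1,2)] c_less[of u ?w] c_less[of v ?w] 4 by (auto simp: d_def)
          moreover have "split_edge N r u ?w" "split_edge N r ?w v"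
            using pair_edge[OF 4(1-3)] split_edge_sym by auto
          ultimately show ?thesis
            using pair(1)[OF 4(1,2)] by (metis zero_neq_one)
        next
          case 5
          \<comment> \<open>As \<open>r\<close> is irreflexive, the diagonal vertex of
            \<open>u\<close> is a clique neighbour with colour 0; an edge of colour 2 continues from
            it to any other clique vertex.\<close>
          let ?w = "N + (u * N + u)"
          have e: "split_edge N r u ?w"
            using pair_edge 5 irrefl by blast
          then have "?w \<noteq> v"
            using 5 by auto
          then have "c {?w, v} = 2"
            using 5 c_less[of ?w v] c_less[of v ?w] by (cases "?w < v") (auto simp: d_def)
          moreover have "c {u, ?w} = 0"
            using pair[OF 5(1) 5(1)] c_less[of u ?w] 5 by (auto simp: d_def)
          moreover have "split_edge N r ?w v"
            using \<open>?w \<noteq> v\<close> 5 by (auto simp: split_edge_def)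
          ultimately show ?thesis
            using e pair(1)[OF 5(1) 5(1)] by (metis zero_neq_numeral)
        next
          case 6
          let ?w = "N + (v * N + v)"
          have e: "split_edge N r ?w v"
            using pair_edge 6 irrefl split_edge_sym by blast
          then have "?w \<noteq> u"
            using 6 by auto
          then have "c {u, ?w} = 2"
            using 6 c_less[of ?w u] c_less[of u ?w] by (cases "?w < u") (auto simp: d_def)
          moreover have "c {?w, v} = 0"
            using pair[OF 6(2) 6(2)] c_less[of v ?w] 6 by (auto simp: d_def)
          moreover have "split_edge N r u ?w"
            using \<open>?w \<noteq> u\<close> 6 by (auto simp: split_edge_def)
          ultimately show ?thesis
            using e pair(1)[OF 6(2) 6(2)] by (metis zero_neq_numeral)
        qed auto
      qed
      then show "u = v \<or> {u, v} \<in> ?E \<or>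
        (\<exists>a\<in>{..<?n}. {u, a} \<in> ?E \<and> {a, v} \<in> ?E \<and> c {u, a} \<noteq> c {a, v}) \<or>
        ((\<forall>a\<in>{..<?n}. \<not> ({u, a} \<in> ?E \<and> {a, v} \<in> ?E)) \<and>
         (\<exists>a\<in>{..<?n}. \<exists>b\<in>{..<?n}. {u, a} \<in> ?E \<and> {a, b} \<in> ?E \<and> {b, v} \<in> ?E \<and>
           c {u, a} \<noteq> c {a, b} \<and> c {u, a} \<noteq> c {b, v} \<and> c {a, b} \<noteq> c {b, v}))"
        using uv split_of_iff[of _ N _ r] by (metis lessThan_iff)
    qed
    then show "\<exists>c :: nat set \<Rightarrow> nat. (\<forall>e. c e < k) \<and> rainbow_links {..<?n} ?E c"
      using \<open>\<forall>e. c e < k\<close> by blast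
  qed
  finally show ?thesis .
qed

section \<open>The reduction as a definable function of the input word\<close>

lemma encode_graph_inj:
  assumes "encode_graph n E = encode_graph n' E'" "simple_graph {..<n} E" "simple_graph {..<n'} E'"
  shows "n = n' \<and> E = E'"
proof -
  have eq: "n * Suc n = n' * Suc n'"
    using length_encode_graph[of n E] length_encode_graph[of n' E'] assms(1) by simp
  \<comment> \<open>The length of a code determines the number of vertices, because this product is
    strictly increasing.\<close>
  have "a * Suc a < b * Suc b" if "a < b" for a b :: nat
    using that by (intro mult_strict_mono) auto
  with eq have n: "n = n'"
    by (metis less_irrefl linorder_neqE_nat)
  have "e \<in> E \<longleftrightarrow> e \<in> E'" for e
  proof -
    have "\<exists>i j. e = {i, j} \<and> i < n \<and> j < n" if "e \<in> E \<or> e \<in> E'"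
    proof -
      have "e \<subseteq> {..<n}" "card e = 2"
        using that assms(2,3) n unfolding simple_graph_def by blast+
      then show ?thesis
        by (auto simp: card_2_iff)
    qed
    then show ?thesis
      using encode_graph_edge[of _ n _ E] encode_graph_edge[of _ n _ E'] assms(1) n by metis
  qed
  with n show ?thesis
    by blast
qed

lemma encode_split_of_iff:
  assumes "\<And>i j. r i j \<Longrightarrow> r j i" "\<And>i. \<not> r i i" "3 \<le> k"
  shows "encode_graph (Suc (N + N * N)) (split_of N r) \<in> split_src_problem k \<longleftrightarrow> colourable k N r"
  using split_of_src[of r k N, OF assms] simple_split_of[of N r] split_split_of[of N r]
    encode_graph_inj[of "Suc (N + N * N)" "split_of N r"]
  unfolding split_src_problem_def by blast

definition reduction :: "nat \<Rightarrow> (nat \<Rightarrow> nat \<Rightarrow> bool) \<Rightarrow> bool list" where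
  "reduction N r = encode_graph (Suc (N + N * N)) (split_of N r)"

lemma reduction_map:
  "reduction N r = (let n = Suc (N + N * N) in
     map (\<lambda>p. p < n \<or> (\<not> p = n \<and> split_edge N r ((p - Suc n) div n) ((p - Suc n) mod n))) [0..<Suc (n + n * n)])"
proof -
  let ?n = "Suc (N + N * N)"
  have "{(p - Suc ?n) div ?n, (p - Suc ?n) mod ?n} \<in> split_of N r \<longleftrightarrow>
      split_edge N r ((p - Suc ?n) div ?n) ((p - Suc ?n) mod ?n)" if "p < Suc (?n + ?n * ?n)" "?n < p" for p
  proof (rule split_of_iff)
    have "p - Suc ?n < ?n * ?n"
      using that by linarith
    then show "(p - Suc ?n) div ?n < ?n"
      by (rule less_mult_imp_div_less)
  qed simp
  then show ?thesis
    unfolding reduction_def encode_graph_map Let_def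
    by (intro map_cong refl) (auto simp del: upt_Suc simp: not_less)
qed

text \<open>The numbers of clauses and literals depend on the input length only; the input symbols
  enter through \<open>lit\<close> alone. What remains for hardness is to give the literals of a
  computation by an expression.\<close>

lemma polytime_reducible_clauses:
  assumes k: "3 \<le> k" and W: "0 < W"
    and m: "definable (\<lambda>w \<rho>. m (\<rho> 0))" and L: "definable (\<lambda>w \<rho>. L (\<rho> 0))"
    and lit: "definable (\<lambda>w \<rho>. lit (w False) (\<rho> 0) (\<rho> 1) (\<rho> 2))"
    and bound: "\<And>x c j. c < m (length x) \<Longrightarrow> j < W \<Longrightarrow> lit (symbol_at x) (length x) c j < L (length x)"
    and A: "\<And>x. x \<in> A \<longleftrightarrow> satisfiable W (m (length x)) (lit (symbol_at x) (length x))"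
  shows "polytime_reducible A (split_src_problem k)"
proof -
  \<comment> \<open>One index range, large enough for palette, literals and states alike, serves all
    four kinds of vertices; surplus vertices do no harm.\<close>
  define N where "N = (\<lambda>l. 4 * (k + m l * Suc W + L l))"
  define r where "r = (\<lambda>x l. conflict k W (m l) (lit x l))"
  define f where "f = (\<lambda>x. reduction (N (length x)) (r (symbol_at x) (length x)))"
  have "x \<in> A \<longleftrightarrow> f x \<in> split_src_problem k" for x
  proof -
    have "satisfiable W (m (length x)) (lit (symbol_at x) (length x)) \<longleftrightarrow>
        colourable k (N (length x)) (r (symbol_at x) (length x))"
      unfolding r_def
    proof
      show "colourable k (N (length x)) (conflict k W (m (length x)) (lit (symbol_at x) (length x))) \<Longrightarrow>
          satisfiable W (m (length x)) (lit (symbol_at x) (length x))"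
        by (erule colourable_satisfiable[OF _ k, where L = "L (length x)"]) (use bound in \<open>auto simp: N_def\<close>)
    qed (rule satisfiable_colourable[OF _ k W])
    then show ?thesis
      unfolding f_def reduction_def A r_def
      by (subst encode_split_of_iff[OF conflict_sym conflict_irrefl k]) auto
  qed
  moreover have "polytime 1 (\<lambda>ws. f (ws ! 0))"
  proof -
    note intros = definable_intros definable_app1[OF m] definable_app1[OF L] definable_app3[OF lit]
    have "definable (\<lambda>w \<rho>. of_bool (r (w False) (\<rho> 0) (\<rho> 1) (\<rho> 2)))"
      unfolding r_def conflict_def arc_def by (intro intros)
    note r = definable_app3[OF this]
    have N: "definable (\<lambda>w \<rho>. N (\<rho> 0))"
      unfolding N_def by (intro intros)
    note N = definable_app1[OF this]
    have "definable (\<lambda>w \<rho>. of_bool (split_edge (N (\<rho> 0)) (r (w False) (\<rho> 0)) (\<rho> 1) (\<rho> 2)))"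
      unfolding split_edge_def cross_edge_def by (intro intros r N)
    note e = definable_app3[OF this]
    let ?n = "\<lambda>\<rho> :: nat \<Rightarrow> nat. Suc (N (\<rho> 1) + N (\<rho> 1) * N (\<rho> 1))"
    have F: "definable (\<lambda>w \<rho>. of_bool (\<rho> 0 < ?n \<rho> \<or> (\<not> \<rho> 0 = ?n \<rho> \<and>
        split_edge (N (\<rho> 1)) (r (w False) (\<rho> 1)) ((\<rho> 0 - Suc (?n \<rho>)) div ?n \<rho>) ((\<rho> 0 - Suc (?n \<rho>)) mod ?n \<rho>))))"
      by (intro intros e N)
    have G: "definable (\<lambda>w \<rho>. Suc (?n \<rho> + ?n \<rho> * ?n \<rho>))"
      by (intro intros N)
    show ?thesis
    proof (rule polytime_definable[OF F G])
      fix ws :: "bool list list"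
      have "word_symbols ws False = symbol_at (ws ! 0)"
        by (simp add: word_symbols_def)
      then show "f (ws ! 0) = map (\<lambda>i. 0 < (of_bool (input_env ws i 0 < ?n (input_env ws i) \<or>
          (\<not> input_env ws i 0 = ?n (input_env ws i) \<and>
          split_edge (N (input_env ws i 1)) (r (word_symbols ws False) (input_env ws i 1))
            ((input_env ws i 0 - Suc (?n (input_env ws i))) div ?n (input_env ws i))
            ((input_env ws i 0 - Suc (?n (input_env ws i))) mod ?n (input_env ws i)))) :: nat))
        [0..<Suc (?n (input_env ws 0) + ?n (input_env ws 0) * ?n (input_env ws 0))]"
        by (simp add: f_def reduction_map Let_def input_env_def del: upt_Suc)
    qed simp
  qed
  ultimately show ?thesis
    unfolding polytime_reducible_def by blast
qed

section \<open>From computations to clauses\<close>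

text \<open>A system of \<open>K\<close> tapes over \<open>A\<close> symbols with all heads at position 0: in each step, the
  symbols \<open>v\<close> under the heads determine the symbol \<open>fw v k\<close> written on tape \<open>k\<close> and the distance
  \<open>fd v k - 1\<close> by which the tape is then moved under its head.\<close>

locale shift_system =
  fixes K A :: nat and tups :: "nat list list" and fw fd :: "nat list \<Rightarrow> nat \<Rightarrow> nat"
  assumes K: "3 \<le> K" and A: "3 \<le> A" and tups: "set tups = {v. length v = K \<and> set v \<subseteq> {..<A}}"
    and fw: "\<And>v k. fw v k < A" and fd: "\<And>v k. fd v k \<le> 2"
begin

definition heads :: "(nat \<Rightarrow> int \<Rightarrow> nat) \<Rightarrow> nat list" where
  "heads s = map (\<lambda>j. s j 0) [0..<K]"

text \<open>Writing precedes moving, so the new symbol shows up where the source cell is 0. Each new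
  cell depends on one old cell and the heads.\<close>

definition shift :: "(nat \<Rightarrow> int \<Rightarrow> nat) \<Rightarrow> nat \<Rightarrow> int \<Rightarrow> nat" where
  "shift s k p =
     (if p + int (fd (heads s) k) - 1 = 0 then fw (heads s) k else s k (p + int (fd (heads s) k) - 1))"

definition start :: "bool list \<Rightarrow> bool list \<Rightarrow> nat \<Rightarrow> int \<Rightarrow> nat" where
  "start x u k p =
     (if p < 0 then 0 else if k = 0 then symbol_at x (nat p) else if k = 1 then symbol_at u (nat p) else 0)"

definition run :: "bool list \<Rightarrow> bool list \<Rightarrow> nat \<Rightarrow> nat \<Rightarrow> int \<Rightarrow> nat" where
  "run x u t = (shift ^^ t) (start x u)"

definition accepts :: "bool list \<Rightarrow> bool list \<Rightarrow> nat \<Rightarrow> bool" where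
  "accepts x u T \<longleftrightarrow> run x u T 0 0 = 2 \<and> run x u T 0 1 = 0"

lemma run_0: "run x u 0 = start x u"
  and run_Suc: "run x u (Suc t) = shift (run x u t)"
  by (simp_all add: run_def)

lemma run_less: "run x u t k p < A"
proof (induction t arbitrary: k p)
  case 0
  have "symbol_at y i < A" for y i
    using symbol_at_le[of y i] A by linarith
  then show ?case
    using A by (simp add: run_0 start_def)
next
  case (Suc t)
  then show ?case
    using fw by (simp add: run_Suc shift_def)
qed

lemma heads_in_tups: "heads (run x u t) \<in> set tups"
  unfolding tups heads_def using run_less by auto

lemma nth_heads: "j < K \<Longrightarrow> heads s ! j = s j 0"
  by (simp add: heads_def)

text \<open>The variable \<open>var Z t k z s\<close> expresses that after \<open>t\<close> steps the cell \<open>z\<close> of tape \<open>k\<close> contains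
  \<open>s\<close>, where the cells are counted such that the heads are at \<open>centre T Q\<close>.\<close>

definition centre :: "nat \<Rightarrow> nat \<Rightarrow> nat" where
  "centre T Q = T + Q + 2"

text \<open>The cells read at the end lie at distance at most 1 from the centre and depend on cells
  within distance \<open>T + 1\<close>; a certificate takes \<open>Q\<close> cells. The radius
  \<open>centre T Q\<close> covers both, and input symbols outside the window cannot influence the
  result.\<close>

definition window :: "nat \<Rightarrow> nat \<Rightarrow> nat" where
  "window T Q = Suc (2 * centre T Q)"

definition var :: "nat \<Rightarrow> nat \<Rightarrow> nat \<Rightarrow> nat \<Rightarrow> nat \<Rightarrow> nat" where
  "var Z t k z s = ((t * K + k) * Z + z) * A + s"

definition pos :: "nat \<Rightarrow> nat \<Rightarrow> nat \<Rightarrow> nat \<Rightarrow> nat \<Rightarrow> nat" where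
  "pos Z t k z s = 2 * var Z t k z s"

definition neg :: "nat \<Rightarrow> nat \<Rightarrow> nat \<Rightarrow> nat \<Rightarrow> nat \<Rightarrow> nat" where
  "neg Z t k z s = Suc (2 * var Z t k z s)"

text \<open>The clause is an implication: if the heads read tuple \<open>a\<close>, then the target
  cell holds the written symbol, or else inherits the symbol \<open>s\<close> of its source cell.
  The premise about the heads takes \<open>K\<close> literals and the rest at most two, whence the
  width \<open>K + 2\<close>.\<close>

definition step_lit :: "nat \<Rightarrow> nat \<Rightarrow> nat \<Rightarrow> nat \<Rightarrow> nat \<Rightarrow> nat \<Rightarrow> nat \<Rightarrow> nat \<Rightarrow> nat" where
  "step_lit B Z t a k z s j =
     (if j < K then neg Z t j B (tups ! a ! j)
      else if z + fd (tups ! a) k - 1 = B then pos Z (Suc t) k z (fw (tups ! a) k)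
      else if j = K then neg Z t k (z + fd (tups ! a) k - 1) s
      else pos Z (Suc t) k z s)"

text \<open>The first \<open>Q\<close> cells of tape 1 are left open, up to being one of the symbols
  0, 1, 2: a satisfying assignment chooses the certificate there. All other cells are fixed by unit
  clauses.\<close>

definition start_lit :: "nat \<Rightarrow> nat \<Rightarrow> nat \<Rightarrow> (nat \<Rightarrow> nat) \<Rightarrow> nat \<Rightarrow> nat \<Rightarrow> nat \<Rightarrow> nat" where
  "start_lit B Z Q X k z j =
     (if k = 1 \<and> B \<le> z \<and> z < B + Q then pos Z 0 1 z (if j < 3 then j else 0)
      else pos Z 0 k z (if k = 0 \<and> B \<le> z then X (z - B) else 0))"

text \<open>\<open>f\<close> selects a family: steps, initial tapes, a certificate staying blank
  after its first blank, and the exclusion of wrong output symbols. Outside these ranges the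
  literals 0 and 1, a variable and its negation, make the clause trivially true.\<close>

definition lit :: "nat \<Rightarrow> nat \<Rightarrow> (nat \<Rightarrow> nat) \<Rightarrow> nat \<Rightarrow> nat \<Rightarrow> nat \<Rightarrow> nat \<Rightarrow> nat \<Rightarrow> nat \<Rightarrow> nat \<Rightarrow> nat" where
  "lit T Q X f t a k z s j =
     (let B = centre T Q; Z = window T Q in
      if f = 0 \<and> t < T \<and> 1 \<le> z \<and> Suc z < Z then step_lit B Z t a k z s j
      else if f = 1 then start_lit B Z Q X k z j
      else if f = 2 \<and> B \<le> z \<and> Suc z < B + Q then if j = 0 then neg Z 0 1 z 0 else pos Z 0 1 (Suc z) 0
      else if f = 3 \<and> (z = B \<and> \<not> s = 2 \<or> z = Suc B \<and> \<not> s = 0) then neg Z T 0 z s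
      else if j = 0 then 0 else 1)"

text \<open>The clause number is read as digits in mixed radix, one for each parameter. Families
  that ignore a parameter merely repeat clauses.\<close>

definition clause :: "nat \<Rightarrow> nat \<Rightarrow> (nat \<Rightarrow> nat) \<Rightarrow> nat \<Rightarrow> nat \<Rightarrow> nat" where
  "clause T Q X c j =
     lit T Q X (c mod 4) (c div 4 div A div window T Q div K div length tups)
       (c div 4 div A div window T Q div K mod length tups) (c div 4 div A div window T Q mod K)
       (c div 4 div A mod window T Q) (c div 4 mod A) j"

definition num_clauses :: "nat \<Rightarrow> nat \<Rightarrow> nat" where
  "num_clauses T Q = Suc T * length tups * K * window T Q * A * 4"

definition num_lits :: "nat \<Rightarrow> nat \<Rightarrow> nat" where
  "num_lits T Q = 2 * (Suc T * K * window T Q * A)"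

lemma pack: "b < B \<Longrightarrow> a < C \<Longrightarrow> (a * B + b) div B = a \<and> (a * B + b) mod B = b \<and> a * B + b < C * (B :: nat)"
proof -
  assume *: "b < B" "a < C"
  have "a * B + b < Suc a * B"
    using * by simp
  also have "\<dots> \<le> C * B"
    using * by (intro mult_le_mono1) simp
  finally show ?thesis
    using * by simp
qed

lemma tups_pos: "0 < length tups"
proof -
  have "replicate K 0 \<in> set tups"
    unfolding tups using A by auto
  then show ?thesis
    by (rule length_pos_if_in_set)
qed

lemma satisfiable_clause_iff:
  "satisfiable (K + 2) (num_clauses T Q) (clause T Q X) \<longleftrightarrow>
    (\<exists>\<alpha>. \<forall>f<4. \<forall>t\<le>T. \<forall>a<length tups. \<forall>k<K. \<forall>z<window T Q. \<forall>s<A.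
       \<exists>j<K + 2. literal_true \<alpha> (lit T Q X f t a k z s j))"
proof -
  have *: "(\<forall>c<num_clauses T Q. P (c mod 4) (c div 4 div A div window T Q div K div length tups)
       (c div 4 div A div window T Q div K mod length tups) (c div 4 div A div window T Q mod K)
       (c div 4 div A mod window T Q) (c div 4 mod A)) \<longleftrightarrow>
     (\<forall>f<4. \<forall>t\<le>T. \<forall>a<length tups. \<forall>k<K. \<forall>z<window T Q. \<forall>s<A. P f t a k z s)" (is "?L \<longleftrightarrow> ?R") for P
  proof
    assume L: ?L
    show ?R
    proof (intro allI impI)
      fix f t a k z s
      assume b: "f < (4 :: nat)" "t \<le> T" "a < length tups" "k < K" "z < window T Q" "s < A"
      let ?c3 = "t * length tups + a"
      let ?c2 = "?c3 * K + k"
      let ?c1 = "?c2 * window T Q + z"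
      let ?c0 = "?c1 * A + s"
      have "t < Suc T"
        using b by simp
      note 3 = pack[OF b(3) this]
      note 2 = pack[OF b(4) conjunct2[OF conjunct2[OF 3]]]
      note 1 = pack[OF b(5) conjunct2[OF conjunct2[OF 2]]]
      note 0 = pack[OF b(6) conjunct2[OF conjunct2[OF 1]]]
      note 00 = pack[OF b(1) conjunct2[OF conjunct2[OF 0]]]
      have "?c0 * 4 + f < num_clauses T Q"
        using 00 unfolding num_clauses_def by blast
      from L[rule_format, OF this] show "P f t a k z s"
        using 00 0 1 2 3 by (simp only:)
    qed
  next
    assume R: ?R
    show ?L
    proof (intro allI impI)
      fix c
      assume "c < num_clauses T Q"
      then have "c div 4 div A div window T Q div K div length tups < Suc T"
        unfolding num_clauses_def by (intro less_mult_imp_div_less)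
      then show "P (c mod 4) (c div 4 div A div window T Q div K div length tups)
       (c div 4 div A div window T Q div K mod length tups) (c div 4 div A div window T Q mod K)
       (c div 4 div A mod window T Q) (c div 4 mod A)"
        using tups_pos K A by (intro R[rule_format]) (auto simp: window_def)
    qed
  qed
  show ?thesis
    unfolding satisfiable_def clause_def
  proof (rule ex_cong1)
    fix \<alpha>
    from *[of "\<lambda>f t a k z s. \<exists>j<K + 2. literal_true \<alpha> (lit T Q X f t a k z s j)"]
    show "(\<forall>c<num_clauses T Q. \<exists>j<K + 2. literal_true \<alpha>
        (lit T Q X (c mod 4) (c div 4 div A div window T Q div K div length tups)
          (c div 4 div A div window T Q div K mod length tups) (c div 4 div A div window T Q mod K)
          (c div 4 div A mod window T Q) (c div 4 mod A) j)) \<longleftrightarrow>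
      (\<forall>f<4. \<forall>t\<le>T. \<forall>a<length tups. \<forall>k<K. \<forall>z<window T Q. \<forall>s<A.
        \<exists>j<K + 2. literal_true \<alpha> (lit T Q X f t a k z s j))" .
  qed
qed

lemma var_less: "t \<le> T \<Longrightarrow> k < K \<Longrightarrow> z < window T Q \<Longrightarrow> s < A \<Longrightarrow> var (window T Q) t k z s < Suc T * K * window T Q * A"
  unfolding var_def using pack[of k K t "Suc T"] pack[of z "window T Q" "t * K + k" "Suc T * K"]
    pack[of s A "(t * K + k) * window T Q + z" "Suc T * K * window T Q"] by simp

lemma pos_less: "t \<le> T \<Longrightarrow> k < K \<Longrightarrow> z < window T Q \<Longrightarrow> s < A \<Longrightarrow> pos (window T Q) t k z s < num_lits T Q"
  and neg_less: "t \<le> T \<Longrightarrow> k < K \<Longrightarrow> z < window T Q \<Longrightarrow> s < A \<Longrightarrow> neg (window T Q) t k z s < num_lits T Q"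
  using var_less[of t T k z Q s] unfolding pos_def neg_def num_lits_def by linarith+

lemma tups_less: "a < length tups \<Longrightarrow> j < K \<Longrightarrow> tups ! a ! j < A"
proof -
  assume "a < length tups" "j < K"
  then have "tups ! a \<in> {v. length v = K \<and> set v \<subseteq> {..<A}}"
    using nth_mem tups by blast
  then show ?thesis
    using nth_mem[of j "tups ! a"] \<open>j < K\<close> by blast
qed

lemma lit_less:
  assumes "t \<le> T" "a < length tups" "k < K" "z < window T Q" "s < A" and X: "\<And>p. X p \<le> 2"
  shows "lit T Q X f t a k z s j < num_lits T Q"
proof -
  let ?B = "centre T Q"
  have B: "?B < window T Q" "Suc ?B < window T Q" "0 < K" "1 < K" "0 < A"
    using K A by (auto simp: window_def centre_def)
  have "X p < A" for p
    using X[of p] A by linarith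
  have "step_lit ?B (window T Q) t a k z s j < num_lits T Q" if "t < T" "1 \<le> z" "Suc z < window T Q"
  proof -
    have "z + fd (tups ! a) k - 1 < window T Q"
      using fd[of "tups ! a" k] that by linarith
    then show ?thesis
      unfolding step_lit_def using assms B that fw tups_less by (auto intro!: pos_less neg_less)
  qed
  moreover have "start_lit ?B (window T Q) Q X k z j < num_lits T Q"
    unfolding start_lit_def using assms B A \<open>\<And>p. X p < A\<close> by (auto intro!: pos_less)
  moreover have "1 < num_lits T Q"
    using B unfolding num_lits_def by (simp add: nat_0_less_mult_iff Suc_lessI)
  moreover have "Suc z < ?B + Q \<Longrightarrow> Suc z < window T Q"
    by (simp add: window_def centre_def)
  ultimately show ?thesis
    unfolding lit_def Let_def using assms B by (auto intro!: pos_less neg_less)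
qed

lemma clause_less:
  assumes "c < num_clauses T Q"
  shows "clause T Q (symbol_at x) c j < num_lits T Q"
proof -
  have "c div 4 div A div window T Q div K div length tups < Suc T"
    using assms unfolding num_clauses_def by (intro less_mult_imp_div_less)
  then show ?thesis
    unfolding clause_def using tups_pos K A by (intro lit_less symbol_at_le) (auto simp: window_def)
qed

section \<open>Correctness of the clauses in both directions\<close>

lemma literal_true_pos: "literal_true \<alpha> (pos Z t k z s) \<longleftrightarrow> \<alpha> (var Z t k z s)"
  and literal_true_neg: "literal_true \<alpha> (neg Z t k z s) \<longleftrightarrow> \<not> \<alpha> (var Z t k z s)"
  by (simp_all add: literal_true_def pos_def neg_def)

lemma accepts_satisfiable:
  assumes acc: "accepts x u T" and u: "length u \<le> Q"
  shows "satisfiable (K + 2) (num_clauses T Q) (clause T Q (symbol_at x))"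
proof -
  let ?B = "centre T Q" and ?Z = "window T Q"
  \<comment> \<open>The inverse of the numbering \<open>var\<close>: time, tape, cell and symbol are
    recovered from the number of the variable.\<close>
  define \<alpha> where "\<alpha> = (\<lambda>v. run x u (v div A div ?Z div K) (v div A div ?Z mod K) (int (v div A mod ?Z) - int ?B) = v mod A)"
  have \<alpha>: "\<alpha> (var ?Z t k z s) \<longleftrightarrow> run x u t k (int z - int ?B) = s" if "k < K" "z < ?Z" "s < A" for t k z s
    unfolding var_def \<alpha>_def
    using pack[OF that(1), of t "Suc t"] pack[OF that(2), of "t * K + k" "Suc (t * K + k)"]
      pack[OF that(3), of "(t * K + k) * ?Z + z" "Suc ((t * K + k) * ?Z + z)"] by simp
  have true: "literal_true \<alpha> (pos ?Z t k z s) \<longleftrightarrow> run x u t k (int z - int ?B) = s"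
      "literal_true \<alpha> (neg ?Z t k z s) \<longleftrightarrow> run x u t k (int z - int ?B) \<noteq> s"
    if "k < K" "z < ?Z" "s < A" for t k z s
    using \<alpha>[OF that] by (simp_all add: literal_true_pos literal_true_neg)
  have B: "?B < ?Z" "Suc ?B < ?Z" "0 < A" "1 < A" "2 < A" "1 < K" "0 < K"
    using A K by (auto simp: window_def centre_def)
  have "\<exists>j<K + 2. literal_true \<alpha> (lit T Q (symbol_at x) f t a k z s j)"
    if t: "t \<le> T" and a: "a < length tups" and k: "k < K" and z: "z < ?Z" and s: "s < A" for f t a k z s
  proof -
    consider "f = 0 \<and> t < T \<and> 1 \<le> z \<and> Suc z < ?Z" | "f = 1" | "f = 2 \<and> ?B \<le> z \<and> Suc z < ?B + Q"
      | "f = 3 \<and> (z = ?B \<and> \<not> s = 2 \<or> z = Suc ?B \<and> \<not> s = 0)"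
      | "lit T Q (symbol_at x) f t a k z s = (\<lambda>j. if j = 0 then 0 else 1)"
      unfolding lit_def Let_def by fastforce
    then show ?thesis
    proof cases
      case 1
      then have l: "lit T Q (symbol_at x) f t a k z s j = step_lit ?B ?Z t a k z s j" for j
        by (simp add: lit_def)
      let ?v = "tups ! a"
      let ?z = "z + fd ?v k - 1"
      show ?thesis
      proof (cases "heads (run x u t) = ?v")
        case False
        have "length ?v = K"
          using nth_mem[OF a] unfolding tups by simp
        then obtain j where j: "j < K" "run x u t j 0 \<noteq> ?v ! j"
          using False nth_equalityI[of "heads (run x u t)" ?v] nth_heads[of _ "run x u t"]
          by (auto simp: heads_def)
        then have "literal_true \<alpha> (step_lit ?B ?Z t a k z s j)"
          using true(2)[OF j(1) B(1) tups_less[OF a j(1)], of t] by (simp add: step_lit_def)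
        then show ?thesis
          unfolding l using j(1) by (intro exI[of _ j]) simp
      next
        case True
        have "int ?z = int z + int (fd ?v k) - 1"
          using 1 by simp
        then have step: "run x u (Suc t) k (int z - int ?B) =
            (if ?z = ?B then fw ?v k else run x u t k (int ?z - int ?B))"
          unfolding run_Suc shift_def True by (auto simp: algebra_simps)
        have z': "?z < ?Z"
          using fd[of ?v k] 1 by linarith
        show ?thesis
        proof (cases "?z = ?B")
          case True
          then have "literal_true \<alpha> (step_lit ?B ?Z t a k z s K)"
            using step true(1)[OF k z fw, of "Suc t" ?v k] by (simp add: step_lit_def)
          then show ?thesis
            unfolding l by (intro exI[of _ K]) simp
        next
          case False
          then have "literal_true \<alpha> (step_lit ?B ?Z t a k z s K) \<or> literal_true \<alpha> (step_lit ?B ?Z t a k z s (Suc K))"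
            using step true(1)[OF k z s, of "Suc t"] true(2)[OF k z' s, of t] by (simp add: step_lit_def)
          then show ?thesis
            unfolding l by (metis add_2_eq_Suc' lessI less_SucI)
        qed
      qed
    next
      case 2
      then have l: "lit T Q (symbol_at x) f t a k z s j = start_lit ?B ?Z Q (symbol_at x) k z j" for j
        by (simp add: lit_def)
      show ?thesis
      proof (cases "k = 1 \<and> ?B \<le> z \<and> z < ?B + Q")
        case True
        let ?j = "symbol_at u (z - ?B)"
        have j: "?j < 3"
          using symbol_at_le[of u "z - ?B"] by linarith
        then have "?j < A"
          using A by linarith
        then have "literal_true \<alpha> (pos ?Z 0 1 z ?j)"
          unfolding true(1)[OF B(6) z \<open>?j < A\<close>] using True by (simp add: run_0 start_def nat_diff_distrib')
        then show ?thesis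
          unfolding l start_lit_def using True j K by (intro exI[of _ ?j]) simp
      next
        case False
        let ?s = "if k = 0 \<and> ?B \<le> z then symbol_at x (z - ?B) else 0"
        have "?s < A"
          using symbol_at_le[of x "z - ?B"] A by auto
        moreover have "run x u 0 k (int z - int ?B) = ?s"
          using False u symbol_at_eq_0[of u "z - ?B"] by (auto simp: run_0 start_def nat_diff_distrib')
        ultimately have "literal_true \<alpha> (pos ?Z 0 k z ?s)"
          using true(1)[OF k z] by blast
        then show ?thesis
          unfolding l start_lit_def using False K by (intro exI[of _ 0]) (auto simp del: One_nat_def)
      qed
    next
      case 3
      then have l: "lit T Q (symbol_at x) f t a k z s j = (if j = 0 then neg ?Z 0 1 z 0 else pos ?Z 0 1 (Suc z) 0)" for j
        by (simp add: lit_def)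
      have z': "Suc z < ?Z"
        using 3 by (simp add: window_def centre_def)
      have "run x u 0 1 (int z - int ?B) \<noteq> 0 \<or> run x u 0 1 (int (Suc z) - int ?B) = 0"
        using 3 symbol_at_eq_0[of u] by (auto simp: run_0 start_def nat_diff_distrib' Suc_nat_eq_nat_zadd1)
      then have "literal_true \<alpha> (neg ?Z 0 1 z 0) \<or> literal_true \<alpha> (pos ?Z 0 1 (Suc z) 0)"
        unfolding true(2)[OF B(6) z B(3)] true(1)[OF B(6) z' B(3)] .
      then show ?thesis
        unfolding l using K by (auto intro: exI[of _ 0] exI[of _ 1])
    next
      case 4
      then have l: "lit T Q (symbol_at x) f t a k z s j = neg ?Z T 0 z s" for j
        by (auto simp: lit_def)
      have "run x u T 0 (int z - int ?B) \<noteq> s"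
        using 4 acc by (auto simp: accepts_def)
      then have "literal_true \<alpha> (neg ?Z T 0 z s)"
        using true(2)[OF B(7) z s] by blast
      then show ?thesis
        unfolding l by (intro exI[of _ 0]) simp
    next
      case 5
      have "literal_true \<alpha> 0 \<or> literal_true \<alpha> 1"
        by (simp add: literal_true_def)
      then show ?thesis
        unfolding 5 using K by (auto intro: exI[of _ 0] exI[of _ 1])
    qed
  qed
  then show ?thesis
    unfolding satisfiable_clause_iff by blast
qed

text \<open>Several symbols may be marked in one cell. It suffices that the symbol of the actual
  run, on a certificate read off the assignment, is always among them.\<close>

lemma satisfiable_accepts:
  assumes "satisfiable (K + 2) (num_clauses T Q) (clause T Q (symbol_at x))"
  shows "\<exists>u. length u \<le> Q \<and> accepts x u T"
proof -
  let ?B = "centre T Q" and ?Z = "window T Q"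
  obtain \<alpha> where \<alpha>: "\<And>f t a k z s. f < 4 \<Longrightarrow> t \<le> T \<Longrightarrow> a < length tups \<Longrightarrow> k < K \<Longrightarrow> z < ?Z \<Longrightarrow> s < A \<Longrightarrow>
      \<exists>j<K + 2. literal_true \<alpha> (lit T Q (symbol_at x) f t a k z s j)"
    using assms unfolding satisfiable_clause_iff by blast
  define V where "V = (\<lambda>t k z s. \<alpha> (var ?Z t k z s))"
  have true: "literal_true \<alpha> (pos ?Z t k z s) = V t k z s" "literal_true \<alpha> (neg ?Z t k z s) = (\<not> V t k z s)" for t k z s
    by (simp_all add: V_def literal_true_pos literal_true_neg)
  have B: "?B < ?Z" "Suc ?B < ?Z" "0 < A" "1 < A" "2 < A" "1 < K" "0 < K" "?B + Q < ?Z"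
    using A K by (auto simp: window_def centre_def)
  have start_clause: "\<exists>j<K + 2. literal_true \<alpha> (start_lit ?B ?Z Q (symbol_at x) k z j)" if "k < K" "z < ?Z" for k z
    using \<alpha>[of 1 0 0 k z 0] that tups_pos B by (simp add: lit_def)
  have cell: "V 0 1 (?B + p) 0 \<or> V 0 1 (?B + p) 1 \<or> V 0 1 (?B + p) 2" if p: "p < Q" for p
  proof -
    obtain j where "literal_true \<alpha> (pos ?Z 0 1 (?B + p) (if j < 3 then j else 0))"
      using start_clause[of 1 "?B + p"] p B by (auto simp: start_lit_def)
    moreover have "(if j < 3 then j else 0) = 0 \<or> (if j < 3 then j else 0) = 1 \<or> (if j < 3 then j else 0) = 2"
      by auto
    ultimately show ?thesis
      unfolding true by metis
  qed
  have blank: "V 0 1 (?B + Suc p) 0" if p: "V 0 1 (?B + p) 0" "Suc p < Q" for p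
  proof -
    have "\<exists>j<K + 2. literal_true \<alpha> (if j = 0 then neg ?Z 0 1 (?B + p) 0 else pos ?Z 0 1 (Suc (?B + p)) 0)"
      using \<alpha>[of 2 0 0 0 "?B + p" 0] p tups_pos B by (simp add: lit_def Let_def)
    then obtain j :: nat where "literal_true \<alpha> (if j = 0 then neg ?Z 0 1 (?B + p) 0 else pos ?Z 0 1 (Suc (?B + p)) 0)"
      by blast
    then show ?thesis
      using p(1) true by (cases "j = 0") auto
  qed
  \<comment> \<open>The first blank ends the certificate; if there is none among the
    \<open>Q\<close> cells, the certificate fills them all.\<close>
  define len where "len = (LEAST p. Q \<le> p \<or> V 0 1 (?B + p) 0)"
  have len: "Q \<le> len \<or> V 0 1 (?B + len) 0"
    unfolding len_def by (rule LeastI[of _ Q]) simp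
  have "len \<le> Q"
    unfolding len_def by (rule Least_le) simp
  have before: "\<not> V 0 1 (?B + p) 0" if "p < len" for p
    using not_less_Least[of p "\<lambda>p. Q \<le> p \<or> V 0 1 (?B + p) 0"] that unfolding len_def by blast
  have after: "V 0 1 (?B + p) 0" if "len \<le> p" "p < Q" for p
    using that
  proof (induction p rule: dec_induct)
    case base
    then show ?case
      using len by simp
  next
    case (step p)
    then show ?case
      using blank by simp
  qed
  \<comment> \<open>Before \<open>len\<close> the blank is not marked, so a cell without mark 2 has
    mark 1; if both are marked, 2 is preferred.\<close>
  define u where "u = map (\<lambda>p. V 0 1 (?B + p) 2) [0..<len]"
  have "length u = len"
    by (simp add: u_def)
  have cert: "V 0 1 (?B + p) (symbol_at u p)" if "p < Q" for p
  proof (cases "p < len")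
    case True
    then show ?thesis
      using cell[OF that] before[OF True] by (auto simp: symbol_at_def u_def bit_symbol_def)
  next
    case False
    then show ?thesis
      using after[of p] that \<open>length u = len\<close> by (simp add: symbol_at_def)
  qed
  have base: "V 0 k z (start x u k (int z - int ?B))" if kz: "k < K" "z < ?Z" for k z
  proof (cases "k = 1 \<and> ?B \<le> z \<and> z < ?B + Q")
    case True
    then show ?thesis
      using cert[of "z - ?B"] by (auto simp: start_def nat_diff_distrib')
  next
    case False
    have "start x u k (int z - int ?B) = (if k = 0 \<and> ?B \<le> z then symbol_at x (z - ?B) else 0)"
      using False \<open>length u = len\<close> \<open>len \<le> Q\<close> symbol_at_eq_0[of u "z - ?B"]
      by (auto simp: start_def nat_diff_distrib')
    then show ?thesis
      using start_clause[OF kz] False unfolding start_lit_def by (auto simp: true)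
  qed
  \<comment> \<open>The clauses determine a cell only as long as its value does not depend on cells outside the
    window, which takes at least as many steps as its distance from the border.\<close>
  have cone: "V t k z (run x u t k (int z - int ?B))" if "t \<le> T" "k < K" "t \<le> z" "z + t < ?Z" for t k z
    using that
  proof (induction t arbitrary: k z)
    case 0
    then show ?case
      using base by (simp add: run_0)
  next
    case (Suc t)
    let ?v = "heads (run x u t)"
    obtain a where a: "a < length tups" "tups ! a = ?v"
      using heads_in_tups by (metis in_set_conv_nth)
    let ?z = "z + fd ?v k - 1"
    let ?s = "run x u t k (int ?z - int ?B)"
    have z': "t \<le> ?z" "?z + t < ?Z"
      using Suc.prems fd[of ?v k] by linarith+
    have "int ?z = int z + int (fd ?v k) - 1"
      using Suc.prems by simp
    then have step: "run x u (Suc t) k (int z - int ?B) = (if ?z = ?B then fw ?v k else ?s)"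
      unfolding run_Suc shift_def by (auto simp: algebra_simps)
    have src: "V t k ?z ?s"
      using Suc.IH[of k ?z] Suc.prems z' by simp
    have hd: "V t j ?B (tups ! a ! j)" if "j < K" for j
      using Suc.IH[of j ?B] Suc.prems that a nth_heads[OF that, of "run x u t"]
      by (simp add: window_def centre_def)
    have "t \<le> T" "z < ?Z" "t < T" "1 \<le> z" "Suc z < ?Z"
      using Suc.prems by auto
    then obtain j where j: "literal_true \<alpha> (step_lit ?B ?Z t a k z ?s j)"
      using \<alpha>[of 0 t a k z ?s] a(1) Suc.prems(2) run_less by (auto simp: lit_def)
    \<comment> \<open>The symbols under the heads are marked, so the premise literals fail and the
      conclusion has to hold.\<close>
    then have "\<not> j < K"
      using hd unfolding step_lit_def by (auto simp: true)
    then have "V (Suc t) k z (if ?z = ?B then fw ?v k else ?s)"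
      using j src unfolding step_lit_def a(2) by (auto simp: true split: if_splits)
    then show ?case
      unfolding step .
  qed
  \<comment> \<open>Wrong output symbols are unmarked while the actual ones are marked, so the
    actual output is right.\<close>
  have final: "\<not> V T 0 z s" if "z = ?B \<and> s \<noteq> 2 \<or> z = Suc ?B \<and> s \<noteq> 0" "s < A" for z s
  proof -
    have "lit T Q (symbol_at x) 3 0 0 0 z s j = neg ?Z T 0 z s" for j
      using that by (auto simp: lit_def)
    then show ?thesis
      using \<alpha>[of 3 0 0 0 z s] that tups_pos B by (auto simp: true)
  qed
  have "run x u T 0 0 = 2"
    using cone[of T 0 ?B] final[of ?B "run x u T 0 0"] run_less[of x u T 0 0] B
    by (auto simp: window_def centre_def)
  moreover have "run x u T 0 1 = 0"
    using cone[of T 0 "Suc ?B"] final[of "Suc ?B" "run x u T 0 1"] run_less[of x u T 0 1] B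
    by (auto simp: window_def centre_def)
  ultimately show ?thesis
    using \<open>length u = len\<close> \<open>len \<le> Q\<close> unfolding accepts_def by metis
qed

text \<open>Everything in a literal is arithmetic except the access to \<open>tups\<close>,
  \<open>fw\<close> and \<open>fd\<close>. These are finite functions of a tuple index and a tape,
  hence tables; they agree with the originals on the index range that decoding a clause number
  produces.\<close>

lemma definable_clause:
  "definable (\<lambda>w \<rho>. clause (poly T (\<rho> 0)) (poly Q (\<rho> 0)) (w b) (\<rho> 1) (\<rho> 2))"
proof -
  define tab where "tab = (\<lambda>(g :: nat list \<Rightarrow> nat \<Rightarrow> nat) a k.
    table (length tups * K) (\<lambda>i. g (tups ! (i div K)) (i mod K)) (a * K + k))"
  have tab: "tab g a k = g (tups ! a) k" if "a < length tups" "k < K" for g a k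
    using pack[OF that(2,1)] by (simp add: tab_def table_def)
  have def_tab: "definable f \<Longrightarrow> definable g \<Longrightarrow> definable (\<lambda>w \<rho>. tab h (f w \<rho>) (g w \<rho>))" for h f g
    unfolding tab_def by (intro definable_intros)
  define lit' where "lit' = (\<lambda>T Q X (f :: nat) t a k z s j.
     let B = centre T Q; Z = window T Q in
      if f = 0 \<and> t < T \<and> 1 \<le> z \<and> Suc z < Z then
        (if j < K then neg Z t j B (tab (!) a j)
         else if z + tab fd a k - 1 = B then pos Z (Suc t) k z (tab fw a k)
         else if j = K then neg Z t k (z + tab fd a k - 1) s
         else pos Z (Suc t) k z s)
      else if f = 1 then start_lit B Z Q X k z j
      else if f = 2 \<and> B \<le> z \<and> Suc z < B + Q then if j = 0 then neg Z 0 1 z 0 else pos Z 0 1 (Suc z) 0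
      else if f = 3 \<and> (z = B \<and> \<not> s = 2 \<or> z = Suc B \<and> \<not> s = 0) then neg Z T 0 z s
      else if j = 0 then 0 else 1 :: nat)"
  have lit': "lit T Q X f t a k z s j = lit' T Q X f t a k z s j" if "a < length tups" "k < K" for T Q X f t a k z s j
  proof -
    have "j < K \<Longrightarrow> tab (!) a j = tups ! a ! j"
      using tab[OF that(1), of j "(!)"] by simp
    then show ?thesis
      unfolding lit_def lit'_def step_lit_def by (simp add: Let_def tab[OF that] cong: if_cong)
  qed
  have eq: "clause T Q X c j = lit' T Q X (c mod 4) (c div 4 div A div window T Q div K div length tups)
       (c div 4 div A div window T Q div K mod length tups) (c div 4 div A div window T Q mod K)
       (c div 4 div A mod window T Q) (c div 4 mod A) j" for T Q X c j
    unfolding clause_def using tups_pos K by (intro lit') auto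
  show ?thesis
    unfolding eq lit'_def Let_def start_lit_def pos_def neg_def var_def window_def centre_def
    by (intro definable_intros def_tab)
qed

end

section \<open>Turing machines as shift systems\<close>

lemma shows_word_unique:
  assumes "shows_word T y" "shows_word T y'"
  shows "y = y'"
proof -
  obtain t h where T: "T = (t, h)"
    by (cases T)
  have nz: "bit_symbol b \<noteq> 0" for b
    by (simp add: bit_symbol_def)
  have "\<not> length y < length y'" "\<not> length y' < length y"
    using assms nz unfolding T by (simp, metis)+
  then have "length y = length y'"
    by simp
  moreover have "bit_symbol b = bit_symbol b' \<Longrightarrow> b = b'" for b b'
    by (simp add: bit_symbol_def split: if_splits)
  ultimately show ?thesis
    using assms unfolding T by (intro nth_equalityI) (simp, metis shows_word.simps)
qed

lemma halted_step: "halted M c \<Longrightarrow> step M c = c"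
  by (cases c) simp

lemma halted_steps: "halted M c \<Longrightarrow> (step M ^^ t) c = c"
  by (induction t) (auto simp: halted_step)

lemma computes_within_mono:
  assumes "computes_within M ws T y" "T \<le> T'"
  shows "computes_within M ws T' y"
proof -
  have "(step M ^^ T') c = (step M ^^ (T' - T)) ((step M ^^ T) c)" for c
    using assms(2) by (metis comp_apply funpow_add le_add_diff_inverse2)
  then show ?thesis
    using assms(1) halted_steps unfolding computes_within_def Let_def by metis
qed

locale machine_shift =
  fixes M :: tm
  assumes wf: "wf_tm M" and two: "2 \<le> tapes M"
begin

text \<open>The control state is kept as a symbol on an additional tape, so states and tape symbols
  share one alphabet.\<close>

definition alphabet :: nat where
  "alphabet = symbols M + states M"

definition move :: "nat list \<Rightarrow> (nat \<times> (nat \<times> dir) list) option" where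
  "move v = trans M (v ! tapes M) (take (tapes M) v)"

text \<open>In a halting situation the symbol read is written back, so that the system stands still
  together with the machine. Tuples that no computation meets may give anything; the final test
  forces the value into the alphabet for them as well.\<close>

definition write_at :: "nat list \<Rightarrow> nat \<Rightarrow> nat" where
  "write_at v k =
     (let r = (case move v of None \<Rightarrow> v ! k | Some (q, as) \<Rightarrow> if k < tapes M then fst (as ! k) else q)
      in if r < alphabet then r else 0)"

fun displacement :: "dir \<Rightarrow> nat" where
  "displacement Lft = 0"
| "displacement Stay = 1"
| "displacement Rgt = 2"

definition move_at :: "nat list \<Rightarrow> nat \<Rightarrow> nat" where
  "move_at v k =
     (case move v of None \<Rightarrow> 1 | Some (q, as) \<Rightarrow> if k < tapes M then displacement (snd (as ! k)) else 1)"

definition tuples :: "nat list list" where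
  "tuples = (SOME xs. set xs = {v. length v = Suc (tapes M) \<and> set v \<subseteq> {..<alphabet}})"

lemma set_tuples: "set tuples = {v. length v = Suc (tapes M) \<and> set v \<subseteq> {..<alphabet}}"
proof -
  have "finite {v. length v = Suc (tapes M) \<and> set v \<subseteq> {..<alphabet}}"
    using finite_lists_length_eq[of "{..<alphabet}" "Suc (tapes M)"] by (simp add: conj_commute)
  then show ?thesis
    unfolding tuples_def by (rule someI_ex[OF finite_list])
qed

lemma displacement_le: "displacement d \<le> 2"
  by (cases d) auto

sublocale shift_system "Suc (tapes M)" alphabet tuples write_at move_at
proof
  show "3 \<le> alphabet" "3 \<le> Suc (tapes M)"
    using wf two by (auto simp: wf_tm_def alphabet_def)
  show "write_at v k < alphabet" for v k
    using wf by (auto simp: write_at_def wf_tm_def alphabet_def Let_def)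
  show "move_at v k \<le> 2" for v k
    using displacement_le by (auto simp: move_at_def split: option.split)
qed (rule set_tuples)

text \<open>The ranges of states and symbols are part of the relation because \<open>wf_tm\<close>
  restricts transitions only there. The additional tape shows the state at cell 0 and is blank
  elsewhere, and since the start state is 0 it begins as a blank tape.\<close>

definition represents :: "(nat \<Rightarrow> int \<Rightarrow> nat) \<Rightarrow> config \<Rightarrow> bool" where
  "represents s c \<longleftrightarrow> fst c < states M \<and> length (snd c) = tapes M \<and>
     (\<forall>k<tapes M. \<forall>p. s k p = fst (snd c ! k) (snd (snd c ! k) + p)) \<and>
     (\<forall>k<tapes M. \<forall>p. fst (snd c ! k) p < symbols M) \<and>
     (\<forall>p. s (tapes M) p = (if p = 0 then fst c else 0))"

lemma represents_start: "represents (start x u) (init_config M [x, u])"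
proof -
  let ?ws = "[x, u] @ replicate (tapes M - 2) []"
  have ts: "snd (init_config M [x, u]) ! k = word_tape (?ws ! k)" and l: "length (snd (init_config M [x, u])) = tapes M"
    if "k < tapes M" for k
    using two that nth_map[of k ?ws word_tape] by (simp_all add: init_config_def numeral_2_eq_2)
  have "start x u k p = fst (word_tape (?ws ! k)) p" if "k < tapes M" for k p
    using that by (cases k; cases "k - 1") (auto simp: start_def word_tape_symbols symbol_at_def)
  moreover have "fst (word_tape w) p < symbols M" for w p
  proof -
    have "fst (word_tape w) p \<le> 2"
      by (auto simp: word_tape_symbols symbol_at_le)
    then show ?thesis
      using wf by (auto simp: wf_tm_def)
  qed
  moreover have "snd (word_tape w) = 0" for w
    by (simp add: word_tape_def)
  ultimately show ?thesis
    unfolding represents_def using ts l two wf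
    by (auto simp: start_def wf_tm_def init_config_def simp del: append.simps)
qed

lemma represents_step:
  assumes "represents s c"
  shows "represents (shift s) (step M c)"
proof -
  let ?N = "tapes M"
  obtain q ts where c: "c = (q, ts)"
    by (cases c)
  have q: "q < states M" and len: "length ts = ?N"
    and s: "\<And>k p. k < ?N \<Longrightarrow> s k p = fst (ts ! k) (snd (ts ! k) + p)"
    and sym: "\<And>k p. k < ?N \<Longrightarrow> fst (ts ! k) p < symbols M"
    and sN: "\<And>p. s ?N p = (if p = 0 then q else 0)"
    using assms unfolding represents_def c by auto
  let ?v = "heads s"
  have read: "read_tape T = fst T (snd T)" for T
    by (cases T) simp
  have v: "?v ! ?N = q" "take ?N ?v = map read_tape ts"
    using len s sN nth_heads[of ?N s] by (auto simp: heads_def read simp del: upt_Suc intro!: nth_equalityI)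
  then have move: "move ?v = trans M q (map read_tape ts)"
    by (simp add: move_def)
  show ?thesis
  proof (cases "trans M q (map read_tape ts)")
    case None
    have "shift s k p = s k p" if "k \<le> ?N" for k p
    proof -
      have "s k 0 < alphabet"
        using that s[of k 0] sym[of k "snd (ts ! k)"] sN[of 0] q
        by (cases "k = ?N") (auto simp: alphabet_def)
      then have "write_at ?v k = s k 0" "move_at ?v k = 1"
        using that by (simp_all add: write_at_def move_at_def move None nth_heads)
      then show ?thesis
        by (simp add: shift_def)
    qed
    then show ?thesis
      using assms None unfolding represents_def c by simp
  next
    case (Some r)
    obtain q' as where r: "r = (q', as)"
      by (cases r)
    have "read_tape (ts ! k) < symbols M" if "k < ?N" for k
      using sym[OF that] by (simp add: read)
    then have "length (map read_tape ts) = ?N" "set (map read_tape ts) \<subseteq> {..<symbols M}"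
      using len by (auto simp: set_conv_nth simp del: read_tape.simps)
    then have wf': "q' < states M" "length as = ?N" "fst ` set as \<subseteq> {..<symbols M}"
      using wf q Some unfolding wf_tm_def r by blast+
    have as: "fst (as ! k) < symbols M" if "k < ?N" for k
    proof -
      have "as ! k \<in> set as"
        using wf'(2) that by simp
      then show ?thesis
        using wf'(3) by blast
    qed
    have step: "step M c = (q', map2 act as ts)"
      by (simp add: c Some r)
    have ts': "map2 act as ts ! k = act (as ! k) (ts ! k)" if "k < ?N" for k
      using that len wf' by simp
    have w: "write_at ?v k = fst (as ! k)" "move_at ?v k = displacement (snd (as ! k))" if "k < ?N" for k
      using as[OF that] that by (simp_all add: write_at_def move_at_def move Some r alphabet_def)
    have wN: "write_at ?v ?N = q'" "move_at ?v ?N = 1"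
      using wf'(1) by (simp_all add: write_at_def move_at_def move Some r alphabet_def)
    have "shift s k p = fst (act (as ! k) (ts ! k)) (snd (act (as ! k) (ts ! k)) + p)" if "k < ?N" for k p
    proof -
      obtain a d t h where "as ! k = (a, d)" "ts ! k = (t, h)"
        by (metis surj_pair)
      then show ?thesis
        using w[OF that] s[OF that] by (cases d) (auto simp: shift_def algebra_simps)
    qed
    moreover have "fst (act (as ! k) (ts ! k)) p < symbols M" if "k < ?N" for k p
      using as[OF that] sym[OF that] by (cases "as ! k"; cases "ts ! k") auto
    moreover have "shift s ?N p = (if p = 0 then q' else 0)" for p
      using wN sN by (simp add: shift_def)
    ultimately show ?thesis
      unfolding represents_def step using ts' wf' len by simp
  qed
qed

lemma represents_run: "represents (run x u t) ((step M ^^ t) (init_config M [x, u]))"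
  by (induction t) (simp_all add: run_0 run_Suc represents_start represents_step)

lemma accepts_iff:
  assumes "computes_within M [x, u] T y"
  shows "accepts x u T \<longleftrightarrow> y = [True]"
proof -
  let ?c = "(step M ^^ T) (init_config M [x, u])"
  obtain t h where th: "snd ?c ! 0 = (t, h)"
    by (cases "snd ?c ! 0")
  have "run x u T 0 p = t (h + p)" for p
    using represents_run[of x u T] two th unfolding represents_def by simp
  then have "accepts x u T \<longleftrightarrow> shows_word (snd ?c ! 0) [True]"
    unfolding accepts_def th by (auto simp: bit_symbol_def)
  moreover have "shows_word (snd ?c ! 0) y"
    using assms unfolding computes_within_def Let_def by blast
  ultimately show ?thesis
    using shows_word_unique by blast
qed

end

section \<open>NP-hardness and NP-completeness\<close>

lemma split_src_problem_NP_hard: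
  assumes "3 \<le> k"
  shows "NP_hard (split_src_problem k)"
  unfolding NP_hard_def
proof
  fix L
  assume "L \<in> NP"
  then obtain V and p :: "nat poly" where "polytime 2 V"
    and L: "\<And>x. x \<in> L \<longleftrightarrow> (\<exists>u. length u \<le> poly p (length x) \<and> V [x, u] = [True])"
    unfolding NP_def by blast
  then obtain M t where M: "wf_tm M" "2 \<le> tapes M"
    and V: "\<And>ws. length ws = 2 \<Longrightarrow> computes_within M ws (poly t (sum_list (map length ws))) (V ws)"
    unfolding polytime_def by blast
  interpret machine_shift M
    using M by unfold_locales
  \<comment> \<open>The clauses are built from the input alone, so the number of steps must be the
    same for all certificates; a longer run does not change the result.\<close>
  define T where "T = pcompose t ([:0, 1:] + p)"
  have acc: "accepts x u (poly T (length x)) \<longleftrightarrow> V [x, u] = [True]" if "length u \<le> poly p (length x)" for x u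
  proof (rule accepts_iff, rule computes_within_mono)
    show "computes_within M [x, u] (poly t (length x + length u)) (V [x, u])"
      using V[of "[x, u]"] by simp
    show "poly t (length x + length u) \<le> poly T (length x)"
      using that by (simp add: T_def poly_pcompose poly_nat_mono)
  qed
  have num: "definable (\<lambda>w \<rho>. num_clauses (poly T (\<rho> 0)) (poly p (\<rho> 0)))"
    "definable (\<lambda>w \<rho>. num_lits (poly T (\<rho> 0)) (poly p (\<rho> 0)))"
    unfolding num_clauses_def num_lits_def window_def centre_def by (intro definable_intros)+
  show "polytime_reducible L (split_src_problem k)"
  proof (rule polytime_reducible_clauses[OF assms _ num, where W = "Suc (tapes M) + 2" and
        lit = "\<lambda>X l. clause (poly T l) (poly p l) X"])
    show "x \<in> L \<longleftrightarrow> satisfiable (Suc (tapes M) + 2) (num_clauses (poly T (length x)) (poly p (length x)))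
        (clause (poly T (length x)) (poly p (length x)) (symbol_at x))" for x
      unfolding L using acc accepts_satisfiable satisfiable_accepts by metis
    show "definable (\<lambda>w \<rho>. clause (poly T (\<rho> 0)) (poly p (\<rho> 0)) (w False) (\<rho> 1) (\<rho> 2))"
      by (rule definable_clause)
  qed (simp_all add: clause_less)
qed

theorem theorem2:
  fixes k :: nat
  assumes "k \<ge> 3"
  shows "NP_complete (split_src_problem k)"
  unfolding NP_complete_def using split_src_problem_NP split_src_problem_NP_hard assms by simp

end
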